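(* Let $(\Lambda V,d)$ be a 1-connected elliptic minimal Sullivan model over $\mathbb{Q}$ which is formal and hyperelliptic. Then $\dim_{\mathbb{Q}} H^*(\Lambda V,d)\geq \dim_{\mathbb{Q}} V$.
   Context: For a graded $\mathbb{Q}$-vector space $V$, $\Lambda V$ is the free graded-commutative algebra on $V$, $\Lambda^k V$ is the span of the elements of wordlength $k$, $\Lambda^{\geq n}V=\bigoplus_{k\geq n}\Lambda^kV$ and $\Lambda^+V=\Lambda^{\geq 1}V$. A minimal Sullivan model is a commutative differential graded algebra $(\Lambda V,d)$ over $\mathbb{Q}$, satisfying the usual Sullivan nilpotence condition, with $dV\subset \Lambda^{\geq 2}V$. It is 1-connected if $V$ is concentrated in degrees $\geq 2$, and elliptic if both $V$ and $H^*(\Lambda V,d)$ are finite dimensional. Writing $V^{\text{even}}$ and $V^{\text{odd}}$ for the parts of $V$ in even and odd degrees, $(\Lambda V,d)$ is hyperelliptic if $dV^{\text{even}}=0$ and $dV^{\text{odd}}\subset \Lambda^+V^{\text{even}}\otimes \Lambda V^{\text{odd}}$. It is formal if $(\Lambda V,d)$ is quasi-isomorphic, as a commutative differential graded algebra, to $(H^*(\Lambda V,d),0)$. Dimensions are total dimensions over all degrees. *)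

theory Defs
  imports "Jordan_Normal_Form.VS_Connect" "HOL-Library.Poly_Mapping" "HOL-Algebra.QuotRing"
begin

section \<open>Commutative differential graded algebras over the rationals\<close>

abbreviation rat_field :: "rat ring" where
  "rat_field \<equiv> class_ring"

record 'a dg_algebra = "(rat, 'a) module" +
  grade :: "nat \<Rightarrow> 'a set"
  diff :: "'a \<Rightarrow> 'a"

locale cdga = ring A + vectorspace rat_field A
  for A :: "'a dg_algebra" (structure) +
  assumes smult_mult_left:
      "\<lbrakk>x \<in> carrier A; y \<in> carrier A\<rbrakk> \<Longrightarrow> (c \<odot> x) \<otimes> y = c \<odot> (x \<otimes> y)"
    and smult_mult_right:
      "\<lbrakk>x \<in> carrier A; y \<in> carrier A\<rbrakk> \<Longrightarrow> x \<otimes> (c \<odot> y) = c \<odot> (x \<otimes> y)"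
    and grade_subspace: "VectorSpace.subspace rat_field (grade A n) A"
    and grade_decomposition:
      "x \<in> carrier A \<Longrightarrow>
        \<exists>!f. (\<forall>n. f n \<in> grade A n) \<and> finite {n. f n \<noteq> \<zero>} \<and> x = (\<Oplus>n\<in>{n. f n \<noteq> \<zero>}. f n)"
    and one_grade: "\<one> \<in> grade A 0"
    and mult_grade: "\<lbrakk>x \<in> grade A i; y \<in> grade A j\<rbrakk> \<Longrightarrow> x \<otimes> y \<in> grade A (i + j)"
    and graded_commutative:
      "\<lbrakk>x \<in> grade A i; y \<in> grade A j\<rbrakk> \<Longrightarrow> x \<otimes> y = ((- 1) ^ (i * j)) \<odot> (y \<otimes> x)"
    and diff_add:
      "\<lbrakk>x \<in> carrier A; y \<in> carrier A\<rbrakk> \<Longrightarrow> diff A (x \<oplus> y) = diff A x \<oplus> diff A y"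
    and diff_smult: "x \<in> carrier A \<Longrightarrow> diff A (c \<odot> x) = c \<odot> diff A x"
    and diff_grade: "x \<in> grade A n \<Longrightarrow> diff A x \<in> grade A (Suc n)"
    and diff_diff: "x \<in> carrier A \<Longrightarrow> diff A (diff A x) = \<zero>"
    and leibniz:
      "\<lbrakk>x \<in> grade A i; y \<in> carrier A\<rbrakk> \<Longrightarrow>
        diff A (x \<otimes> y) = diff A x \<otimes> y \<oplus> ((- 1) ^ i) \<odot> (x \<otimes> diff A y)"

definition cdga_hom :: "'a dg_algebra \<Rightarrow> 'b dg_algebra \<Rightarrow> ('a \<Rightarrow> 'b) set" where
  "cdga_hom A B = {f \<in> Ring.ring_hom A B.
     (\<forall>c. \<forall>x\<in>carrier A. f (c \<odot>\<^bsub>A\<^esub> x) = c \<odot>\<^bsub>B\<^esub> f x) \<and>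
     (\<forall>n. f ` grade A n \<subseteq> grade B n) \<and>
     (\<forall>x\<in>carrier A. f (diff A x) = diff B (f x))}"


section \<open>Cohomology and formality\<close>

definition cocycles :: "'a dg_algebra \<Rightarrow> 'a set" where
  "cocycles A = {x \<in> carrier A. diff A x = \<zero>\<^bsub>A\<^esub>}"

definition coboundaries :: "'a dg_algebra \<Rightarrow> 'a set" where
  "coboundaries A = diff A ` carrier A"

definition cohomology_ring :: "'a dg_algebra \<Rightarrow> 'a set ring" where
  "cohomology_ring A = A\<lparr>carrier := cocycles A\<rparr> Quot coboundaries A"

text \<open>The cohomology algebra, regarded as a CDGA with zero differential; its elements are the
  cosets of the coboundaries in the cocycles.\<close>

definition cohomology :: "'a dg_algebra \<Rightarrow> 'a set dg_algebra" where
  "cohomology A =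
    \<lparr>carrier = carrier (cohomology_ring A),
     mult = mult (cohomology_ring A),
     one = one (cohomology_ring A),
     zero = zero (cohomology_ring A),
     add = add (cohomology_ring A),
     smult = (\<lambda>c K. \<Union>x\<in>K. coboundaries A +>\<^bsub>A\<^esub> (c \<odot>\<^bsub>A\<^esub> x)),
     grade = (\<lambda>n. (\<lambda>x. coboundaries A +>\<^bsub>A\<^esub> x) ` (cocycles A \<inter> grade A n)),
     diff = (\<lambda>K. zero (cohomology_ring A))\<rparr>"

definition cohomology_map ::
    "'a dg_algebra \<Rightarrow> 'b dg_algebra \<Rightarrow> ('a \<Rightarrow> 'b) \<Rightarrow> 'a set \<Rightarrow> 'b set" where
  "cohomology_map A B f K = (\<Union>x\<in>K. coboundaries B +>\<^bsub>B\<^esub> f x)"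

definition quasi_isomorphism :: "'a dg_algebra \<Rightarrow> 'b dg_algebra \<Rightarrow> ('a \<Rightarrow> 'b) \<Rightarrow> bool" where
  "quasi_isomorphism A B f \<longleftrightarrow>
     cdga A \<and> cdga B \<and> f \<in> cdga_hom A B \<and>
     bij_betw (cohomology_map A B f) (carrier (cohomology A)) (carrier (cohomology B))"

definition quasi_iso_step :: "'a dg_algebra \<Rightarrow> 'b dg_algebra \<Rightarrow> bool" where
  "quasi_iso_step A B \<longleftrightarrow> (\<exists>f. quasi_isomorphism A B f) \<or> (\<exists>f. quasi_isomorphism B A f)"

text \<open>Being quasi-isomorphic means being connected by a finite zigzag of quasi-isomorphisms.
  HOL cannot quantify over the type carrying the intermediate algebras, so it is a parameter.
  Since carriers are subsets of the type, all members of a zigzag fit into one large enough type;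
  a hypothesis \<open>quasi_isomorphic TYPE('c) A B\<close> with a free type variable \<open>'c\<close> therefore
  covers all zigzags.\<close>

definition quasi_isomorphic ::
    "'c itself \<Rightarrow> 'a dg_algebra \<Rightarrow> 'b dg_algebra \<Rightarrow> bool" where
  "quasi_isomorphic T A B \<longleftrightarrow>
     quasi_iso_step A B \<or>
     (\<exists>C D :: 'c dg_algebra.
        quasi_iso_step A C \<and> quasi_iso_step\<^sup>*\<^sup>* C D \<and> quasi_iso_step D B)"

definition formal :: "'c itself \<Rightarrow> 'a dg_algebra \<Rightarrow> bool" where
  "formal T A \<longleftrightarrow> quasi_isomorphic T A (cohomology A)"


section \<open>Graded subspaces and wordlength\<close>

abbreviation qspan :: "'a dg_algebra \<Rightarrow> 'a set \<Rightarrow> 'a set" where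
  "qspan A S \<equiv> LinearCombinations.module.span rat_field A S"

abbreviation qsubspace :: "'a dg_algebra \<Rightarrow> 'a set \<Rightarrow> bool" where
  "qsubspace A W \<equiv> VectorSpace.subspace rat_field W A"

abbreviation qfin_dim :: "'a dg_algebra \<Rightarrow> 'a set \<Rightarrow> bool" where
  "qfin_dim A W \<equiv> vectorspace.fin_dim rat_field (A\<lparr>carrier := W\<rparr>)"

abbreviation qdim :: "'a dg_algebra \<Rightarrow> 'a set \<Rightarrow> nat" where
  "qdim A W \<equiv> vectorspace.dim rat_field (A\<lparr>carrier := W\<rparr>)"

text \<open>A graded subspace is given by its homogeneous parts \<open>V n\<close>.\<close>

definition total_space :: "'a dg_algebra \<Rightarrow> (nat \<Rightarrow> 'a set) \<Rightarrow> 'a set" where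
  "total_space A V = qspan A (\<Union>n. V n)"

definition even_part :: "'a dg_algebra \<Rightarrow> (nat \<Rightarrow> 'a set) \<Rightarrow> 'a set" where
  "even_part A V = qspan A (\<Union>n\<in>{n. even n}. V n)"

definition odd_part :: "'a dg_algebra \<Rightarrow> (nat \<Rightarrow> 'a set) \<Rightarrow> 'a set" where
  "odd_part A V = qspan A (\<Union>n\<in>{n. odd n}. V n)"

definition word :: "'a dg_algebra \<Rightarrow> 'a list \<Rightarrow> 'a" where
  "word A vs = foldr (\<lambda>x y. x \<otimes>\<^bsub>A\<^esub> y) vs \<one>\<^bsub>A\<^esub>"

definition wordlength_eq :: "'a dg_algebra \<Rightarrow> 'a set \<Rightarrow> nat \<Rightarrow> 'a set" where
  "wordlength_eq A W k = qspan A {word A vs |vs. set vs \<subseteq> W \<and> length vs = k}"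

definition wordlength_ge :: "'a dg_algebra \<Rightarrow> 'a set \<Rightarrow> nat \<Rightarrow> 'a set" where
  "wordlength_ge A W n = qspan A (\<Union>k\<in>{n..}. wordlength_eq A W k)"

text \<open>The image of \<open>S \<otimes> T\<close> under multiplication. For \<open>S \<subseteq> \<Lambda>V\<^sup>e\<^sup>v\<^sup>e\<^sup>n\<close> and \<open>T \<subseteq> \<Lambda>V\<^sup>o\<^sup>d\<^sup>d\<close>
  this is the usual identification \<open>\<Lambda>V\<^sup>e\<^sup>v\<^sup>e\<^sup>n \<otimes> \<Lambda>V\<^sup>o\<^sup>d\<^sup>d = \<Lambda>V\<close>.\<close>

definition tensor_image :: "'a dg_algebra \<Rightarrow> 'a set \<Rightarrow> 'a set \<Rightarrow> 'a set" where
  "tensor_image A S T = qspan A {s \<otimes>\<^bsub>A\<^esub> t |s t. s \<in> S \<and> t \<in> T}"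


section \<open>Free graded-commutative algebras\<close>

text \<open>A graded vector space \<open>V\<close> is presented by a homogeneous basis \<open>X\<close> with degrees \<open>deg\<close>.
  A basis of \<open>\<Lambda>V\<close> is given by the monomials in \<open>X\<close> that contain no generator of odd degree twice;
  the multiset \<open>{#x\<^sub>1, \<dots>, x\<^sub>k#}\<close> with \<open>x\<^sub>1 \<le> \<dots> \<le> x\<^sub>k\<close> stands for the
  product \<open>x\<^sub>1 \<cdots> x\<^sub>k\<close> in this order.\<close>

definition monomials :: "'x set \<Rightarrow> ('x \<Rightarrow> nat) \<Rightarrow> 'x multiset set" where
  "monomials X deg =
     {M. set_mset M \<subseteq> X \<and> (\<forall>x. odd (deg x) \<longrightarrow> count M x \<le> 1)}"

text \<open>Sorting the product of two ordered monomials interchanges, with a sign, each odd factor of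
  the first one with every smaller odd factor of the second one. A repeated odd generator
  makes the product vanish.\<close>

definition inversions :: "('x::linorder \<Rightarrow> nat) \<Rightarrow> 'x multiset \<Rightarrow> 'x multiset \<Rightarrow> nat" where
  "inversions deg M N =
     (\<Sum>x\<in>#M. \<Sum>y\<in>#N. if odd (deg x) \<and> odd (deg y) \<and> y < x then 1 else 0)"

definition koszul_sign :: "('x::linorder \<Rightarrow> nat) \<Rightarrow> 'x multiset \<Rightarrow> 'x multiset \<Rightarrow> rat" where
  "koszul_sign deg M N =
     (if M + N \<in> monomials UNIV deg then (- 1) ^ inversions deg M N else 0)"

type_synonym 'x lambda = "'x multiset \<Rightarrow>\<^sub>0 rat"

definition Lambda_mult ::
    "('x::linorder \<Rightarrow> nat) \<Rightarrow> 'x lambda \<Rightarrow> 'x lambda \<Rightarrow> 'x lambda" where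
  "Lambda_mult deg f g =
     (\<Sum>M\<in>Poly_Mapping.keys f. \<Sum>N\<in>Poly_Mapping.keys g.
        Poly_Mapping.single (M + N)
          (koszul_sign deg M N * Poly_Mapping.lookup f M * Poly_Mapping.lookup g N))"

definition Lambda ::
    "'x::linorder set \<Rightarrow> ('x \<Rightarrow> nat) \<Rightarrow> ('x lambda \<Rightarrow> 'x lambda) \<Rightarrow> 'x lambda dg_algebra" where
  "Lambda X deg d =
    \<lparr>carrier = {f. Poly_Mapping.keys f \<subseteq> monomials X deg},
     mult = Lambda_mult deg,
     one = Poly_Mapping.single {#} 1,
     zero = 0,
     add = (+),
     smult = (\<lambda>c. Poly_Mapping.map ((*) c)),
     grade = (\<lambda>n. {f. Poly_Mapping.keys f \<subseteq> {M \<in> monomials X deg. (\<Sum>x\<in>#M. deg x) = n}}),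
     diff = d\<rparr>"

text \<open>The graded subspace \<open>V\<close> of \<open>\<Lambda>V\<close>.\<close>

definition generators :: "'x::linorder set \<Rightarrow> ('x \<Rightarrow> nat) \<Rightarrow> nat \<Rightarrow> 'x lambda set" where
  "generators X deg n =
     {f. Poly_Mapping.keys f \<subseteq> {{#x#} |x. x \<in> X \<and> deg x = n}}"


section \<open>Sullivan models\<close>

text \<open>In the following, \<open>A\<close> is \<open>(\<Lambda>V, d)\<close> and \<open>V\<close> its graded subspace of generators.\<close>

definition sullivan_condition :: "'a dg_algebra \<Rightarrow> (nat \<Rightarrow> 'a set) \<Rightarrow> bool" where
  "sullivan_condition A V \<longleftrightarrow>
     (\<exists>F :: nat \<Rightarrow> nat \<Rightarrow> 'a set.
        (\<forall>k n. qsubspace A (F k n) \<and> F k n \<subseteq> F (Suc k) n) \<and>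
        (\<forall>n. (\<Union>k. F k n) = V n) \<and>
        (\<forall>n. \<forall>v\<in>F 0 n. diff A v = \<zero>\<^bsub>A\<^esub>) \<and>
        (\<forall>k n. \<forall>v\<in>F (Suc k) n. diff A v \<in> wordlength_ge A (total_space A (F k)) 0))"

definition minimal_sullivan_model :: "'a dg_algebra \<Rightarrow> (nat \<Rightarrow> 'a set) \<Rightarrow> bool" where
  "minimal_sullivan_model A V \<longleftrightarrow>
     cdga A \<and> sullivan_condition A V \<and>
     diff A ` total_space A V \<subseteq> wordlength_ge A (total_space A V) 2"

definition one_connected :: "'a dg_algebra \<Rightarrow> (nat \<Rightarrow> 'a set) \<Rightarrow> bool" where
  "one_connected A V \<longleftrightarrow> (\<forall>n<2. V n = {\<zero>\<^bsub>A\<^esub>})"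

definition elliptic :: "'a dg_algebra \<Rightarrow> (nat \<Rightarrow> 'a set) \<Rightarrow> bool" where
  "elliptic A V \<longleftrightarrow>
     qfin_dim A (total_space A V) \<and> qfin_dim (cohomology A) (carrier (cohomology A))"

definition hyperelliptic :: "'a dg_algebra \<Rightarrow> (nat \<Rightarrow> 'a set) \<Rightarrow> bool" where
  "hyperelliptic A V \<longleftrightarrow>
     diff A ` even_part A V \<subseteq> {\<zero>\<^bsub>A\<^esub>} \<and>
     diff A ` odd_part A V \<subseteq>
       tensor_image A (wordlength_ge A (even_part A V) 1) (wordlength_ge A (odd_part A V) 0)"


section \<open>The free graded-commutative algebra is a CDGA with zero differential\<close>

lemma Lambda_mult_superset:
  assumes "finite S" "finite T" "Poly_Mapping.keys f \<subseteq> S" "Poly_Mapping.keys g \<subseteq> T"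
  shows "Lambda_mult deg f g =
    (\<Sum>M\<in>S. \<Sum>N\<in>T. Poly_Mapping.single (M + N)
       (koszul_sign deg M N * Poly_Mapping.lookup f M * Poly_Mapping.lookup g N))"
proof -
  let ?h = "\<lambda>M N. Poly_Mapping.single (M + N)
       (koszul_sign deg M N * Poly_Mapping.lookup f M * Poly_Mapping.lookup g N)"
  have "(\<Sum>N\<in>Poly_Mapping.keys g. ?h M N) = (\<Sum>N\<in>T. ?h M N)" for M
    using assms by (intro sum.mono_neutral_left) (auto simp: in_keys_iff)
  moreover have "(\<Sum>M\<in>Poly_Mapping.keys f. \<Sum>N\<in>T. ?h M N) = (\<Sum>M\<in>S. \<Sum>N\<in>T. ?h M N)"
    using assms by (intro sum.mono_neutral_left) (auto simp: in_keys_iff)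
  ultimately show ?thesis by (simp add: Lambda_mult_def)
qed

lemma Lambda_mult_add_left:
  "Lambda_mult deg (f + g) h = Lambda_mult deg f h + Lambda_mult deg g h"
proof -
  let ?S = "Poly_Mapping.keys f \<union> Poly_Mapping.keys g"
  have k: "Poly_Mapping.keys (f + g) \<subseteq> ?S" by (rule Poly_Mapping.keys_add)
  show ?thesis
    by (subst (1 2 3) Lambda_mult_superset[of ?S "Poly_Mapping.keys h"])
      (use k in \<open>auto simp: lookup_add distrib_left distrib_right single_add sum.distrib\<close>)
qed

lemma Lambda_mult_add_right:
  "Lambda_mult deg h (f + g) = Lambda_mult deg h f + Lambda_mult deg h g"
proof -
  let ?S = "Poly_Mapping.keys f \<union> Poly_Mapping.keys g"
  have k: "Poly_Mapping.keys (f + g) \<subseteq> ?S" by (rule Poly_Mapping.keys_add)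
  show ?thesis
    by (subst (1 2 3) Lambda_mult_superset[of "Poly_Mapping.keys h" ?S])
      (use k in \<open>auto simp: lookup_add distrib_left distrib_right single_add sum.distrib\<close>)
qed

lemma Lambda_mult_zero [simp]: "Lambda_mult deg 0 f = 0" "Lambda_mult deg f 0 = 0"
  by (simp_all add: Lambda_mult_def)

lemma Lambda_mult_single:
  "Lambda_mult deg (Poly_Mapping.single M a) (Poly_Mapping.single N b) =
     Poly_Mapping.single (M + N) (koszul_sign deg M N * a * b)"
  by (subst Lambda_mult_superset[of "{M}" "{N}"]) (auto split: if_splits)

lemma poly_mapping_as_sum:
  fixes f :: "'k \<Rightarrow>\<^sub>0 'b::comm_monoid_add"
  shows "f = (\<Sum>M\<in>Poly_Mapping.keys f. Poly_Mapping.single M (Poly_Mapping.lookup f M))"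
proof (rule poly_mapping_eqI)
  fix k
  show "Poly_Mapping.lookup f k =
    Poly_Mapping.lookup (\<Sum>M\<in>Poly_Mapping.keys f. Poly_Mapping.single M (Poly_Mapping.lookup f M)) k"
    by (cases "k \<in> Poly_Mapping.keys f")
      (auto simp: lookup_sum lookup_single when_def sum.delta in_keys_iff)
qed

lemma lambda_induct [case_names zero single add]:
  fixes f :: "'k \<Rightarrow>\<^sub>0 'b::comm_monoid_add"
  assumes "P 0"
    and "\<And>M a. M \<in> Poly_Mapping.keys f \<Longrightarrow> P (Poly_Mapping.single M a)"
    and "\<And>g h. P g \<Longrightarrow> P h \<Longrightarrow> P (g + h)"
  shows "P f"
proof -
  have "P (\<Sum>M\<in>S. Poly_Mapping.single M (Poly_Mapping.lookup f M))"
    if "finite S" "S \<subseteq> Poly_Mapping.keys f" for S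
    using that by (induction S) (use assms in auto)
  from this[of "Poly_Mapping.keys f"] show ?thesis
    by (simp flip: poly_mapping_as_sum)
qed

lemma inversions_add_left: "inversions deg (M + N) P = inversions deg M P + inversions deg N P"
  by (simp add: inversions_def)

lemma inversions_add_right: "inversions deg P (M + N) = inversions deg P M + inversions deg P N"
  by (simp add: inversions_def sum_mset.distrib)

lemma koszul_sign_cocycle:
  "koszul_sign deg M N * koszul_sign deg (M + N) P = koszul_sign deg N P * koszul_sign deg M (N + P)"
proof (cases "M + N + P \<in> monomials UNIV deg")
  case True
  have "count M x + count N x + count P x \<le> 1" if "odd (deg x)" for x
    using that True unfolding monomials_def by auto
  hence "M + N \<in> monomials UNIV deg" "N + P \<in> monomials UNIV deg"
    unfolding monomials_def by (auto, (metis add_leD1 add_leD2 add.assoc)+)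
  thus ?thesis using True
    by (simp add: koszul_sign_def inversions_add_left inversions_add_right power_add add.assoc)
next
  case False
  thus ?thesis by (simp add: koszul_sign_def add.assoc)
qed

lemma Lambda_mult_assoc:
  "Lambda_mult deg (Lambda_mult deg f g) h = Lambda_mult deg f (Lambda_mult deg g h)"
proof (induction f rule: lambda_induct)
  case (single M a)
  show ?case
  proof (induction g rule: lambda_induct)
    case (single N b)
    show ?case
    proof (induction h rule: lambda_induct)
      case (single P c)
      show ?case
        using koszul_sign_cocycle[of deg M N P]
        by (simp add: Lambda_mult_single add.assoc mult_ac)
    qed (auto simp: Lambda_mult_add_left Lambda_mult_add_right)
  qed (auto simp: Lambda_mult_add_left Lambda_mult_add_right)
qed (auto simp: Lambda_mult_add_left Lambda_mult_add_right)

lemma scale_single [simp]: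
  "Poly_Mapping.map ((*) (c::rat)) (Poly_Mapping.single M a) = Poly_Mapping.single M (c * a)"
  by (simp)

lemma scale_zero [simp]: "Poly_Mapping.map ((*) (c::rat)) 0 = 0"
  by (rule poly_mapping_eqI) (simp add: Poly_Mapping.map.rep_eq)

lemma lookup_scale [simp]:
  "Poly_Mapping.lookup (Poly_Mapping.map ((*) (c::rat)) f) M = c * Poly_Mapping.lookup f M"
  by (simp add: Poly_Mapping.map.rep_eq when_def)

lemma scale_add: "Poly_Mapping.map ((*) (c::rat)) (f + g) =
    Poly_Mapping.map ((*) c) f + Poly_Mapping.map ((*) c) g"
  by (rule poly_mapping_eqI) (simp add: lookup_add algebra_simps)

lemma Lambda_mult_scale_left:
  "Lambda_mult deg (Poly_Mapping.map ((*) c) f) g = Poly_Mapping.map ((*) c) (Lambda_mult deg f g)"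
proof (induction f rule: lambda_induct)
  case (single M a)
  show ?case
    by (induction g rule: lambda_induct)
     (auto simp: Lambda_mult_single Lambda_mult_add_right scale_add mult.assoc mult.left_commute[of c])
qed (auto simp: Lambda_mult_add_left scale_add)

lemma Lambda_mult_scale_right:
  "Lambda_mult deg f (Poly_Mapping.map ((*) c) g) = Poly_Mapping.map ((*) c) (Lambda_mult deg f g)"
proof (induction f rule: lambda_induct)
  case (single M a)
  show ?case
    by (induction g rule: lambda_induct)
     (auto simp: Lambda_mult_single Lambda_mult_add_right scale_add mult.assoc mult.left_commute[of c])
qed (auto simp: Lambda_mult_add_left scale_add)

lemma Lambda_mult_one:
  assumes "Poly_Mapping.keys f \<subseteq> monomials X deg"
  shows "Lambda_mult deg (Poly_Mapping.single {#} 1) f = f"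
    and "Lambda_mult deg f (Poly_Mapping.single {#} 1) = f"
proof -
  have s: "koszul_sign deg {#} M = 1 \<and> koszul_sign deg M {#} = 1" if "M \<in> monomials X deg" for M
    using that by (auto simp: koszul_sign_def inversions_def monomials_def)
  show "Lambda_mult deg (Poly_Mapping.single {#} 1) f = f"
    by (induction f rule: lambda_induct)
      (use assms s in \<open>auto simp: Lambda_mult_single Lambda_mult_add_right simp del: single_one\<close>)
  show "Lambda_mult deg f (Poly_Mapping.single {#} 1) = f"
    by (induction f rule: lambda_induct)
      (use assms s in \<open>auto simp: Lambda_mult_single Lambda_mult_add_left simp del: single_one\<close>)
qed

lemma keys_Lambda_mult:
  "Poly_Mapping.keys (Lambda_mult deg f g) \<subseteq>
     {M + N |M N. M \<in> Poly_Mapping.keys f \<and> N \<in> Poly_Mapping.keys g \<and> M + N \<in> monomials UNIV deg}"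
  (is "_ \<subseteq> ?R")
proof
  fix P assume "P \<in> Poly_Mapping.keys (Lambda_mult deg f g)"
  hence "(\<Sum>M\<in>Poly_Mapping.keys f. \<Sum>N\<in>Poly_Mapping.keys g.
     Poly_Mapping.lookup (Poly_Mapping.single (M + N)
          (koszul_sign deg M N * Poly_Mapping.lookup f M * Poly_Mapping.lookup g N)) P) \<noteq> 0"
    by (simp add: Lambda_mult_def in_keys_iff lookup_sum)
  then obtain M N where "M \<in> Poly_Mapping.keys f" "N \<in> Poly_Mapping.keys g"
    and n: "Poly_Mapping.lookup (Poly_Mapping.single (M + N)
          (koszul_sign deg M N * Poly_Mapping.lookup f M * Poly_Mapping.lookup g N)) P \<noteq> 0"
    by (metis (no_types, lifting) sum.neutral)
  thus "P \<in> ?R" by (auto simp: lookup_single when_def koszul_sign_def split: if_splits)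
qed

definition odd_count :: "('x \<Rightarrow> nat) \<Rightarrow> 'x multiset \<Rightarrow> nat" where
  "odd_count deg M = (\<Sum>x\<in>#M. if odd (deg x) then 1 else 0)"

lemma inversions_swap:
  assumes "M + N \<in> monomials UNIV deg"
  shows "inversions deg M N + inversions deg N M = odd_count deg M * odd_count deg N"
proof -
  have ne: "x \<noteq> y" if "x \<in># M" "y \<in># N" "odd (deg x)" for x y
    using that assms unfolding monomials_def
    by (auto simp: count_greater_zero_iff[symmetric] simp del: count_greater_zero_iff) 
  have "inversions deg N M =
      (\<Sum>x\<in>#M. \<Sum>y\<in>#N. if odd (deg x) \<and> odd (deg y) \<and> x < y then 1 else 0)"
    unfolding inversions_def by (subst sum_mset.swap) (simp add: conj_ac cong: if_cong)
  hence "inversions deg M N + inversions deg N M =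
     (\<Sum>x\<in>#M. \<Sum>y\<in>#N. (if odd (deg x) \<and> odd (deg y) \<and> y < x then 1 else 0) +
       (if odd (deg x) \<and> odd (deg y) \<and> x < y then 1 else 0))"
    by (simp add: inversions_def sum_mset.distrib)
  also have "\<dots> = (\<Sum>x\<in>#M. \<Sum>y\<in>#N. (if odd (deg x) then 1 else 0) * (if odd (deg y) then 1 else 0))"
  proof (intro arg_cong[where f = sum_mset] image_mset_cong)
    fix x y assume "x \<in># M" "y \<in># N"
    thus "(if odd (deg x) \<and> odd (deg y) \<and> y < x then 1 else 0) +
       (if odd (deg x) \<and> odd (deg y) \<and> x < y then 1 else 0) =
      (if odd (deg x) then 1 else 0) * (if odd (deg y) then 1 else (0::nat))"
      using ne[of x y] by auto
  qed
  also have "\<dots> = odd_count deg M * odd_count deg N"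
    unfolding odd_count_def sum_mset_distrib_right by (simp only: sum_mset_distrib_left)
  finally show ?thesis .
qed

lemma odd_count_parity: "even (odd_count deg M) \<longleftrightarrow> even (\<Sum>x\<in>#M. deg x)"
  by (induction M) (auto simp: odd_count_def)

lemma koszul_sign_swap:
  "koszul_sign deg M N = (- 1) ^ ((\<Sum>x\<in>#M. deg x) * (\<Sum>x\<in>#N. deg x)) * koszul_sign deg N M"
proof (cases "M + N \<in> monomials UNIV deg")
  case True
  have p: "even (inversions deg M N + inversions deg N M)
     = even ((\<Sum>x\<in>#M. deg x) * (\<Sum>x\<in>#N. deg x))"
    by (simp only: inversions_swap[OF True] even_mult_iff odd_count_parity)
  show ?thesis using True p
    by (simp add: koszul_sign_def add.commute minus_one_power_iff) argo
qed (simp add: koszul_sign_def add.commute)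

abbreviation (input) "mdeg deg M \<equiv> \<Sum>x\<in>#M. deg x"

lemma Lambda_mult_comm:
  assumes "\<And>M. M \<in> Poly_Mapping.keys f \<Longrightarrow> mdeg deg M = i"
    and "\<And>M. M \<in> Poly_Mapping.keys g \<Longrightarrow> mdeg deg M = j"
  shows "Lambda_mult deg f g = Poly_Mapping.map ((*) ((- 1) ^ (i * j))) (Lambda_mult deg g f)"
proof (induction f rule: lambda_induct)
  case (single M a)
  hence M: "mdeg deg M = i" using assms(1) by auto
  show ?case
  proof (induction g rule: lambda_induct)
    case (single N b)
    thus ?case using koszul_sign_swap[of deg M N] M assms(2)
      by (simp add: Lambda_mult_single add.commute mult_ac)
  qed (auto simp: Lambda_mult_add_left Lambda_mult_add_right scale_add)
qed (auto simp: Lambda_mult_add_left Lambda_mult_add_right scale_add)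

lemma Lambda_simps [simp]:
  "carrier (Lambda X deg d) = {f. Poly_Mapping.keys f \<subseteq> monomials X deg}"
  "mult (Lambda X deg d) = Lambda_mult deg"
  "one (Lambda X deg d) = Poly_Mapping.single {#} 1"
  "zero (Lambda X deg d) = 0"
  "add (Lambda X deg d) = (+)"
  "smult (Lambda X deg d) = (\<lambda>c. Poly_Mapping.map ((*) c))"
  "grade (Lambda X deg d) n =
     {f. Poly_Mapping.keys f \<subseteq> {M \<in> monomials X deg. mdeg deg M = n}}"
  "diff (Lambda X deg d) = d"
  by (simp_all add: Lambda_def)

lemma empty_monomial [simp]: "{#} \<in> monomials X deg"
  by (simp add: monomials_def)

lemma keys_scale: "Poly_Mapping.keys (Poly_Mapping.map ((*) (c::rat)) f) \<subseteq> Poly_Mapping.keys f"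
  by (auto simp: in_keys_iff)

lemma Lambda_mult_closed:
  assumes "Poly_Mapping.keys f \<subseteq> monomials X deg" "Poly_Mapping.keys g \<subseteq> monomials X deg"
  shows "Poly_Mapping.keys (Lambda_mult deg f g) \<subseteq> monomials X deg"
proof -
  have "M + N \<in> monomials X deg"
    if "M \<in> monomials X deg" "N \<in> monomials X deg" "M + N \<in> monomials UNIV deg" for M N
    using that by (auto simp: monomials_def)
  thus ?thesis using keys_Lambda_mult[of deg f g] assms by blast
qed

lemma keys_add_subset: "Poly_Mapping.keys f \<subseteq> S \<Longrightarrow> Poly_Mapping.keys g \<subseteq> S \<Longrightarrow> Poly_Mapping.keys (f + g) \<subseteq> S"
  using Poly_Mapping.keys_add[of f g] by blast

lemma Lambda_ring: "ring (Lambda X deg d)"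
proof (rule ringI)
  show "abelian_group (Lambda X deg d)"
  proof (rule abelian_groupI)
    fix x assume "x \<in> carrier (Lambda X deg d)"
    thus "\<exists>y\<in>carrier (Lambda X deg d). y \<oplus>\<^bsub>Lambda X deg d\<^esub> x = \<zero>\<^bsub>Lambda X deg d\<^esub>"
      by (intro bexI[of _ "- x"]) (auto simp: in_keys_iff)
  qed (auto simp: add_ac intro: subsetD[OF keys_add_subset])
  show "monoid (Lambda X deg d)"
    by (rule monoidI) (auto simp: Lambda_mult_assoc Lambda_mult_one simp del: single_one
      intro: subsetD[OF Lambda_mult_closed])
qed (auto simp: Lambda_mult_add_left Lambda_mult_add_right)

lemma rat_field_field: "field rat_field"
  by (rule class_field.field_axioms)

lemma Lambda_vectorspace: "vectorspace rat_field (Lambda X deg d)"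
proof -
  interpret R: ring "Lambda X deg d" by (rule Lambda_ring)
  have F: "cring rat_field" using rat_field_field by (simp add: field_def domain_def)
  have "module rat_field (Lambda X deg d)"
  proof (rule moduleI[OF F R.abelian_group_axioms], goal_cases)
    case (1 a x)
    thus ?case using keys_scale[of a x] by auto
  qed (auto simp: lookup_add algebra_simps intro!: poly_mapping_eqI)
  thus ?thesis by (intro vectorspace.intro rat_field_field)
qed

lemma finsum_Lambda:
  assumes "finite I" "\<And>i. i \<in> I \<Longrightarrow> Poly_Mapping.keys (f i) \<subseteq> monomials X deg"
  shows "finsum (Lambda X deg d) f I = sum f I"
proof -
  interpret R: ring "Lambda X deg d" by (rule Lambda_ring)
  show ?thesis using assms by (induction I) (auto simp: R.finsum_insert Pi_iff)
qed

lemma Lambda_decomposition: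
  assumes "x \<in> carrier (Lambda X deg d)"
  shows "\<exists>!f. (\<forall>n. f n \<in> grade (Lambda X deg d) n) \<and> finite {n. f n \<noteq> \<zero>\<^bsub>Lambda X deg d\<^esub>} \<and>
     x = finsum (Lambda X deg d) f {n. f n \<noteq> \<zero>\<^bsub>Lambda X deg d\<^esub>}"
proof (rule ex1I)
  let ?L = "Lambda X deg d"
  define p where "p n = (\<Sum>M\<in>{M\<in>Poly_Mapping.keys x. mdeg deg M = n}.
     Poly_Mapping.single M (Poly_Mapping.lookup x M))" for n
  have lp: "Poly_Mapping.lookup (p n) M = (if mdeg deg M = n then Poly_Mapping.lookup x M else 0)" for n M
    by (auto simp: p_def lookup_sum lookup_single when_def sum.delta' in_keys_iff)
  have char: "f = p" if f: "(\<forall>n. f n \<in> grade ?L n) \<and> finite {n. f n \<noteq> \<zero>\<^bsub>?L\<^esub>} \<and>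
     x = finsum ?L f {n. f n \<noteq> \<zero>\<^bsub>?L\<^esub>}" for f
  proof (rule ext, rule poly_mapping_eqI)
    fix n M
    have fin: "finite {n. f n \<noteq> 0}"
      using f by simp
    have "Poly_Mapping.keys (f n) \<subseteq> monomials X deg" for n
      using f by auto
    hence s: "x = sum f {n. f n \<noteq> 0}"
      using f by (simp add: finsum_Lambda[OF fin])
    have "f m \<in> grade ?L m" for m
      using f by (elim conjE allE[of _ m])
    hence z: "Poly_Mapping.lookup (f m) M = 0" if "m \<noteq> mdeg deg M" for m
      using that by (auto simp: in_keys_iff subset_iff)
    have "Poly_Mapping.lookup x M = (\<Sum>m\<in>{n. f n \<noteq> 0}. Poly_Mapping.lookup (f m) M)"
      by (subst s) (simp add: lookup_sum)
    also have "\<dots> = (\<Sum>m\<in>{n. f n \<noteq> 0}. if m = mdeg deg M then Poly_Mapping.lookup (f (mdeg deg M)) M else 0)"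
      by (intro sum.cong) (auto simp: z)
    also have "\<dots> = Poly_Mapping.lookup (f (mdeg deg M)) M"
      using fin by (simp add: sum.delta')
    finally show "Poly_Mapping.lookup (f n) M = Poly_Mapping.lookup (p n) M"
      using z[of n] by (auto simp: lp)
  qed
  have sub: "{n. p n \<noteq> 0} \<subseteq> mdeg deg ` Poly_Mapping.keys x"
  proof
    fix n assume "n \<in> {n. p n \<noteq> 0}"
    hence "Poly_Mapping.keys (p n) \<noteq> {}"
      by simp
    then obtain M where "Poly_Mapping.lookup (p n) M \<noteq> 0"
      unfolding in_keys_iff[symmetric] by blast
    hence "n = mdeg deg M" "M \<in> Poly_Mapping.keys x"
      unfolding lp in_keys_iff by (simp_all split: if_splits)
    thus "n \<in> mdeg deg ` Poly_Mapping.keys x"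
      by (rule image_eqI)
  qed
  have fin: "finite {n. p n \<noteq> 0}" by (rule finite_subset[OF sub]) simp
  have gr: "p n \<in> grade ?L n" for n
  proof -
    have "M \<in> Poly_Mapping.keys x \<and> mdeg deg M = n" if "M \<in> Poly_Mapping.keys (p n)" for M
      using that unfolding in_keys_iff lp by (simp split: if_splits)
    thus ?thesis using assms by auto
  qed
  have "x = sum p {n. p n \<noteq> 0}"
  proof (rule poly_mapping_eqI)
    fix M
    have "(\<Sum>n\<in>{n. p n \<noteq> 0}. Poly_Mapping.lookup (p n) M) =
      (if p (mdeg deg M) \<noteq> 0 then Poly_Mapping.lookup x M else 0)"
      using fin by (simp add: lp sum.delta)
    also have "\<dots> = Poly_Mapping.lookup x M"
      using lp[of "mdeg deg M" M] by auto
    finally show "Poly_Mapping.lookup x M = Poly_Mapping.lookup (sum p {n. p n \<noteq> 0}) M"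
      by (simp add: lookup_sum)
  qed
  also have "\<dots> = finsum ?L p {n. p n \<noteq> 0}"
  proof (intro finsum_Lambda[symmetric] fin)
    show "Poly_Mapping.keys (p n) \<subseteq> monomials X deg" for n
      using gr[of n] by auto
  qed
  finally have sum: "x = finsum ?L p {n. p n \<noteq> 0}" .
  show "(\<forall>n. p n \<in> grade ?L n) \<and> finite {n. p n \<noteq> \<zero>\<^bsub>?L\<^esub>} \<and>
     x = finsum ?L p {n. p n \<noteq> \<zero>\<^bsub>?L\<^esub>}"
    unfolding Lambda_simps(4) by (intro conjI allI gr fin sum)
  show "\<And>f. (\<forall>n. f n \<in> grade ?L n) \<and> finite {n. f n \<noteq> \<zero>\<^bsub>?L\<^esub>} \<and>
     x = finsum ?L f {n. f n \<noteq> \<zero>\<^bsub>?L\<^esub>} \<Longrightarrow> f = p" by (rule char)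
qed

lemma Lambda_subspace:
  assumes "S \<subseteq> monomials X deg"
  shows "VectorSpace.subspace rat_field {f. Poly_Mapping.keys f \<subseteq> S} (Lambda X deg d)"
proof -
  interpret V: vectorspace rat_field "Lambda X deg d" by (rule Lambda_vectorspace)
  show ?thesis
  proof (intro VectorSpace.subspace.intro submodule.intro V.vectorspace_axioms V.module_axioms, goal_cases)
      case (2 v w)
      thus ?case using keys_add_subset[of v S w] by simp
    next
      case (4 c v)
      thus ?case using keys_scale[of c v] by auto
    qed (use assms in auto)
qed

theorem Lambda_cdga: "cdga (Lambda X deg (\<lambda>_. 0))"
proof -
  interpret R: ring "Lambda X deg (\<lambda>_. 0)" by (rule Lambda_ring)
  interpret V: vectorspace rat_field "Lambda X deg (\<lambda>_. 0)" by (rule Lambda_vectorspace)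
  show ?thesis
  proof (intro cdga.intro R.ring_axioms V.vectorspace_axioms cdga_axioms.intro, goal_cases)
    case (3 n) thus ?case using Lambda_subspace[of "{M \<in> monomials X deg. mdeg deg M = n}" X deg] by auto
  next
    case (4 x) thus ?case by (rule Lambda_decomposition)
  next
    case (6 x i y j)
    have "Poly_Mapping.keys (Lambda_mult deg x y) \<subseteq> monomials X deg"
      using 6 by (intro Lambda_mult_closed) auto
    thus ?case using 6 keys_Lambda_mult[of deg x y] by (auto simp: subset_iff; blast)
  next
    case (7 x i y j) thus ?case using Lambda_mult_comm[of x deg i y j] by auto
  qed (auto simp: Lambda_mult_scale_left Lambda_mult_scale_right)
qed

end

theory Submission
  imports Defs "HOL-Computational_Algebra.Polynomial_FPS"
begin

text \<open>Let there be \<open>n\<close> even and \<open>m\<close> odd generators, and let \<open>e\<close>, \<open>o\<close> be the dimensions of the even and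
  the odd cohomology.

  \<^item> By minimality, boundaries that are words of length at most 2 in the even generators come only from
    linear combinations of the \<open>m\<close> odd generators. So \<open>e \<ge> 1 + n\<close> and \<open>e + m \<ge> 1 + n + n(n+1)/2\<close>.

  \<^item> Dividing out the even generators one at a time, the long exact sequence of multiplication by \<open>x\<close>
    replaces a cohomology of dimension \<open>k\<close> by one of dimension at most \<open>2k - 1\<close>. Hyperellipticity makes
    the differential vanish on the last quotient, the exterior algebra on the odd generators; hence
    \<open>2\<^sup>m - 1 \<le> 2\<^sup>n (e + o - 1)\<close>.

  \<^item> If \<open>m > n\<close>, the Euler characteristic \<open>e - o\<close> vanishes. In large weight the associated pure model
    is exact, so the cohomology is that of a finite-dimensional truncation, and \<open>e - o\<close> is the value
    at \<open>t = 1\<close> of the polynomial \<open>\<Prod>(1 - t\<^bsup>|y|+1\<^esup>) / \<Prod>(1 - t\<^bsup>|x|\<^esup>)\<close>.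

  These facts imply \<open>e + o \<ge> n + m\<close> by arithmetic.\<close>

section \<open>Linear algebra\<close>

text \<open>The weight gives an odd generator y the value |y| + 1, which is the degree of
  \<open>d y\<close>. So the terms of \<open>d y\<close> in even generators alone preserve the
  weight, and every odd factor in the other terms raises it: \<open>d\<close> is filtered but not
  homogeneous, and the Euler characteristic cannot be taken weight by weight. Acyclicity in large
  weight replaces this. It comes from finite-dimensional cohomology: some power of each even
  generator is a boundary, even for the weight-preserving part of \<open>d\<close>. The resulting
  polynomial has a zero of order m - n at t = 1, whence e = o.

  The bounds complement each other. For m \<le> n the quadratic one suffices. For m > n the equality
  e = o gives h \<ge> 2e for the total dimension h, so the bounds on e become bounds on h/2; the
  linear one settles m - n \<le> 2. Beyond that, the exponential bound, which for n > 0 reads 2^(m -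
  n) < h, settles every n that is too small for the quadratic bound to win.\<close>

context vector_space
begin

text \<open>Used to represent the quotient by \<open>B\<close> as the image of a linear map, inside the same type.\<close>

lemma exists_linear_with_kernel:
  assumes "subspace B"
  obtains p where "Vector_Spaces.linear scale scale p" "\<And>v. p v = 0 \<longleftrightarrow> v \<in> B"
proof -
  interpret pair: vector_space_pair scale scale ..
  obtain b where b: "b \<subseteq> B" "independent b" "span b = B"
    using basis_exists[of B] assms by (metis span_subspace)
  let ?E = "extend_basis b"
  have E: "independent ?E" "span ?E = UNIV" "b \<subseteq> ?E"
    using b by (auto simp: independent_extend_basis extend_basis_superset)
  obtain p where p: "Vector_Spaces.linear scale scale p" "\<And>x. x \<in> ?E \<Longrightarrow> p x = (if x \<in> b then 0 else x)"
    using pair.linear_independent_extend[OF E(1), of "\<lambda>x. if x \<in> b then 0 else x"] by blast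
  interpret p: Vector_Spaces.linear scale scale p by fact
  have p0: "p u = 0" if "u \<in> span b" for u
    using p.eq_0_on_span[OF _ that] p(2) E(3) by (metis subsetD)
  have p1: "p u = u" if "u \<in> span (?E - b)" for u
    using pair.linear_eq_on[OF p(1) linear_ident that] p(2) by auto
  have "p v = 0 \<longleftrightarrow> v \<in> B" for v
  proof
    assume v: "p v = 0"
    have "v \<in> span (b \<union> (?E - b))" using E by (simp add: Un_absorb1)
    then obtain u w where "v = u + w" "u \<in> span b" "w \<in> span (?E - b)"
      unfolding span_Un by blast
    thus "v \<in> B" using v p0 p1 b by (auto simp: p.add)
  qed (use p0 b in auto)
  thus ?thesis using that p(1) by blast
qed

text \<open>\<open>dim\<close> is the cardinality of a basis and \<open>card\<close> of an infinite
  set is 0, so the finite \<open>T\<close> keeps the dimension of the image meaningful.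
  \<open>F\<close> consists of preimages of a basis of the image.\<close>

lemma basis_of_image:
  assumes "p ` Z \<subseteq> span T" "finite T"
  obtains F where "F \<subseteq> Z" "finite F" "inj_on p F" "independent (p ` F)" "p ` Z \<subseteq> span (p ` F)"
    "card F = dim (p ` Z)"
proof -
  obtain C where C: "C \<subseteq> p ` Z" "independent C" "p ` Z \<subseteq> span C" "card C = dim (p ` Z)"
    by (rule basis_exists)
  have fin: "finite C" using independent_span_bound[of T C] assms C by auto
  obtain F where "F \<subseteq> Z" "C = p ` F" "inj_on p F" using C(1) by (meson subset_image_inj)
  thus ?thesis using that[of F] C fin by (metis card_image finite_image_iff)
qed

lemma independent_of_image:
  assumes "Vector_Spaces.linear scale scale f" "independent (f ` F)" "inj_on f F"
  shows "independent F"
proof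
  interpret f: Vector_Spaces.linear scale scale f by fact
  assume "dependent F"
  then obtain a where a: "a \<in> F" "a \<in> span (F - {a})" by (auto simp: dependent_def)
  hence "f a \<in> span (f ` (F - {a}))" by (auto simp: f.span_image)
  also have "f ` (F - {a}) = f ` F - {f a}" using a(1) assms(3) by (auto simp: inj_on_def)
  finally show False using assms(2) a(1) by (auto simp: dependent_def)
qed

lemma independent_Un_of_spans:
  assumes "finite F" "independent K" "independent F" "span K \<inter> span F \<subseteq> {0}"
  shows "independent (K \<union> F)"
  using assms
proof (induction F)
  case (insert a F)
  have sub: "span F \<subseteq> span (insert a F)" by (intro span_mono) auto
  have "a \<notin> span (K \<union> F)"
  proof
    assume "a \<in> span (K \<union> F)"
    then obtain u w where uw: "a = u + w" "u \<in> span K" "w \<in> span F" by (auto simp: span_Un)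
    hence "u = a - w" by simp
    hence "u \<in> span (insert a F)" using uw(3) sub by (metis insertI1 span_base span_diff subsetD)
    hence "u = 0" using uw(2) insert.prems(3) by blast
    hence "a \<in> span F" using uw by simp
    thus False using insert.hyps(2) insert.prems(2) independent_insert[of a F] by simp
  qed
  moreover have "independent (K \<union> F)"
    using insert.prems(1,3) independent_mono[OF insert.prems(2), of F] sub by (intro insert.IH) auto
  ultimately show ?case by (simp add: independent_insertI)
qed simp

text \<open>A linear map that sends \<open>F\<close> injectively to an independent set is injective
  on the span of \<open>F\<close>.\<close>

lemma kernel_Int_span_lift:
  assumes "Vector_Spaces.linear scale scale f" "finite F" "independent (f ` F)" "inj_on f F"
    "x \<in> span F" "f x = 0"
  shows "x = 0"
proof -
  interpret pair: vector_space_pair scale scale ..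
  show ?thesis
    using pair.linear_indep_image_lemma[OF assms(1,2,3,4,5,6)] .
qed

text \<open>Relative to a finite-dimensional subspace \<open>S\<close>, because the ambient
  polynomial space is infinite-dimensional. A basis of the kernel and lifts of a basis of the image
  form a basis of \<open>S\<close>.\<close>

lemma rank_nullity:
  assumes f: "Vector_Spaces.linear scale scale f" and S: "subspace S" "S \<subseteq> span T" "finite T"
  shows "dim S = dim {x \<in> S. f x = 0} + dim (f ` S)"
proof -
  interpret f: Vector_Spaces.linear scale scale f by fact
  let ?N = "{x \<in> S. f x = 0}"
  obtain K where K: "K \<subseteq> ?N" "independent K" "?N \<subseteq> span K" "card K = dim ?N"
    by (rule basis_exists)
  have finK: "finite K" using independent_span_bound[of T K] K S by blast
  have N: "subspace ?N"
    using S(1) by (auto simp: subspace_def f.add f.scale f.zero)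
  obtain F where F: "F \<subseteq> S" "finite F" "inj_on f F" "independent (f ` F)" "f ` S \<subseteq> span (f ` F)"
    "card F = dim (f ` S)"
    using basis_of_image[of f S "f ` T"] S by (metis f.span_image finite_imageI image_mono)
  have zero: "x = 0" if "x \<in> span F" "f x = 0" for x
    using kernel_Int_span_lift[OF f F(2,4,3) that] .
  have sK: "span K \<subseteq> ?N" using K(1) N by (rule span_minimal)
  have disj: "span K \<inter> span F \<subseteq> {0}" using zero sK by auto
  have KF: "K \<inter> F = {}"
  proof -
    have "0 \<notin> K" using K(2) dependent_zero by blast
    thus ?thesis using disj by (auto dest: span_base)
  qed
  have ind: "independent (K \<union> F)"
    using F disj K independent_of_image[OF f F(4,3)] by (intro independent_Un_of_spans) auto
  have "S \<subseteq> span (K \<union> F)"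
  proof
    fix x assume x: "x \<in> S"
    then obtain y where y: "y \<in> span F" "f x = f y" using F(5) by (auto simp: f.span_image)
    have "y \<in> S" using y(1) F(1) S(1) by (metis span_minimal subsetD)
    hence "x - y \<in> span K" using x y S(1) K(3) by (auto simp: f.diff subspace_diff)
    hence "(x - y) + y \<in> span (K \<union> F)"
      using y(1) by (intro span_add) (auto intro: span_mono[THEN subsetD])
    thus "x \<in> span (K \<union> F)" by simp
  qed
  hence "dim S = card (K \<union> F)"
    using ind K F by (intro dim_eq_card) (auto intro!: span_eq[THEN iffD2] intro: span_base
      simp: span_superset subset_trans)
  also have "\<dots> = card K + card F" using finK F KF by (simp add: card_Un_disjoint)
  finally show ?thesis using K F by simp
qed

text \<open>Rank-nullity for a linear map with kernel \<open>P\<close>: it maps the sum and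
  \<open>Q\<close> to the same image, and it is injective on \<open>Q\<close>.\<close>

lemma dim_direct_sum:
  assumes P: "subspace P" "P \<subseteq> span T" and Q: "subspace Q" "Q \<subseteq> span T" and "finite T" "P \<inter> Q \<subseteq> {0}"
  shows "dim {x + y |x y. x \<in> P \<and> y \<in> Q} = dim P + dim Q"
proof -
  obtain p where p: "Vector_Spaces.linear scale scale p" "\<And>v. p v = 0 \<longleftrightarrow> v \<in> P"
    using exists_linear_with_kernel[OF P(1)] by blast
  interpret p: Vector_Spaces.linear scale scale p by fact
  let ?S = "{x + y |x y. x \<in> P \<and> y \<in> Q}"
  have S: "subspace ?S" "?S \<subseteq> span T" using P Q by (auto intro: subspace_sums span_add)
  have 0: "0 \<in> P" "0 \<in> Q" using P Q by (auto simp: subspace_0)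
  have "P \<subseteq> ?S" using 0 by force
  hence "{x \<in> ?S. p x = 0} = P" by (auto simp: p(2))
  moreover have "p ` ?S = p ` Q"
  proof
    have "p x = 0" if "x \<in> P" for x using that p(2) by simp
    thus "p ` ?S \<subseteq> p ` Q" by (auto simp: p.add)
    have "Q \<subseteq> ?S" using 0 by force
    thus "p ` Q \<subseteq> p ` ?S" by blast
  qed
  moreover have "dim Q = dim {x \<in> Q. p x = 0} + dim (p ` Q)"
    by (rule rank_nullity[OF p(1) Q assms(5)])
  moreover have "{x \<in> Q. p x = 0} = {0}" using assms(6) p(2) 0 by auto
  moreover have "dim {0} = 0"
    using dim_span_eq_card_independent[OF independent_empty] by simp
  ultimately show ?thesis using rank_nullity[OF p(1) S assms(5)] by simp
qed

text \<open>Both images are isomorphic to the quotient of \<open>Z\<close> by the common kernel.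
  This compares cohomology with the cohomology of a truncated complex.\<close>

lemma dim_image_same_kernel:
  assumes p: "Vector_Spaces.linear scale scale p" and r: "Vector_Spaces.linear scale scale r"
    and Z: "subspace Z" "p ` Z \<subseteq> span T" "finite T"
    and ker: "\<And>z. z \<in> Z \<Longrightarrow> p z = 0 \<longleftrightarrow> r z = 0"
  shows "dim (p ` Z) = dim (r ` Z)"
proof -
  interpret p: Vector_Spaces.linear scale scale p by fact
  interpret r: Vector_Spaces.linear scale scale r by fact
  interpret pair: vector_space_pair scale scale ..
  obtain F where F: "F \<subseteq> Z" "finite F" "inj_on p F" "independent (p ` F)" "p ` Z \<subseteq> span (p ` F)"
    "card F = dim (p ` Z)"
    using basis_of_image[OF Z(2,3)] by blast
  have sF: "span F \<subseteq> Z" using F(1) Z(1) by (rule span_minimal)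
  have "inj_on r (span F)"
  proof (rule inj_onI)
    fix x y assume xy: "x \<in> span F" "y \<in> span F" "r x = r y"
    hence "x - y \<in> span F" "r (x - y) = 0" by (auto simp: span_diff r.diff)
    thus "x = y" using ker[of "x - y"] sF kernel_Int_span_lift[OF p F(2,4,3)] by fastforce
  qed
  moreover have "independent F" by (rule independent_of_image[OF p F(4,3)])
  ultimately have ind: "independent (r ` F)"
    by (metis pair.linear_dependent_inj_imageD r)
  have "r ` Z \<subseteq> span (r ` F)"
  proof safe
    fix x assume x: "x \<in> Z"
    then obtain y where y: "y \<in> span F" "p x = p y" using F(5) by (auto simp: p.span_image)
    have "x - y \<in> Z" using x y sF Z(1) by (auto simp: subspace_diff)
    hence "r x = r y" using ker[of "x - y"] y(2) by (auto simp: p.diff r.diff)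
    thus "r x \<in> span (r ` F)" using y(1) by (auto simp: r.span_image)
  qed
  hence "card (r ` F) = dim (r ` Z)"
    using F ind by (intro basis_card_eq_dim) auto
  moreover have "inj_on r F" using \<open>inj_on r (span F)\<close> by (rule inj_on_subset) (rule span_superset)
  ultimately show ?thesis using F by (simp add: card_image)
qed

text \<open>Steinitz exchange modulo \<open>B\<close>: scanning \<open>F\<close> for the element at
  which \<open>x\<close> enters the span yields the one that \<open>x\<close> can replace.\<close>

lemma spanning_exchange:
  assumes "x \<in> span (F \<union> B)" "x \<notin> span B" "finite F"
  obtains f where "f \<in> F" "F \<subseteq> span (insert x (F - {f}) \<union> B)"
proof -
  have "\<exists>f\<in>F. f \<in> span (insert x (F - {f}) \<union> B)" using assms(3,1)
  proof (induction F)
    case empty thus ?case using assms(2) by simp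
  next
    case (insert a F)
    show ?case
    proof (cases "x \<in> span (F \<union> B)")
      case True
      then obtain f where f: "f \<in> F" "f \<in> span (insert x (F - {f}) \<union> B)" using insert.IH by blast
      have "span (insert x (F - {f}) \<union> B) \<subseteq> span (insert x (insert a F - {f}) \<union> B)"
        by (intro span_mono) auto
      thus ?thesis using f by blast
    next
      case False
      have "a \<in> span (insert x (F \<union> B))"
        using in_span_insert[of x a "F \<union> B"] insert.prems False by simp
      moreover have "insert a F - {a} = F" using insert.hyps by auto
      ultimately show ?thesis by (intro bexI[of _ a]) auto
    qed
  qed
  then obtain f where f: "f \<in> F" "f \<in> span (insert x (F - {f}) \<union> B)" by blast
  have "g \<in> span (insert x (F - {f}) \<union> B)" if "g \<in> F" for g
    using that f by (cases "g = f") (auto intro: span_base)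
  thus ?thesis using that[of f] f(1) by blast
qed

text \<open>The dimension count for an exact sequence: modulo \<open>B\<close> the image of
  \<open>Y\<close> has dimension at most \<open>card F\<close>, and modulo \<open>C\<close> the
  kernel is spanned by \<open>G\<close>. Lifts of a basis of the image together with
  \<open>G\<close> span \<open>Y\<close> modulo \<open>C\<close>.\<close>

lemma two_step_spanning:
  assumes g: "Vector_Spaces.linear scale scale g" and Y: "subspace Y" and B: "subspace B"
    and Z: "g ` Y \<subseteq> span (F \<union> B)" "finite F"
    and ker: "\<And>y. y \<in> Y \<Longrightarrow> g y \<in> B \<Longrightarrow> y \<in> span (G \<union> C)" "finite G"
  obtains H where "finite H" "card H \<le> card F + card G" "Y \<subseteq> span (H \<union> C)"
proof -
  obtain p where p: "Vector_Spaces.linear scale scale p" "\<And>v. p v = 0 \<longleftrightarrow> v \<in> B"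
    using exists_linear_with_kernel[OF B] by blast
  interpret p: Vector_Spaces.linear scale scale p by fact
  have pg: "Vector_Spaces.linear scale scale (p \<circ> g)" by (rule Vector_Spaces.linear_compose[OF g p(1)])
  interpret pg: Vector_Spaces.linear scale scale "p \<circ> g" by fact
  have sp: "(p \<circ> g) ` Y \<subseteq> span (p ` F)"
  proof -
    have "p ` B \<subseteq> {0}" using p(2) by auto
    hence "p ` span (F \<union> B) \<subseteq> span (insert 0 (p ` F))"
      by (subst p.span_image[symmetric]) (intro span_mono, auto)
    thus ?thesis using Z(1) by (auto simp: image_subset_iff)
  qed
  obtain E where E: "E \<subseteq> Y" "finite E" "inj_on (p \<circ> g) E" "independent ((p \<circ> g) ` E)"
    "(p \<circ> g) ` Y \<subseteq> span ((p \<circ> g) ` E)" "card E = dim ((p \<circ> g) ` Y)"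
    using basis_of_image[OF sp] Z(2) by blast
  have "card E \<le> card (p ` F)" unfolding E(6) using sp Z(2) by (intro dim_le_card) auto
  hence "card E \<le> card F" using card_image_le[OF Z(2), of p] by simp
  hence "card (E \<union> G) \<le> card F + card G" using card_Un_le[of E G] by simp
  moreover have "Y \<subseteq> span (E \<union> G \<union> C)"
  proof
    fix x assume x: "x \<in> Y"
    hence "(p \<circ> g) x \<in> (p \<circ> g) ` span E" using E(5) unfolding pg.span_image by blast
    then obtain y where y: "y \<in> span E" "(p \<circ> g) x = (p \<circ> g) y" by blast
    have "x - y \<in> Y" using x y(1) E(1) Y by (metis span_minimal subsetD subspace_diff)
    moreover have "p (g (x - y)) = 0" using y(2) pg.diff[of x y] by simp
    ultimately have "x - y \<in> span (G \<union> C)" using ker(1) p(2) by blast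
    hence "(x - y) + y \<in> span (E \<union> G \<union> C)"
      using y(1) by (intro span_add) (auto intro: span_mono[THEN subsetD])
    thus "x \<in> span (E \<union> G \<union> C)" by simp
  qed
  ultimately show ?thesis using that[of "E \<union> G"] E(2) ker(2) by blast
qed

end

section \<open>Polynomials as a rational vector space with the monomials as basis\<close>

declare single_one [simp del]

abbreviation qscale :: "rat \<Rightarrow> ('k \<Rightarrow>\<^sub>0 rat) \<Rightarrow> ('k \<Rightarrow>\<^sub>0 rat)" where
  "qscale c \<equiv> Poly_Mapping.map ((*) c)"

interpretation pm: vector_space qscale
  by unfold_locales (auto intro!: poly_mapping_eqI simp: lookup_add algebra_simps)

abbreviation mon :: "'k \<Rightarrow> ('k \<Rightarrow>\<^sub>0 rat)" where
  "mon M \<equiv> Poly_Mapping.single M 1"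

abbreviation lin :: "(('k \<Rightarrow>\<^sub>0 rat) \<Rightarrow> ('k \<Rightarrow>\<^sub>0 rat)) \<Rightarrow> bool" where
  "lin \<equiv> Vector_Spaces.linear qscale qscale"

lemma linI:
  assumes "\<And>f g. T (f + g) = T f + T g" "\<And>c f. T (qscale c f) = qscale c (T f)"
  shows "lin T"
  using assms by (simp add: Vector_Spaces.linear_iff pm.vector_space_axioms)

lemma
  assumes "lin T"
  shows lin_add: "T (f + g) = T f + T g"
    and lin_scale: "T (qscale c f) = qscale c (T f)"
    and lin_0: "T 0 = 0"
    and lin_diff: "T (f - g) = T f - T g"
    and lin_sum: "T (sum h I) = (\<Sum>i\<in>I. T (h i))"
proof -
  interpret T: Vector_Spaces.linear qscale qscale T by fact
  show "T (f + g) = T f + T g" "T (qscale c f) = qscale c (T f)" "T 0 = 0"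
    "T (f - g) = T f - T g" "T (sum h I) = (\<Sum>i\<in>I. T (h i))"
    by (rule T.add T.scale T.zero T.diff T.sum)+
qed

lemma lin_comp: "lin S \<Longrightarrow> lin T \<Longrightarrow> lin (\<lambda>f. T (S f))"
  by (intro linI) (simp_all add: lin_add lin_scale)

lemma lin_expand:
  assumes "lin T"
  shows "T f = (\<Sum>M\<in>Poly_Mapping.keys f. qscale (Poly_Mapping.lookup f M) (T (mon M)))"
proof -
  have "T f = T (\<Sum>M\<in>Poly_Mapping.keys f. qscale (Poly_Mapping.lookup f M) (mon M))"
    by (subst poly_mapping_as_sum[of f]) simp
  thus ?thesis by (simp only: lin_sum[OF assms] lin_scale[OF assms])
qed

lemma lin_eqI:
  assumes "lin T" "lin U" "\<And>M. M \<in> Poly_Mapping.keys f \<Longrightarrow> T (mon M) = U (mon M)"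
  shows "T f = U f"
  unfolding lin_expand[OF assms(1), of f] lin_expand[OF assms(2), of f]
  by (intro sum.cong refl) (simp add: assms(3))

lemma keys_lin:
  assumes "lin T"
  shows "Poly_Mapping.keys (T f) \<subseteq> (\<Union>M\<in>Poly_Mapping.keys f. Poly_Mapping.keys (T (mon M)))"
proof
  fix N assume "N \<in> Poly_Mapping.keys (T f)"
  hence "(\<Sum>M\<in>Poly_Mapping.keys f. Poly_Mapping.lookup f M * Poly_Mapping.lookup (T (mon M)) N) \<noteq> 0"
    by (subst (asm) lin_expand[OF assms]) (simp add: in_keys_iff lookup_sum)
  then obtain M where "M \<in> Poly_Mapping.keys f" "Poly_Mapping.lookup (T (mon M)) N \<noteq> 0"
    by (metis (no_types, lifting) mult_zero_right sum.neutral)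
  thus "N \<in> (\<Union>M\<in>Poly_Mapping.keys f. Poly_Mapping.keys (T (mon M)))"
    by (auto simp: in_keys_iff)
qed

definition lin_ext :: "('k \<Rightarrow> ('k \<Rightarrow>\<^sub>0 rat)) \<Rightarrow> ('k \<Rightarrow>\<^sub>0 rat) \<Rightarrow> ('k \<Rightarrow>\<^sub>0 rat)" where
  "lin_ext g f = (\<Sum>M\<in>Poly_Mapping.keys f. qscale (Poly_Mapping.lookup f M) (g M))"

lemma lin_ext_superset:
  assumes "finite S" "Poly_Mapping.keys f \<subseteq> S"
  shows "lin_ext g f = (\<Sum>M\<in>S. qscale (Poly_Mapping.lookup f M) (g M))"
  unfolding lin_ext_def
  using assms by (intro sum.mono_neutral_left) (auto simp: in_keys_iff)

lemma lin_lin_ext: "lin (lin_ext g)"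
proof (rule linI)
  fix f h :: "'a \<Rightarrow>\<^sub>0 rat" and c
  let ?S = "Poly_Mapping.keys f \<union> Poly_Mapping.keys h"
  show "lin_ext g (f + h) = lin_ext g f + lin_ext g h"
    using Poly_Mapping.keys_add[of f h]
    by (subst (1 2 3) lin_ext_superset[of ?S])
      (auto simp: lookup_add pm.scale_left_distrib sum.distrib)
  show "lin_ext g (qscale c f) = qscale c (lin_ext g f)"
    using keys_scale[of c f]
    by (subst (1 2) lin_ext_superset[of "Poly_Mapping.keys f"]) (auto simp: pm.scale_sum_right)
qed

lemma lin_ext_mono [simp]: "lin_ext g (mon M) = g M"
  by (simp add: lin_ext_def)

text \<open>The coordinate projection to the monomials in \<open>S\<close>. It serves for
  homogeneous components, for truncation, and for reading off coefficients modulo an ideal of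
  monomials.\<close>

definition res :: "'k set \<Rightarrow> ('k \<Rightarrow>\<^sub>0 rat) \<Rightarrow> ('k \<Rightarrow>\<^sub>0 rat)" where
  "res S = lin_ext (\<lambda>M. if M \<in> S then mon M else 0)"

lemma lin_res: "lin (res S)"
  unfolding res_def by (rule lin_lin_ext)

lemma lookup_res: "Poly_Mapping.lookup (res S f) M = (if M \<in> S then Poly_Mapping.lookup f M else 0)"
proof (induction f rule: lambda_induct)
  case (single N a)
  have "Poly_Mapping.single N a = qscale a (mon N)" by simp
  thus ?case by (simp only: lin_scale[OF lin_res]) (auto simp: res_def lookup_single when_def)
qed (simp_all add: lin_add[OF lin_res] lin_0[OF lin_res] lookup_add)

lemma keys_res [simp]: "Poly_Mapping.keys (res S f) = Poly_Mapping.keys f \<inter> S"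
  by (auto simp: in_keys_iff lookup_res split: if_splits)

lemma res_id: "Poly_Mapping.keys f \<subseteq> S \<Longrightarrow> res S f = f"
  by (intro poly_mapping_eqI) (auto simp: lookup_res in_keys_iff subset_iff)

lemma res_eq_0_iff: "res S f = 0 \<longleftrightarrow> Poly_Mapping.keys f \<inter> S = {}"
  by (simp add: keys_res[symmetric] del: keys_res)

lemma res_split: "f = res S f + res (- S) f"
  by (intro poly_mapping_eqI) (auto simp: lookup_res lookup_add)

lemma keys_diff_res: "Poly_Mapping.keys (f - res S f) = Poly_Mapping.keys f - S"
  by (auto simp: in_keys_iff lookup_res lookup_minus split: if_splits)

text \<open>Monomials outside \<open>S\<close> may be dropped before applying \<open>T\<close> if
  none of them contributes to \<open>R\<close>. The filtrations by weight, by length and by number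
  of odd factors are all exploited in this form.\<close>

lemma res_lin_cong:
  assumes "lin T" "\<And>M. M \<in> Poly_Mapping.keys f - S \<Longrightarrow> Poly_Mapping.keys (T (mon M)) \<inter> R = {}"
  shows "res R (T f) = res R (T (res S f))"
proof -
  have "Poly_Mapping.keys (T (res (- S) f)) \<inter> R = {}"
    using keys_lin[OF assms(1), of "res (- S) f"] assms(2) by fastforce
  hence "res R (T (res (- S) f)) = 0" by (simp add: res_eq_0_iff)
  thus ?thesis
    by (subst res_split[of f S]) (simp only: lin_add[OF assms(1)] lin_add[OF lin_res] add_0_right)
qed

definition supp :: "'k set \<Rightarrow> ('k \<Rightarrow>\<^sub>0 rat) set" where
  "supp S = {f. Poly_Mapping.keys f \<subseteq> S}"

lemma subspace_supp: "pm.subspace (supp S)"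
proof (rule pm.subspaceI)
  show "f + g \<in> supp S" if "f \<in> supp S" "g \<in> supp S" for f g
    using that keys_add_subset[of f S g] by (simp add: supp_def)
  show "qscale c f \<in> supp S" if "f \<in> supp S" for c f
    using that keys_scale[of c f] by (auto simp: supp_def)
qed (simp add: supp_def)

lemma supp_eq_span: "supp S = pm.span (mon ` S)"
proof
  show "supp S \<subseteq> pm.span (mon ` S)"
  proof
    fix f assume "f \<in> supp S"
    hence "(\<Sum>M\<in>Poly_Mapping.keys f. qscale (Poly_Mapping.lookup f M) (mon M)) \<in> pm.span (mon ` S)"
      by (intro pm.span_sum pm.span_scale pm.span_base) (auto simp: supp_def)
    thus "f \<in> pm.span (mon ` S)" by (simp flip: poly_mapping_as_sum)
  qed
  show "pm.span (mon ` S) \<subseteq> supp S"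
    by (rule pm.span_minimal[OF _ subspace_supp]) (auto simp: supp_def)
qed

lemma inj_mono: "inj_on mon S"
  by (auto simp: inj_on_def dest!: arg_cong[of _ _ Poly_Mapping.keys])

lemma independent_mono_image: "pm.independent (mon ` S)"
proof
  assume "pm.dependent (mon ` S)"
  then obtain M where M: "M \<in> S" "mon M \<in> pm.span (mon ` S - {mon M})"
    by (auto simp: pm.dependent_def)
  have "mon ` S - {mon M} = mon ` (S - {M})" using inj_mono[of UNIV] by (auto simp: inj_def)
  hence "mon M \<in> supp (S - {M})" using M by (simp add: supp_eq_span)
  thus False by (simp add: supp_def)
qed

lemma dim_supp: "pm.dim (supp S) = card S"
  unfolding supp_eq_span
  by (simp add: pm.dim_eq_card_independent independent_mono_image card_image inj_mono)

lemma card_le_of_spanned: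
  assumes "mon ` S \<subseteq> pm.span T" "finite T"
  shows "finite S" "card S \<le> card T"
  using pm.independent_span_bound[OF assms(2) independent_mono_image assms(1)]
  by (auto simp: finite_image_iff inj_mono card_image)

lemma lin_Lambda_mult_right: "lin (Lambda_mult deg f)"
  by (rule linI) (simp_all add: Lambda_mult_add_right Lambda_mult_scale_right)

lemma lin_Lambda_mult_left: "lin (\<lambda>f. Lambda_mult deg f g)"
  by (rule linI) (simp_all add: Lambda_mult_add_left Lambda_mult_scale_left)

lemma finite_monomials_bounded_degree:
  assumes "finite X" "\<And>x. x \<in> X \<Longrightarrow> 0 < deg x"
  shows "finite {M \<in> monomials X deg. mdeg deg M \<le> p}"
proof -
  have "{M \<in> monomials X deg. mdeg deg M \<le> p} \<subseteq> mset ` {xs. set xs \<subseteq> X \<and> length xs \<le> p}"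
  proof
    fix M assume M: "M \<in> {M \<in> monomials X deg. mdeg deg M \<le> p}"
    hence "set_mset M \<subseteq> X" by (auto simp: monomials_def)
    hence "size M \<le> mdeg deg M"
    proof (induction M)
      case (add x M)
      thus ?case using assms(2)[of x] by simp
    qed simp
    moreover obtain xs where "mset xs = M" by (metis ex_mset)
    ultimately show "M \<in> mset ` {xs. set xs \<subseteq> X \<and> length xs \<le> p}"
      using M by (intro image_eqI[of _ _ xs]) (auto simp: monomials_def)
  qed
  thus ?thesis using finite_lists_length_le[OF assms(1), of p] by (rule finite_subset[OF _ finite_imageI])
qed

section \<open>Hyperelliptic models\<close>

text \<open>\<open>d_odd\<close> bundles the degree of the differential, minimality
  (\<open>2 \<le> size M\<close>) and hyperellipticity (an even factor in each monomial).
  Finite-dimensional cohomology enters the lemmas separately, as a finite set \<open>F\<close> that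
  spans the cocycles modulo boundaries.\<close>

locale hyperelliptic_model =
  fixes X :: "'x::linorder set" and deg :: "'x \<Rightarrow> nat" and d :: "'x lambda \<Rightarrow> 'x lambda"
  assumes finite_X: "finite X"
    and deg_pos: "x \<in> X \<Longrightarrow> 0 < deg x"
    and lin_d: "lin d"
    and d_in_A: "f \<in> supp (monomials X deg) \<Longrightarrow> d f \<in> supp (monomials X deg)"
    and d_d: "f \<in> supp (monomials X deg) \<Longrightarrow> d (d f) = 0"
    and leibniz: "\<lbrakk>f \<in> supp {M \<in> monomials X deg. mdeg deg M = i}; g \<in> supp (monomials X deg)\<rbrakk> \<Longrightarrow>
      d (Lambda_mult deg f g) =
        Lambda_mult deg (d f) g + qscale ((- 1) ^ i) (Lambda_mult deg f (d g))"
    and d_even: "\<lbrakk>x \<in> X; even (deg x)\<rbrakk> \<Longrightarrow> d (mon {#x#}) = 0"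
    and d_odd: "\<lbrakk>x \<in> X; odd (deg x)\<rbrakk> \<Longrightarrow> d (mon {#x#}) \<in>
      supp {M \<in> monomials X deg. mdeg deg M = Suc (deg x) \<and> 2 \<le> size M \<and> (\<exists>y\<in>#M. even (deg y))}"
begin

abbreviation "Mon \<equiv> monomials X deg"

abbreviation "evens \<equiv> {x \<in> X. even (deg x)}"
abbreviation "odds \<equiv> {x \<in> X. odd (deg x)}"

abbreviation "ev \<equiv> filter_mset (\<lambda>x. even (deg x))"

abbreviation "A \<equiv> supp Mon"

section \<open>The differential on monomials\<close>

lemma subset_Mon: "M \<in> Mon \<Longrightarrow> K \<subseteq># M \<Longrightarrow> K \<in> Mon"
  unfolding monomials_def mem_Collect_eq
  by (meson mset_subset_eq_count order_trans set_mset_mono)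

lemma Mon_UNIV: "M \<in> Mon \<Longrightarrow> M \<in> monomials UNIV deg"
  by (auto simp: monomials_def)

lemma mult_mon_mon: "Lambda_mult deg (mon M) (mon N) = Poly_Mapping.single (M + N) (koszul_sign deg M N)"
  by (simp add: Lambda_mult_single)

lemma mono_in_supp [simp]: "mon M \<in> supp S \<longleftrightarrow> M \<in> S"
  by (simp add: supp_def)

lemma mult_in_A: "f \<in> A \<Longrightarrow> g \<in> A \<Longrightarrow> Lambda_mult deg f g \<in> A"
  by (simp add: supp_def Lambda_mult_closed)

lemma leibniz_mon:
  assumes "M \<in> Mon" "g \<in> A"
  shows "d (Lambda_mult deg (mon M) g) =
    Lambda_mult deg (d (mon M)) g + qscale ((- 1) ^ mdeg deg M) (Lambda_mult deg (mon M) (d g))"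
  using assms by (intro leibniz) auto

lemma one_mult: "f \<in> A \<Longrightarrow> Lambda_mult deg (mon {#}) f = f"
  by (rule Lambda_mult_one(1)[of _ X]) (simp add: supp_def)

lemma mult_one: "f \<in> A \<Longrightarrow> Lambda_mult deg f (mon {#}) = f"
  by (rule Lambda_mult_one(2)[of _ X]) (simp add: supp_def)

text \<open>How a monomial \<open>M'\<close> of \<open>d M\<close> compares with \<open>M\<close>: some odd generator \<open>y\<close> in \<open>M\<close> is replaced by a
  monomial of \<open>d y\<close>.\<close>

definition step :: "'x multiset \<Rightarrow> 'x multiset \<Rightarrow> bool" where
  "step M M' \<longleftrightarrow> M' \<in> Mon \<and> mdeg deg M' = Suc (mdeg deg M) \<and> size M < size M' \<and> 2 \<le> size M' \<and>
     ev M \<subseteq># ev M' \<and> ev M' \<noteq> {#} \<and> odd_count deg M \<le> Suc (odd_count deg M')"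

lemma d_one: "d (mon {#}) = 0"
proof -
  have "d (mon {#}) = d (mon {#}) + d (mon {#})"
    using leibniz_mon[of "{#}" "mon {#}"] d_in_A[of "mon {#}"]
    by (simp add: one_mult mult_one del: single_one)
  thus ?thesis by simp
qed

text \<open>A multiset stands for a sorted product, so splitting off an arbitrary generator costs a
  Koszul sign. The sign is nonzero on admissible monomials, which permits induction over
  multisets.\<close>

lemma d_factor:
  assumes M: "add_mset x K \<in> Mon"
  obtains s :: rat where "s \<noteq> 0" "K \<in> Mon" "{#x#} \<in> Mon"
    "mon (add_mset x K) = qscale s (Lambda_mult deg (mon {#x#}) (mon K))"
proof
  have "koszul_sign deg {#x#} K \<noteq> 0"
    using Mon_UNIV[OF M] by (simp add: koszul_sign_def)
  thus "1 / koszul_sign deg {#x#} K \<noteq> 0" and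
    "mon (add_mset x K) = qscale (1 / koszul_sign deg {#x#} K) (Lambda_mult deg (mon {#x#}) (mon K))"
    by (simp_all add: mult_mon_mon)
qed (use subset_Mon[OF M] in auto)

text \<open>Leibniz gives two kinds of terms. In \<open>d x\<close> times \<open>K\<close> the
  generator \<open>x\<close> must be odd and \<open>d_odd\<close> supplies the conditions; in
  \<open>x\<close> times \<open>d K\<close> they are inherited from \<open>K\<close>.\<close>

lemma step_d: "M \<in> Mon \<Longrightarrow> M' \<in> Poly_Mapping.keys (d (mon M)) \<Longrightarrow> step M M'"
proof (induction M arbitrary: M')
  case empty thus ?case by (simp add: d_one)
next
  case (add x K)
  obtain s where s: "s \<noteq> 0" "K \<in> Mon" "{#x#} \<in> Mon"
    "mon (add_mset x K) = qscale s (Lambda_mult deg (mon {#x#}) (mon K))"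
    using d_factor[OF add.prems(1)] by blast
  have x: "x \<in> X" using s(3) by (simp add: monomials_def)
  let ?f = "Lambda_mult deg (d (mon {#x#})) (mon K)"
  let ?g = "Lambda_mult deg (mon {#x#}) (d (mon K))"
  have "d (mon (add_mset x K)) = qscale s (?f + qscale ((- 1) ^ deg x) ?g)"
    unfolding s(4) lin_scale[OF lin_d] using leibniz_mon[OF s(3), of "mon K"] s(2) by simp
  hence "M' \<in> Poly_Mapping.keys ?f \<union> Poly_Mapping.keys ?g"
    using add.prems(2) by (auto simp: in_keys_iff lookup_add)
  thus ?case
  proof
    assume "M' \<in> Poly_Mapping.keys ?f"
    then obtain N where N: "M' = N + K" "N \<in> Poly_Mapping.keys (d (mon {#x#}))" "M' \<in> monomials UNIV deg"
      using keys_Lambda_mult[of deg "d (mon {#x#})" "mon K"] by auto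
    have o: "odd (deg x)" using N(2) d_even[OF x] by auto
    hence N': "N \<in> Mon" "mdeg deg N = Suc (deg x)" "2 \<le> size N" "\<exists>y\<in>#N. even (deg y)"
      using d_odd[OF x] N(2) by (auto simp: supp_def)
    have "M' \<in> Mon" using N(3) N'(1) s(2) by (auto simp: N(1) monomials_def)
    thus ?thesis using o N' unfolding step_def N(1)
      by (auto simp: odd_count_def filter_mset_eq_conv)
  next
    assume "M' \<in> Poly_Mapping.keys ?g"
    then obtain N where N: "M' = {#x#} + N" "N \<in> Poly_Mapping.keys (d (mon K))" "M' \<in> monomials UNIV deg"
      using keys_Lambda_mult[of deg "mon {#x#}" "d (mon K)"] by auto
    have "step K N" using add.IH s(2) N(2) by simp
    moreover have "M' \<in> Mon" using N(3) calculation x by (auto simp: N(1) monomials_def step_def)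
    ultimately show ?thesis unfolding step_def N(1) by (auto simp: odd_count_def)
  qed
qed

lemma keys_d:
  assumes "f \<in> A" "M' \<in> Poly_Mapping.keys (d f)"
  obtains M where "M \<in> Poly_Mapping.keys f" "step M M'"
  using assms keys_lin[OF lin_d, of f] step_d by (fastforce simp: supp_def)

section \<open>Multiplication and division by even monomials\<close>

definition shift :: "'x multiset \<Rightarrow> 'x lambda \<Rightarrow> 'x lambda" where
  "shift P = Lambda_mult deg (mon P)"

text \<open>Division by \<open>P\<close>, with 0 for monomials that \<open>P\<close> does not
  divide. For even \<open>P\<close> no sign arises, so it is a left inverse of
  \<open>shift P\<close>, and the other composite is the projection to the multiples of
  \<open>P\<close>.\<close>

definition unshift :: "'x multiset \<Rightarrow> 'x lambda \<Rightarrow> 'x lambda" where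
  "unshift P = lin_ext (\<lambda>M. if P \<subseteq># M then mon (M - P) else 0)"

lemma lin_shift: "lin (shift P)"
  unfolding shift_def by (rule lin_Lambda_mult_right)

lemma lin_unshift: "lin (unshift P)"
  unfolding unshift_def by (rule lin_lin_ext)

lemma unshift_mon: "unshift P (mon M) = (if P \<subseteq># M then mon (M - P) else 0)"
  by (simp add: unshift_def)

definition EvenMon :: "'x multiset set" where
  "EvenMon = {P. set_mset P \<subseteq> evens}"

lemma EvenMon_count: "P \<in> EvenMon \<Longrightarrow> odd (deg x) \<Longrightarrow> count P x = 0"
  by (auto simp: EvenMon_def count_eq_zero_iff)

lemma EvenMon_Mon: "P \<in> EvenMon \<Longrightarrow> P \<in> Mon"
  unfolding monomials_def by (auto simp: EvenMon_count) (auto simp: EvenMon_def)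

lemma EvenMon_add: "P \<in> EvenMon \<Longrightarrow> M \<in> Mon \<Longrightarrow> P + M \<in> Mon"
  unfolding monomials_def by (auto simp: EvenMon_count) (auto simp: EvenMon_def)

lemma EvenMon_inversions: "P \<in> EvenMon \<Longrightarrow> inversions deg P M = 0"
  unfolding inversions_def EvenMon_def by (induction P) auto

lemma shift_mon:
  assumes P: "P \<in> EvenMon" and M: "M \<in> Mon"
  shows "shift P (mon M) = mon (P + M)"
  using Mon_UNIV[OF EvenMon_add[OF assms]]
  by (simp add: shift_def mult_mon_mon koszul_sign_def EvenMon_inversions[OF P])

lemma unshift_shift:
  assumes "P \<in> EvenMon" "f \<in> A"
  shows "unshift P (shift P f) = f"
proof (rule lin_eqI[OF lin_comp[OF lin_shift lin_unshift] pm.linear_ident])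
  fix M assume "M \<in> Poly_Mapping.keys f"
  hence "M \<in> Mon" using assms(2) by (auto simp: supp_def)
  thus "unshift P (shift P (mon M)) = mon M" using assms(1) by (simp add: shift_mon unshift_mon)
qed

lemma res_mon: "res S (mon M) = (if M \<in> S then mon M else 0)"
  by (simp add: res_def)

lemma shift_unshift:
  assumes "P \<in> EvenMon" "f \<in> A"
  shows "shift P (unshift P f) = res {M. P \<subseteq># M} f"
proof (rule lin_eqI[OF lin_comp[OF lin_unshift lin_shift] lin_res])
  fix M assume "M \<in> Poly_Mapping.keys f"
  hence "M \<in> Mon" using assms(2) by (auto simp: supp_def)
  thus "shift P (unshift P (mon M)) = res {M. P \<subseteq># M} (mon M)"
    using assms(1) subset_Mon[of M "M - P"]
    by (simp add: shift_mon unshift_mon res_mon lin_0[OF lin_shift])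
qed

lemma keys_shift:
  assumes "P \<in> EvenMon" "f \<in> A"
  shows "Poly_Mapping.keys (shift P f) \<subseteq> (+) P ` Poly_Mapping.keys f"
  using keys_lin[OF lin_shift, of P f] assms by (fastforce simp: shift_mon supp_def)

lemma keys_unshift:
  "Poly_Mapping.keys (unshift P f) \<subseteq> {K. P + K \<in> Poly_Mapping.keys f}"
proof
  fix K assume "K \<in> Poly_Mapping.keys (unshift P f)"
  then obtain M where "M \<in> Poly_Mapping.keys f" "K \<in> Poly_Mapping.keys (unshift P (mon M))"
    using keys_lin[OF lin_unshift, of P f] by blast
  thus "K \<in> {K. P + K \<in> Poly_Mapping.keys f}" by (auto simp: unshift_mon split: if_splits)
qed

lemma shift_in_A: "P \<in> EvenMon \<Longrightarrow> f \<in> A \<Longrightarrow> shift P f \<in> A"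
  unfolding shift_def by (intro mult_in_A) (simp_all add: EvenMon_Mon)

lemma unshift_in_A: "f \<in> A \<Longrightarrow> unshift P f \<in> A"
  using keys_unshift[of P f] subset_Mon[of "P + _"] by (fastforce simp: supp_def)

lemma even_mdeg: "P \<in> EvenMon \<Longrightarrow> even (mdeg deg P)"
  unfolding EvenMon_def by (induction P) auto

lemma d_EvenMon: "P \<in> EvenMon \<Longrightarrow> d (mon P) = 0"
proof (induction P)
  case empty thus ?case by (simp add: d_one)
next
  case (add x K)
  have x: "{#x#} \<in> EvenMon" and K: "K \<in> EvenMon" using add.prems by (auto simp: EvenMon_def)
  have "d (shift {#x#} (mon K)) = 0"
    unfolding shift_def using leibniz_mon[of "{#x#}" "mon K"] add.IH K x d_even[of x]
    by (simp add: EvenMon_Mon EvenMon_def lin_0[OF lin_Lambda_mult_right])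
  thus ?case by (simp add: shift_mon[OF x EvenMon_Mon[OF K]])
qed

lemma d_shift: "P \<in> EvenMon \<Longrightarrow> f \<in> A \<Longrightarrow> d (shift P f) = shift P (d f)"
  unfolding shift_def
  by (simp add: leibniz_mon EvenMon_Mon d_EvenMon even_mdeg minus_one_power_iff)

section \<open>Quotients by even generators and the exponential bound\<close>

text \<open>The monomials of the ideal generated by the powers x^(N x) with \<open>x\<close> in
  \<open>S\<close>. Exponent 1 gives the successive quotients of the model; larger exponents occur
  in the exactness argument for the pure differential.\<close>

definition ideal_mons :: "'x set \<Rightarrow> ('x \<Rightarrow> nat) \<Rightarrow> 'x multiset set" where
  "ideal_mons S N = {M \<in> Mon. \<exists>x\<in>S. N x \<le> count M x}"

abbreviation "idl S N \<equiv> supp (ideal_mons S N)"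

lemma idl_in_A: "f \<in> idl S N \<Longrightarrow> f \<in> A"
  by (auto simp: supp_def ideal_mons_def)

text \<open>A step never loses an even factor, so exponents of even generators can only
  grow.\<close>

lemma step_ideal_mons:
  assumes "S \<subseteq> evens" "M \<in> ideal_mons S N" "step M M'"
  shows "M' \<in> ideal_mons S N"
proof -
  obtain x where x: "x \<in> S" "N x \<le> count M x" using assms(2) by (auto simp: ideal_mons_def)
  have "count (ev M) x \<le> count (ev M') x"
    using assms(3) by (intro mset_subset_eq_count) (simp add: step_def)
  hence "N x \<le> count M' x" using x assms(1) by (auto split: if_splits)
  thus ?thesis using x(1) assms(3) unfolding ideal_mons_def step_def by blast
qed

lemma d_ideal:
  assumes "S \<subseteq> evens" "f \<in> idl S N"
  shows "d f \<in> idl S N"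
  unfolding supp_def
proof safe
  fix M' assume "M' \<in> Poly_Mapping.keys (d f)"
  then obtain M where "M \<in> Poly_Mapping.keys f" "step M M'"
    using keys_d[OF idl_in_A[OF assms(2)]] by blast
  thus "M' \<in> ideal_mons S N" using assms step_ideal_mons[of S M N M'] by (auto simp: supp_def)
qed

text \<open>Cocycles and coboundaries of the quotient complex \<open>A/(S)\<close>, pulled back to \<open>A\<close>.\<close>

definition cyc :: "'x set \<Rightarrow> 'x lambda set" where
  "cyc S = {f \<in> A. d f \<in> idl S (\<lambda>_. 1)}"

definition bnd :: "'x set \<Rightarrow> 'x lambda set" where
  "bnd S = {e + j |e j. e \<in> d ` A \<and> j \<in> idl S (\<lambda>_. 1)}"

lemma subspace_image_d: "pm.subspace V \<Longrightarrow> pm.subspace (d ` V)"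
proof -
  interpret D: Vector_Spaces.linear qscale qscale d by (rule lin_d)
  show "pm.subspace V \<Longrightarrow> pm.subspace (d ` V)" by (rule D.subspace_image)
qed

lemma subspace_bnd: "pm.subspace (bnd S)"
  unfolding bnd_def by (rule pm.subspace_sums[OF subspace_image_d[OF subspace_supp] subspace_supp])

lemma subspace_cyc: "pm.subspace (cyc S)"
proof (rule pm.subspaceI)
  note A = subspace_supp[of Mon] and I = subspace_supp[of "ideal_mons S (\<lambda>_. 1)"]
  show "0 \<in> cyc S"
    using pm.subspace_0[OF A] pm.subspace_0[OF I] by (simp add: cyc_def lin_0[OF lin_d])
  show "f + g \<in> cyc S" if "f \<in> cyc S" "g \<in> cyc S" for f g
    using that pm.subspace_add[OF A, of f g] pm.subspace_add[OF I, of "d f" "d g"]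
    by (simp add: cyc_def lin_add[OF lin_d])
  show "qscale c f \<in> cyc S" if "f \<in> cyc S" for c f
    using that pm.subspace_scale[OF A, of f c] pm.subspace_scale[OF I, of "d f" c]
    by (simp add: cyc_def lin_scale[OF lin_d])
qed

lemma ideal_subset_bnd: "idl S (\<lambda>_. 1) \<subseteq> bnd S"
proof
  fix j assume "j \<in> idl S (\<lambda>_. 1)"
  moreover have "0 \<in> d ` A" by (rule pm.subspace_0[OF subspace_image_d[OF subspace_supp]])
  ultimately show "j \<in> bnd S" unfolding bnd_def by force
qed

lemma bnd_mono:
  assumes "S \<subseteq> T"
  shows "bnd S \<subseteq> bnd T"
proof -
  have "idl S (\<lambda>_. 1) \<subseteq> idl T (\<lambda>_. 1)" using assms by (force simp: supp_def ideal_mons_def)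
  thus ?thesis unfolding bnd_def by blast
qed

text \<open>The coefficient of the word \<open>x\<close> vanishes on boundaries, whose words have
  length at least 2 by minimality, and on the ideal of \<open>S\<close>. The nonzero class of
  \<open>x\<close> is what later saves one dimension per quotient.\<close>

lemma generator_notin_bnd:
  assumes "x \<notin> S"
  shows "mon {#x#} \<notin> bnd S"
proof
  assume "mon {#x#} \<in> bnd S"
  then obtain a j where aj: "a \<in> A" "j \<in> idl S (\<lambda>_. 1)" "mon {#x#} = d a + j"
    by (auto simp: bnd_def)
  have "{#x#} \<notin> Poly_Mapping.keys (d a)" using keys_d[OF aj(1)] by (force simp: step_def)
  moreover have "{#x#} \<notin> Poly_Mapping.keys j"
    using aj(2) assms by (auto simp: supp_def ideal_mons_def subset_iff split: if_splits)
  ultimately have "Poly_Mapping.lookup (d a + j) {#x#} = 0" by (simp add: lookup_add in_keys_iff)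
  thus False using aj(3)[symmetric] by simp
qed

text \<open>What is subtracted is exactly the part divisible by x^(N x). Each remaining monomial
  owes its membership in the ideal to a generator in \<open>S\<close>.\<close>

lemma minus_shift_unshift_idl:
  assumes "f \<in> idl (insert x S) N" "x \<in> evens"
  defines "P \<equiv> replicate_mset (N x) x"
  shows "f - shift P (unshift P f) \<in> idl S N"
proof -
  have "P \<in> EvenMon" using assms(2) by (simp add: P_def EvenMon_def)
  thus ?thesis using assms(1) idl_in_A[OF assms(1)]
    by (auto simp: shift_unshift P_def supp_def keys_diff_res ideal_mons_def
      simp flip: count_le_replicate_mset_subset_eq)
qed

text \<open>\<open>x\<close> is a nonzerodivisor modulo the ideal of \<open>S\<close>, since
  multiplying by a power of \<open>x\<close> leaves the exponents of the generators in
  \<open>S\<close> unchanged.\<close>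

lemma shift_idl_cancel:
  assumes "shift (replicate_mset n x) f \<in> idl S N" "f \<in> A" "x \<in> evens" "x \<notin> S"
  shows "f \<in> idl S N"
proof -
  let ?P = "replicate_mset n x"
  have "?P \<in> EvenMon" using assms(3) by (simp add: EvenMon_def)
  hence "f = unshift ?P (shift ?P f)" using assms(2) by (simp add: unshift_shift)
  hence "Poly_Mapping.keys f \<subseteq> {K. ?P + K \<in> Poly_Mapping.keys (shift ?P f)}"
    using keys_unshift[of ?P "shift ?P f"] by simp
  moreover have "count ?P y = 0" if "y \<in> S" for y using that assms(4) by auto
  ultimately show ?thesis using assms(1,2) by (fastforce simp: supp_def ideal_mons_def)
qed

text \<open>The connecting homomorphism of the long exact sequence, on cocycles: \<open>d a\<close>
  is \<open>x\<close> times \<open>c\<close> modulo \<open>S\<close>, and applying \<open>d\<close>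
  again shows that \<open>c\<close> is a cocycle modulo \<open>S\<close> because \<open>x\<close>
  can be cancelled.\<close>

lemma connecting_map_cyc:
  assumes S: "S \<subseteq> evens" and x: "x \<in> evens" "x \<notin> S" and a: "a \<in> cyc (insert x S)"
  defines "c \<equiv> unshift {#x#} (d a)"
  shows "c \<in> cyc S" "d a - shift {#x#} c \<in> idl S (\<lambda>_. 1)"
proof -
  have xE: "{#x#} \<in> EvenMon" using x by (simp add: EvenMon_def)
  have a': "a \<in> A" "d a \<in> idl (insert x S) (\<lambda>_. 1)" using a by (auto simp: cyc_def)
  have cA: "c \<in> A" unfolding c_def using a' d_in_A by (intro unshift_in_A)
  show j: "d a - shift {#x#} c \<in> idl S (\<lambda>_. 1)"
    using minus_shift_unshift_idl[OF a'(2) x(1)] by (simp add: c_def)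
  have "d (d a - shift {#x#} c) = - shift {#x#} (d c)"
    by (simp add: lin_diff[OF lin_d] d_d[OF a'(1)] d_shift[OF xE cA])
  hence "shift {#x#} (d c) \<in> idl S (\<lambda>_. 1)"
    using d_ideal[OF S j] pm.subspace_neg[OF subspace_supp] by fastforce
  hence "d c \<in> idl S (\<lambda>_. 1)"
    using shift_idl_cancel[of 1 x "d c" S] d_in_A[OF cA] x by simp
  thus "c \<in> cyc S" using cA by (simp add: cyc_def)
qed

text \<open>The long exact sequence of \<open>0 \<rightarrow> A/S \<rightarrow> A/S \<rightarrow> A/(S,x) \<rightarrow> 0\<close>, the first map being multiplication by
  \<open>x\<close>: the cokernel of \<open>x\<close> on cohomology loses the class of \<open>x\<close> itself.\<close>

lemma spanning_insert:
  assumes S: "S \<subseteq> evens" and x: "x \<in> evens" "x \<notin> S"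
    and F: "finite F" "cyc S \<subseteq> pm.span (F \<union> bnd S)"
  obtains H where "finite H" "card H + 1 \<le> 2 * card F" "cyc (insert x S) \<subseteq> pm.span (H \<union> bnd (insert x S))"
proof -
  let ?S = "insert x S"
  have xE: "{#x#} \<in> EvenMon" using x by (simp add: EvenMon_def)
  have xcyc: "mon {#x#} \<in> cyc S"
    using d_EvenMon[OF xE] EvenMon_Mon[OF xE] by (simp add: cyc_def pm.subspace_0[OF subspace_supp])
  have sb: "pm.span (bnd S) = bnd S" using subspace_bnd by (simp add: pm.span_eq_iff)
  \<comment> \<open>The class of \<open>x\<close> is nonzero modulo \<open>S\<close>, so it may
    replace some \<open>f\<close> in \<open>F\<close>. It dies modulo \<open>insert x S\<close>, so
    \<open>F - {f}\<close> already spans the image of the old cocycles there.\<close>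
  have "mon {#x#} \<in> pm.span (F \<union> bnd S)" "mon {#x#} \<notin> pm.span (bnd S)"
    using xcyc F(2) generator_notin_bnd[OF x(2)] by (auto simp: sb)
  from pm.spanning_exchange[OF this F(1)] obtain f
    where f: "f \<in> F" "F \<subseteq> pm.span (insert (mon {#x#}) (F - {f}) \<union> bnd S)" by blast
  let ?G = "F - {f}"
  have xb: "mon {#x#} \<in> bnd ?S"
  proof -
    have "mon {#x#} \<in> idl ?S (\<lambda>_. 1)" using EvenMon_Mon[OF xE] by (simp add: ideal_mons_def)
    thus ?thesis using ideal_subset_bnd by blast
  qed
  have bS: "bnd S \<subseteq> bnd ?S" by (rule bnd_mono) auto
  have cycS: "cyc S \<subseteq> pm.span (?G \<union> bnd ?S)"
  proof -
    have 1: "pm.span (insert (mon {#x#}) ?G \<union> bnd S) \<subseteq> pm.span (?G \<union> bnd ?S)"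
      using xb bS by (intro pm.span_mono) auto
    have 2: "bnd S \<subseteq> pm.span (?G \<union> bnd ?S)" using bS by (auto intro: pm.span_base)
    have "F \<union> bnd S \<subseteq> pm.span (?G \<union> bnd ?S)" using f(2) 1 2 by blast
    hence "pm.span (F \<union> bnd S) \<subseteq> pm.span (?G \<union> bnd ?S)"
      by (intro pm.span_minimal) auto
    thus ?thesis using F(2) by blast
  qed
  \<comment> \<open>The connecting map. Its image has dimension at most \<open>card F\<close>, and
    \<open>ker\<close> shows that its kernel is spanned by the \<open>card F - 1\<close> elements of
    \<open>?G\<close>.\<close>
  let ?g = "\<lambda>a. unshift {#x#} (d a)"
  have ker: "y \<in> pm.span (?G \<union> bnd ?S)" if y: "y \<in> cyc ?S" "?g y \<in> bnd S" for y
  proof -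
    obtain e j where ej: "e \<in> A" "j \<in> idl S (\<lambda>_. 1)" "?g y = d e + j"
      using y(2) by (auto simp: bnd_def)
    \<comment> \<open>If the connecting map sends \<open>y\<close> to a boundary
      \<open>d e + j\<close>, then subtracting \<open>x\<close> times \<open>e\<close> turns
      \<open>y\<close> into a cocycle modulo \<open>S\<close> without changing it modulo
      \<open>x\<close>.\<close>
    let ?z = "y - shift {#x#} e"
    have yA: "y \<in> A" using y(1) by (simp add: cyc_def)
    have ue: "shift {#x#} e \<in> A" using shift_in_A[OF xE ej(1)] .
    have zA: "?z \<in> A" using yA ue pm.subspace_diff[OF subspace_supp] by blast
    have "d ?z = (d y - shift {#x#} (?g y)) + shift {#x#} j"
      by (simp add: lin_diff[OF lin_d] d_shift[OF xE ej(1)] ej(3) lin_add[OF lin_shift])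
    moreover have "shift {#x#} j \<in> idl S (\<lambda>_. 1)"
    proof -
      have "Poly_Mapping.keys (shift {#x#} j) \<subseteq> add_mset x ` Poly_Mapping.keys j"
        using keys_shift[OF xE idl_in_A[OF ej(2)]] by simp
      thus ?thesis using ej(2) shift_in_A[OF xE idl_in_A[OF ej(2)]]
        by (fastforce simp: supp_def ideal_mons_def)
    qed
    ultimately have "d ?z \<in> idl S (\<lambda>_. 1)"
      using connecting_map_cyc(2)[OF S x y(1)] pm.subspace_add[OF subspace_supp] by simp
    hence "?z \<in> pm.span (?G \<union> bnd ?S)" using zA cycS by (auto simp: cyc_def)
    moreover have "shift {#x#} e \<in> pm.span (?G \<union> bnd ?S)"
    proof -
      have "shift {#x#} e \<in> idl ?S (\<lambda>_. 1)"
        using keys_shift[OF xE ej(1)] ue by (fastforce simp: supp_def ideal_mons_def)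
      thus ?thesis using ideal_subset_bnd by (auto intro: pm.span_base)
    qed
    ultimately have "?z + shift {#x#} e \<in> pm.span (?G \<union> bnd ?S)" by (rule pm.span_add)
    thus ?thesis by simp
  qed
  have img: "?g ` cyc ?S \<subseteq> pm.span (F \<union> bnd S)"
    using connecting_map_cyc(1)[OF S x] F(2) by blast
  obtain H where H: "finite H" "card H \<le> card F + card ?G" "cyc ?S \<subseteq> pm.span (H \<union> bnd ?S)"
    using pm.two_step_spanning[OF lin_comp[OF lin_d lin_unshift] subspace_cyc subspace_bnd img F(1) ker] F(1)
    by (metis finite_Diff)
  have "card ?G + 1 = card F" using f(1) F(1) by (metis Suc_eq_plus1 card_Suc_Diff1)
  thus ?thesis using that[of H] H by simp
qed

text \<open>Each quotient at most doubles \<open>card H - 1\<close>. The inequality is card H - 1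
  \<le> 2^(card T) * (card F - 1), written without subtraction on the naturals.\<close>

lemma spanning_quotient:
  assumes "finite T" "T \<subseteq> evens" "finite F" "cyc {} \<subseteq> pm.span (F \<union> bnd {})"
  shows "\<exists>H. finite H \<and> card H + 2 ^ card T \<le> 2 ^ card T * card F + 1 \<and> cyc T \<subseteq> pm.span (H \<union> bnd T)"
  using assms(1,2)
proof (induction T)
  case empty thus ?case using assms(3,4) by auto
next
  case (insert x T)
  then obtain H where H: "finite H" "card H + 2 ^ card T \<le> 2 ^ card T * card F + 1"
    "cyc T \<subseteq> pm.span (H \<union> bnd T)" by auto
  obtain H' where H': "finite H'" "card H' + 1 \<le> 2 * card H" "cyc (insert x T) \<subseteq> pm.span (H' \<union> bnd (insert x T))"
    using spanning_insert[of T x H] insert.prems insert.hyps H by auto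
  have "card H' + 2 ^ card (insert x T) \<le> 2 ^ card (insert x T) * card F + 1"
    using H(2) H'(2) insert.hyps by simp
  thus ?case using H' by blast
qed

lemma oddmon_Mon: "T \<subseteq> odds \<Longrightarrow> mset_set T \<in> Mon"
  using finite_subset[of T X] finite_X by (cases "finite T") (auto simp: monomials_def count_mset_set')

text \<open>Every monomial in the image of \<open>d\<close> has an even factor. Hence projecting to
  monomials without even factors kills \<open>bnd evens\<close>, while all products of distinct odd
  generators lie in \<open>cyc evens\<close> and survive as independent vectors.\<close>

lemma power_bound:
  assumes "finite F" "cyc {} \<subseteq> pm.span (F \<union> bnd {})"
  shows "2 ^ card odds + 2 ^ card evens \<le> 2 ^ card evens * card F + 1"
proof -
  obtain H where H: "finite H" "card H + 2 ^ card evens \<le> 2 ^ card evens * card F + 1"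
    "cyc evens \<subseteq> pm.span (H \<union> bnd evens)"
    using spanning_quotient[OF _ _ assms, of evens] finite_X by auto
  let ?E = "{M. ev M = {#}}"
  interpret R: Vector_Spaces.linear qscale qscale "res ?E" by (rule lin_res)
  have mem: "M \<in> ideal_mons evens (\<lambda>_. 1) \<longleftrightarrow> ev M \<noteq> {#}" if "M \<in> Mon" for M
    using that by (auto simp: ideal_mons_def monomials_def filter_mset_eq_mempty_iff Suc_le_eq)
  have dA: "d a \<in> idl evens (\<lambda>_. 1)" if "a \<in> A" for a
    using keys_d[OF that] mem unfolding supp_def step_def by blast
  have "res ?E b = 0" if "b \<in> bnd evens" for b
  proof -
    have "b \<in> idl evens (\<lambda>_. 1)"
      using that dA pm.subspace_add[OF subspace_supp] by (auto simp: bnd_def)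
    thus ?thesis using mem by (auto simp: res_eq_0_iff supp_def ideal_mons_def)
  qed
  hence "res ?E ` (H \<union> bnd evens) \<subseteq> insert 0 (res ?E ` H)" by auto
  hence "pm.span (res ?E ` (H \<union> bnd evens)) \<subseteq> pm.span (insert 0 (res ?E ` H))"
    by (rule pm.span_mono)
  hence span: "res ?E ` pm.span (H \<union> bnd evens) \<subseteq> pm.span (res ?E ` H)"
    unfolding R.span_image[symmetric] pm.span_insert_0 .
  have "mon ` mset_set ` Pow odds \<subseteq> pm.span (res ?E ` H)"
  proof safe
    fix T assume T: "T \<subseteq> odds"
    have M: "mset_set T \<in> Mon" by (rule oddmon_Mon[OF T])
    have fT: "finite T" by (rule finite_subset[OF T]) (simp add: finite_X)
    have "mset_set T \<in> ?E" using T fT by (auto simp: filter_mset_eq_mempty_iff)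
    hence "mon (mset_set T) = res ?E (mon (mset_set T))" by (simp add: res_id)
    moreover have "mon (mset_set T) \<in> cyc evens" using M dA by (simp add: cyc_def)
    ultimately show "mon (mset_set T) \<in> pm.span (res ?E ` H)" using H(3) span by blast
  qed
  hence "card (mset_set ` Pow odds) \<le> card (res ?E ` H)"
    using H(1) by (intro card_le_of_spanned(2)) auto
  also have "card (mset_set ` Pow odds) = card (Pow odds)"
  proof (rule card_image, rule inj_onI)
    fix S T assume "S \<in> Pow odds" "T \<in> Pow odds" "mset_set S = mset_set T"
    moreover from this have "finite S" "finite T" using finite_subset[of _ odds] finite_X by auto
    ultimately show "S = T" by (metis finite_set_mset_mset_set)
  qed
  also have "card (Pow odds) = 2 ^ card odds" using finite_X by (simp add: card_Pow)
  finally have "2 ^ card odds \<le> card H" using card_image_le[OF H(1), of "res ?E"] by linarith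
  thus ?thesis using H(2) by linarith
qed

text \<open>As \<open>d\<close> never lowers the weight (degree plus number of odd factors), its weight-preserving part
  \<open>pure_d\<close> is again a differential and a derivation: the differential of the associated pure model.\<close>

definition wt :: "'x multiset \<Rightarrow> nat" where
  "wt M = mdeg deg M + odd_count deg M"

lemma wt_add: "wt (M + K) = wt M + wt K"
  by (simp add: wt_def odd_count_def)

lemma step_wt: "step M M' \<Longrightarrow> wt M \<le> wt M'"
  by (simp add: wt_def step_def)

abbreviation "W q \<equiv> {M. wt M = q}"

definition pure_d :: "'x lambda \<Rightarrow> 'x lambda" where
  "pure_d = lin_ext (\<lambda>M. res (W (wt M)) (d (mon M)))"

lemma lin_pure_d: "lin pure_d"
  unfolding pure_d_def by (rule lin_lin_ext)

lemma pure_d_mon: "pure_d (mon M) = res (W (wt M)) (d (mon M))"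
  by (simp add: pure_d_def)

lemma pure_d_homogeneous:
  assumes "f \<in> supp (W q)"
  shows "pure_d f = res (W q) (d f)"
  by (rule lin_eqI[OF lin_pure_d lin_comp[OF lin_d lin_res]]) (use assms in \<open>auto simp: pure_d_mon supp_def\<close>)

lemma keys_pure_d:
  assumes "f \<in> A" "M' \<in> Poly_Mapping.keys (pure_d f)"
  obtains M where "M \<in> Poly_Mapping.keys f" "step M M'" "wt M' = wt M"
proof -
  obtain M where M: "M \<in> Poly_Mapping.keys f" "M' \<in> Poly_Mapping.keys (pure_d (mon M))"
    using keys_lin[OF lin_pure_d, of f] assms(2) by blast
  hence "M \<in> Mon" using assms(1) by (auto simp: supp_def)
  thus ?thesis using that[OF M(1)] M(2) step_d[of M M'] by (auto simp: pure_d_mon)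
qed

lemma pure_d_in_A: "f \<in> A \<Longrightarrow> pure_d f \<in> A"
proof -
  assume f: "f \<in> A"
  have "M' \<in> Mon" if "M' \<in> Poly_Mapping.keys (pure_d f)" for M'
    using keys_pure_d[OF f that] unfolding step_def by metis
  thus "pure_d f \<in> A" by (auto simp: supp_def)
qed

text \<open>Terms of weight above \<open>q\<close> stay above \<open>q\<close>, so the component of
  \<open>d f\<close> in the lowest weight sees only that component of \<open>f\<close>.\<close>

lemma res_W_d:
  assumes "f \<in> A" "\<And>M. M \<in> Poly_Mapping.keys f \<Longrightarrow> q \<le> wt M"
  shows "res (W q) (d (res (W q) f)) = res (W q) (d f)"
proof (rule res_lin_cong[OF lin_d, symmetric])
  fix M assume "M \<in> Poly_Mapping.keys f - W q"
  hence M: "M \<in> Mon" "q < wt M" using assms by (auto simp: supp_def order_less_le)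
  show "Poly_Mapping.keys (d (mon M)) \<inter> W q = {}"
    using step_d[OF M(1)] step_wt[of M] M(2) by fastforce
qed

text \<open>On a monomial this is the component of lowest weight in the identity
  \<open>d (d f) = 0\<close>.\<close>

lemma pure_d_pure_d:
  assumes "f \<in> A"
  shows "pure_d (pure_d f) = 0"
proof (rule lin_eqI[OF lin_comp[OF lin_pure_d lin_pure_d], of "\<lambda>_. 0"])
  show "lin (\<lambda>_. 0)" by (rule linI) simp_all
  fix M assume "M \<in> Poly_Mapping.keys f"
  hence M: "M \<in> Mon" using assms by (auto simp: supp_def)
  have "pure_d (pure_d (mon M)) = res (W (wt M)) (d (res (W (wt M)) (d (mon M))))"
    unfolding pure_d_mon by (rule pure_d_homogeneous) (simp add: supp_def)
  also have "\<dots> = res (W (wt M)) (d (d (mon M)))"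
    using M step_d[OF M] step_wt[of M] d_in_A[of "mon M"] by (intro res_W_d) auto
  also have "\<dots> = 0" using d_d[of "mon M"] M by (simp add: lin_0[OF lin_res])
  finally show "pure_d (pure_d (mon M)) = 0" .
qed

lemma res_W_mult:
  assumes "f \<in> supp (W q)"
  shows "res (W (q + w)) (Lambda_mult deg f g) = Lambda_mult deg f (res (W w) g)"
proof (rule lin_eqI[OF lin_comp[OF lin_Lambda_mult_right lin_res] lin_comp[OF lin_res lin_Lambda_mult_right]])
  fix K
  show "res (W (q + w)) (Lambda_mult deg f (mon K)) = Lambda_mult deg f (res (W w) (mon K))"
  proof (rule lin_eqI[OF lin_comp[OF lin_Lambda_mult_left lin_res] lin_Lambda_mult_left])
    fix M assume "M \<in> Poly_Mapping.keys f"
    hence "wt M = q" using assms by (auto simp: supp_def)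
    hence "wt (M + K) = q + w \<longleftrightarrow> wt K = w" by (simp add: wt_add)
    thus "res (W (q + w)) (Lambda_mult deg (mon M) (mon K)) = Lambda_mult deg (mon M) (res (W w) (mon K))"
      by (auto simp: res_mon mult_mon_mon lin_0[OF lin_Lambda_mult_right] res_eq_0_iff intro!: res_id)
  qed
qed

lemma res_W_mult':
  "res (W (q + wt K)) (Lambda_mult deg f (mon K)) = Lambda_mult deg (res (W q) f) (mon K)"
proof (rule lin_eqI[OF lin_comp[OF lin_Lambda_mult_left lin_res] lin_comp[OF lin_res lin_Lambda_mult_left]])
  fix M
  show "res (W (q + wt K)) (Lambda_mult deg (mon M) (mon K)) = Lambda_mult deg (res (W q) (mon M)) (mon K)"
    by (auto simp: res_mon mult_mon_mon lin_0[OF lin_Lambda_mult_left] res_eq_0_iff wt_add intro!: res_id)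
qed

text \<open>A weight component of the Leibniz rule for \<open>d\<close>. The element
  \<open>v\<close> is homogeneous twice: its degree fixes the sign, its weight fixes the component
  to extract.\<close>

lemma pure_d_leibniz:
  assumes v: "v \<in> supp {M \<in> Mon. mdeg deg M = i \<and> wt M = q}" and c: "c \<in> A"
  shows "pure_d (Lambda_mult deg v c) =
    Lambda_mult deg (pure_d v) c + qscale ((- 1) ^ i) (Lambda_mult deg v (pure_d c))"
proof (rule lin_eqI[of "\<lambda>c. pure_d (Lambda_mult deg v c)"])
  show "lin (\<lambda>c. pure_d (Lambda_mult deg v c))" by (rule lin_comp[OF lin_Lambda_mult_right lin_pure_d])
  show "lin (\<lambda>c. Lambda_mult deg (pure_d v) c + qscale ((- 1) ^ i) (Lambda_mult deg v (pure_d c)))"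
    by (rule linI) (simp_all add: lin_add[OF lin_Lambda_mult_right] lin_add[OF lin_pure_d]
      lin_scale[OF lin_Lambda_mult_right] lin_scale[OF lin_pure_d] scale_add pm.scale_left_commute)
  fix K assume "K \<in> Poly_Mapping.keys c"
  hence K: "K \<in> Mon" using c by (auto simp: supp_def)
  have vq: "v \<in> supp (W q)" and vi: "v \<in> supp {M \<in> Mon. mdeg deg M = i}"
    using v by (auto simp: supp_def)
  have "Lambda_mult deg v (mon K) \<in> supp (W (q + wt K))"
    using keys_Lambda_mult[of deg v "mon K"] vq by (fastforce simp: supp_def wt_add)
  hence "pure_d (Lambda_mult deg v (mon K)) = res (W (q + wt K)) (d (Lambda_mult deg v (mon K)))"
    by (rule pure_d_homogeneous)
  also have "\<dots> = res (W (q + wt K)) (Lambda_mult deg (d v) (mon K)) +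
      qscale ((- 1) ^ i) (res (W (q + wt K)) (Lambda_mult deg v (d (mon K))))"
    using leibniz[OF vi, of "mon K"] K by (simp add: lin_add[OF lin_res] lin_scale[OF lin_res])
  also have "\<dots> = Lambda_mult deg (pure_d v) (mon K) + qscale ((- 1) ^ i) (Lambda_mult deg v (pure_d (mon K)))"
    by (simp add: res_W_mult' res_W_mult[OF vq] pure_d_homogeneous[OF vq] pure_d_mon)
  finally show "pure_d (Lambda_mult deg v (mon K)) =
    Lambda_mult deg (pure_d v) (mon K) + qscale ((- 1) ^ i) (Lambda_mult deg v (pure_d (mon K)))" .
qed

lemma pure_d_shift:
  assumes "P \<in> EvenMon" "c \<in> A"
  shows "pure_d (shift P c) = shift P (pure_d c)"
proof -
  have "pure_d (mon P) = 0" using assms(1) by (simp add: pure_d_mon d_EvenMon lin_0[OF lin_res])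
  thus ?thesis
    using pure_d_leibniz[of "mon P" "mdeg deg P" "wt P" c] assms even_mdeg[OF assms(1)]
    by (simp add: shift_def EvenMon_Mon lin_0[OF lin_Lambda_mult_left] minus_one_power_iff)
qed

lemma pure_d_idl:
  assumes "S \<subseteq> evens" "f \<in> idl S N"
  shows "pure_d f \<in> idl S N"
  unfolding supp_def
proof safe
  fix M' assume "M' \<in> Poly_Mapping.keys (pure_d f)"
  then obtain M where "M \<in> Poly_Mapping.keys f" "step M M'"
    using keys_pure_d[OF idl_in_A[OF assms(2)]] by blast
  thus "M' \<in> ideal_mons S N" using assms step_ideal_mons[of S M N M'] by (auto simp: supp_def)
qed

lemma mult_idl:
  assumes "f \<in> A" "g \<in> idl S N"
  shows "Lambda_mult deg f g \<in> idl S N"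
  unfolding supp_def
proof safe
  fix M assume M: "M \<in> Poly_Mapping.keys (Lambda_mult deg f g)"
  hence "M \<in> Mon" using mult_in_A[OF assms(1) idl_in_A[OF assms(2)]] by (auto simp: supp_def)
  moreover obtain K L where "M = K + L" "L \<in> ideal_mons S N"
    using M keys_Lambda_mult[of deg f g] assms(2) by (fastforce simp: supp_def)
  ultimately show "M \<in> ideal_mons S N" by (auto simp: ideal_mons_def intro: trans_le_add2)
qed

text \<open>Homogeneity in abstract form: \<open>S\<close> and \<open>R\<close> stand for two
  consecutive degrees, or for the two parities of the degree.\<close>

lemma res_deg_d:
  assumes "f \<in> A" "\<And>M M'. step M M' \<Longrightarrow> M \<in> S \<longleftrightarrow> M' \<in> R"
  shows "res R (d f) = d (res S f)"
proof -
  have "res R (d f) = res R (d (res S f))"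
  proof (rule res_lin_cong[OF lin_d])
    fix M assume "M \<in> Poly_Mapping.keys f - S"
    thus "Poly_Mapping.keys (d (mon M)) \<inter> R = {}"
      using assms step_d[of M] by (fastforce simp: supp_def)
  qed
  also have "Poly_Mapping.keys (d (res S f)) \<subseteq> R"
  proof
    fix M' assume M': "M' \<in> Poly_Mapping.keys (d (res S f))"
    have "res S f \<in> A" using assms(1) by (auto simp: supp_def)
    then obtain M where "M \<in> Poly_Mapping.keys (res S f)" "step M M'" using M' by (rule keys_d)
    thus "M' \<in> R" using assms(2) by auto
  qed
  hence "res R (d (res S f)) = d (res S f)" by (rule res_id)
  finally show ?thesis .
qed

lemma res_deg_pure_d:
  assumes "f \<in> A" "\<And>M M'. step M M' \<Longrightarrow> wt M' = wt M \<Longrightarrow> M \<in> S \<longleftrightarrow> M' \<in> R"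
  shows "res R (pure_d f) = pure_d (res S f)"
proof -
  have "res R (pure_d f) = res R (pure_d (res S f))"
  proof (rule res_lin_cong[OF lin_pure_d])
    fix M assume M: "M \<in> Poly_Mapping.keys f - S"
    hence A: "mon M \<in> A" using assms(1) by (auto simp: supp_def)
    have "M' \<notin> R" if "M' \<in> Poly_Mapping.keys (pure_d (mon M))" for M'
      using keys_pure_d[OF A that] assms(2)[of M M'] M by auto
    thus "Poly_Mapping.keys (pure_d (mon M)) \<inter> R = {}" by blast
  qed
  also have "Poly_Mapping.keys (pure_d (res S f)) \<subseteq> R"
  proof
    fix M' assume M': "M' \<in> Poly_Mapping.keys (pure_d (res S f))"
    have "res S f \<in> A" using assms(1) by (auto simp: supp_def)
    then obtain M where "M \<in> Poly_Mapping.keys (res S f)" "step M M'" "wt M' = wt M" using M' by (rule keys_pure_d)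
    thus "M' \<in> R" using assms(2) by auto
  qed
  hence "res R (pure_d (res S f)) = pure_d (res S f)" by (rule res_id)
  finally show ?thesis .
qed

section \<open>Exactness of the pure differential in large weight\<close>

lemma cyc_empty: "cyc {} = {a \<in> A. d a = 0}"
  by (auto simp: cyc_def ideal_mons_def supp_def)

lemma bnd_empty: "bnd {} = d ` A"
proof -
  have "idl {} (\<lambda>_. 1) = {0}" by (auto simp: ideal_mons_def supp_def)
  thus ?thesis by (simp add: bnd_def)
qed

text \<open>The degree changes parity in a step and \<open>odd_count\<close> has the parity of the
  degree, so the count cannot stay 0; and it drops by at most 1.\<close>

lemma odd_count_step:
  assumes "step M M'" "odd_count deg M' = 0" "M \<in> Mon"
  shows "odd_count deg M = 1"
proof -
  have "odd_count deg M \<noteq> 0"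
  proof
    assume "odd_count deg M = 0"
    hence "even (mdeg deg M)" "even (mdeg deg M')"
      using odd_count_parity[of deg M] odd_count_parity[of deg M'] assms(2) by auto
    thus False using assms(1) by (simp add: step_def)
  qed
  thus ?thesis using assms by (simp add: step_def)
qed

text \<open>Powers of \<open>x\<close> are linearly dependent in cohomology, and the degrees separate them.\<close>

lemma power_exact:
  assumes F: "finite F" "cyc {} \<subseteq> pm.span (F \<union> bnd {})" and x: "x \<in> evens"
  obtains n i v where "odd i" "v \<in> supp {M \<in> Mon. mdeg deg M = i \<and> wt M = Suc i}"
    "pure_d v = mon (replicate_mset n x)"
proof -
  obtain p where p: "lin p" "\<And>v. p v = 0 \<longleftrightarrow> v \<in> bnd {}"
    using pm.exists_linear_with_kernel[OF subspace_bnd] by blast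
  interpret p: Vector_Spaces.linear qscale qscale p by (rule p(1))
  let ?P = "\<lambda>k. replicate_mset k x"
  \<comment> \<open>The powers x^0, ..., x^(card F) are more numerous than the dimension of
    cohomology allows, so some nonzero combination of them is a boundary.\<close>
  let ?K = "?P ` {..card F}"
  have PE: "?P k \<in> EvenMon" for k using x by (simp add: EvenMon_def)
  have inj: "inj ?P" by (rule injI) (metis size_replicate_mset)
  have cyc: "supp ?K \<subseteq> cyc {}"
    unfolding supp_eq_span
  proof (rule pm.span_minimal[OF _ subspace_cyc], safe)
    show "mon (?P k) \<in> cyc {}" for k using d_EvenMon[OF PE] EvenMon_Mon[OF PE] by (simp add: cyc_empty)
  qed
  have "p ` (F \<union> bnd {}) \<subseteq> insert 0 (p ` F)" using p(2) by auto
  hence "pm.span (p ` (F \<union> bnd {})) \<subseteq> pm.span (insert 0 (p ` F))" by (rule pm.span_mono)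
  hence "p ` pm.span (F \<union> bnd {}) \<subseteq> pm.span (p ` F)"
    unfolding p.span_image[symmetric] pm.span_insert_0 .
  hence "p ` supp ?K \<subseteq> pm.span (p ` F)" using cyc F(2) by blast
  hence "pm.dim (p ` supp ?K) \<le> card (p ` F)" using F(1) by (intro pm.dim_le_card) auto
  also have "\<dots> \<le> card F" by (rule card_image_le[OF F(1)])
  also have "card F < card ?K" using inj by (simp add: card_image inj_on_subset)
  also have "card ?K = pm.dim {v \<in> supp ?K. p v = 0} + pm.dim (p ` supp ?K)"
    using pm.rank_nullity[OF p(1) subspace_supp, of ?K "mon ` ?K"]
    by (simp add: supp_eq_span[symmetric] dim_supp)
  finally have dim: "pm.dim {v \<in> supp ?K. p v = 0} \<noteq> 0" by linarith
  have "\<exists>f. f \<in> supp ?K \<and> p f = 0 \<and> f \<noteq> 0"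
  proof (rule ccontr)
    assume "\<not> ?thesis"
    hence "{v \<in> supp ?K. p v = 0} \<subseteq> pm.span {}" by auto
    from pm.dim_le_card[OF this] dim show False by simp
  qed
  then obtain f where f: "f \<in> supp ?K" "p f = 0" "f \<noteq> 0" by blast
  then obtain a where a: "a \<in> A" "f = d a" using p(2) by (auto simp: bnd_empty)
  obtain k where k: "?P k \<in> Poly_Mapping.keys f"
    using f(1,3) by (fastforce simp: supp_def simp flip: keys_eq_empty)
  let ?n = "mdeg deg (?P k)"
  obtain M where M: "step M (?P k)" using keys_d[OF a(1)] k a(2) by metis
  then obtain i where i: "?n = Suc i" by (auto simp: step_def)
  have deg: "mdeg deg (?P l) = l * deg x" for l by simp
  define c where "c = Poly_Mapping.lookup f (?P k)"
  have c: "c \<noteq> 0" using k by (simp add: c_def in_keys_iff)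
  have "res {M. mdeg deg M = ?n} f = qscale c (mon (?P k))"
  proof (rule poly_mapping_eqI)
    fix L
    show "Poly_Mapping.lookup (res {M. mdeg deg M = ?n} f) L = Poly_Mapping.lookup (qscale c (mon (?P k))) L"
    proof (cases "L = ?P k")
      case False
      have "L \<notin> Poly_Mapping.keys f" if "mdeg deg L = ?n"
      proof
        assume "L \<in> Poly_Mapping.keys f"
        then obtain l where l: "L = ?P l" using f(1) by (auto simp: supp_def)
        hence "l * deg x = k * deg x" using that by simp
        thus False using False l deg_pos[of x] x by auto
      qed
      thus ?thesis using False by (auto simp: lookup_res lookup_single in_keys_iff)
    qed (simp add: lookup_res c_def)
  qed
  moreover have "res {M. mdeg deg M = ?n} f = d (res {M. mdeg deg M = i} a)"
    unfolding a(2) i by (rule res_deg_d[OF a(1)]) (auto simp: step_def)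
  ultimately have da: "d (res {M. mdeg deg M = i} a) = qscale c (mon (?P k))" by simp
  let ?a = "res {M. mdeg deg M = i} a"
  \<comment> \<open>Only terms with exactly one odd factor can reach x^k, which has none. Selecting
    them gives \<open>v\<close> the weight \<open>Suc i\<close>, which is both the degree and the
    weight of x^k. As \<open>d v\<close> has degree \<open>Suc i\<close>, its weight-preserving part
    is its part without odd factors.\<close>
  define v where "v = qscale (1 / c) (res {M. odd_count deg M = 1} ?a)"
  have kv: "Poly_Mapping.keys v \<subseteq> Poly_Mapping.keys (res {M. odd_count deg M = 1} ?a)"
    unfolding v_def by (rule keys_scale)
  have "M \<in> Mon \<and> mdeg deg M = i \<and> odd_count deg M = 1" if "M \<in> Poly_Mapping.keys v" for M
    using subsetD[OF kv that] a(1) by (auto simp: supp_def)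
  hence v: "v \<in> supp {M \<in> Mon. mdeg deg M = i \<and> wt M = Suc i}"
    by (auto simp: supp_def wt_def)
  have "pure_d v = res (W (Suc i)) (d v)" using v by (intro pure_d_homogeneous) (auto simp: supp_def)
  also have "\<dots> = res {M. odd_count deg M = 0} (d v)"
  proof -
    have "mdeg deg M = Suc i" if M: "M \<in> Poly_Mapping.keys (d v)" for M
    proof -
      have vA: "v \<in> A" using v by (auto simp: supp_def)
      obtain L where "L \<in> Poly_Mapping.keys v" "step L M" by (rule keys_d[OF vA M])
      thus ?thesis using v by (auto simp: supp_def step_def)
    qed
    hence "wt M = Suc i \<longleftrightarrow> odd_count deg M = 0" if "M \<in> Poly_Mapping.keys (d v)" for M
      using that by (auto simp: wt_def)
    hence "Poly_Mapping.lookup (res (W (Suc i)) (d v)) M =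
        Poly_Mapping.lookup (res {M. odd_count deg M = 0} (d v)) M" for M
      by (cases "M \<in> Poly_Mapping.keys (d v)") (simp_all add: lookup_res in_keys_iff)
    thus ?thesis by (rule poly_mapping_eqI)
  qed
  also have "\<dots> = qscale (1 / c) (res {M. odd_count deg M = 0} (d (res {M. odd_count deg M = 1} ?a)))"
    by (simp only: v_def lin_scale[OF lin_d] lin_scale[OF lin_res])
  also have "res {M. odd_count deg M = 0} (d (res {M. odd_count deg M = 1} ?a)) =
      res {M. odd_count deg M = 0} (d ?a)"
  proof (rule res_lin_cong[OF lin_d, symmetric])
    fix M assume "M \<in> Poly_Mapping.keys ?a - {M. odd_count deg M = 1}"
    hence M: "M \<in> Mon" "odd_count deg M \<noteq> 1" using a(1) by (auto simp: supp_def)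
    show "Poly_Mapping.keys (d (mon M)) \<inter> {M. odd_count deg M = 0} = {}"
      using step_d[OF M(1)] odd_count_step[of M] M by blast
  qed
  also have "qscale (1 / c) (res {M. odd_count deg M = 0} (d ?a)) = mon (?P k)"
  proof -
    have "odd_count deg (?P k) = 0" using x by (simp add: odd_count_def)
    hence "res {M. odd_count deg M = 0} (d ?a) = qscale c (mon (?P k))"
      unfolding da by (intro res_id) auto
    thus ?thesis using c by simp
  qed
  finally have "pure_d v = mon (?P k)" .
  moreover have "odd i" using i even_mdeg[OF PE, of k] by simp
  ultimately show ?thesis using that v by blast
qed

lemma finite_bounded_wt: "finite {M \<in> Mon. wt M \<le> p}"
  by (rule finite_subset[OF _ finite_monomials_bounded_degree[of X deg p, OF finite_X deg_pos]]) (auto simp: wt_def)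

text \<open>A monomial outside the ideal has exponents below \<open>N x\<close> at even generators
  and at most 1 at odd ones, which bounds its weight by a crude sum over \<open>X\<close>.\<close>

lemma bounded_outside_ideal:
  obtains p where "\<And>M. M \<in> Mon \<Longrightarrow> p < wt M \<Longrightarrow> M \<in> ideal_mons evens N"
proof
  fix M assume M: "M \<in> Mon" "(\<Sum>x\<in>X. (N x + 1) * (deg x + 1)) < wt M"
  have sum: "(\<Sum>x\<in>#K. f x) = (\<Sum>x\<in>X. count K x * f x)" if "set_mset K \<subseteq> X" for K and f :: "'x \<Rightarrow> nat"
    using that
  proof (induction K)
    case (add x K)
    have "(\<Sum>z\<in>X. count (add_mset x K) z * f z) = (\<Sum>z\<in>X. (if z = x then f x else 0) + count K z * f z)"
      by (intro sum.cong) auto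
    also have "\<dots> = f x + (\<Sum>z\<in>X. count K z * f z)"
      using add.prems finite_X by (simp add: sum.distrib)
    finally show ?case using add by simp
  qed simp
  show "M \<in> ideal_mons evens N"
  proof (rule ccontr)
    assume "M \<notin> ideal_mons evens N"
    hence lt: "count M x < N x" if "x \<in> evens" for x
      using that M(1) by (auto simp: ideal_mons_def not_le)
    have "count M x \<le> N x + 1" if "x \<in> X" for x
      using that lt[of x] M(1) by (cases "even (deg x)") (auto simp: monomials_def trans_le_add2)
    moreover have "wt M = (\<Sum>x\<in>X. count M x * (deg x + (if odd (deg x) then 1 else 0)))"
      using M(1) by (simp add: wt_def odd_count_def sum monomials_def sum.distrib algebra_simps)
    moreover have "(\<Sum>x\<in>X. count M x * (deg x + (if odd (deg x) then 1 else 0))) \<le>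
        (\<Sum>x\<in>X. (N x + 1) * (deg x + 1))"
      using calculation(1) by (intro sum_mono mult_le_mono) auto
    ultimately have "wt M \<le> (\<Sum>x\<in>X. (N x + 1) * (deg x + 1))" by simp
    thus False using M(2) by simp
  qed
qed

text \<open>Since \<open>x\<^sup>N = pure_d v\<close>, multiplication by \<open>x\<^sup>N\<close> is null-homotopic for each even \<open>x\<close>. Hence exactness modulo
  these powers, which is trivial in large weight, can be lifted by removing one power after the other.\<close>

lemma pure_d_exact_mod:
  assumes "\<And>x. x \<in> evens \<Longrightarrow> odd (i x) \<and> v x \<in> supp {M \<in> Mon. mdeg deg M = i x \<and> wt M = Suc (i x)} \<and>
      pure_d (v x) = mon (replicate_mset (N x) x)"
    and "a \<in> idl evens N" "pure_d a = 0" "finite T" "T \<subseteq> evens"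
  shows "\<exists>b\<in>A. a - pure_d b \<in> idl (evens - T) N"
  using assms(4,5)
proof (induction T)
  case empty
  have "0 \<in> A" by (rule pm.subspace_0[OF subspace_supp])
  thus ?case using assms(2) by (intro bexI[of _ 0]) (simp_all add: lin_0[OF lin_pure_d])
next
  case (insert x T)
  let ?S = "evens - insert x T"
  have x: "x \<in> evens" and S: "?S \<subseteq> evens" and ins: "evens - T = insert x ?S" using insert by auto
  obtain b where b: "b \<in> A" "a - pure_d b \<in> idl (insert x ?S) N" using insert unfolding ins by auto
  define z where "z = a - pure_d b"
  let ?P = "replicate_mset (N x) x"
  define c where "c = unshift ?P z"
  define z' where "z' = z - shift ?P c"
  have PE: "?P \<in> EvenMon" using x by (simp add: EvenMon_def)
  have aA: "a \<in> A" by (rule idl_in_A[OF assms(2)])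
  have z: "z \<in> idl (insert x ?S) N" using b by (simp add: z_def)
  have zA: "z \<in> A" by (rule idl_in_A[OF z])
  have cA: "c \<in> A" unfolding c_def by (rule unshift_in_A[OF zA])
  have z': "z' \<in> idl ?S N"
    unfolding z'_def c_def by (rule minus_shift_unshift_idl[OF z x])
  have "pure_d z = 0" by (simp add: z_def lin_diff[OF lin_pure_d] assms(3) pure_d_pure_d[OF b(1)])
  hence "shift ?P (pure_d c) = - pure_d z'"
    by (simp add: z'_def lin_diff[OF lin_pure_d] pure_d_shift[OF PE cA])
  hence "shift ?P (pure_d c) \<in> idl ?S N"
    using pure_d_idl[OF S z'] pm.subspace_neg[OF subspace_supp] by simp
  hence pure_dc: "pure_d c \<in> idl ?S N"
    using shift_idl_cancel[of "N x" x "pure_d c" ?S N] pure_d_in_A[OF cA] x by simp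
  have i: "odd (i x)" and v: "v x \<in> supp {M \<in> Mon. mdeg deg M = i x \<and> wt M = Suc (i x)}"
    and pure_dv: "pure_d (v x) = mon ?P" using assms(1)[OF x] by auto
  have vA: "v x \<in> A" using v by (auto simp: supp_def)
  \<comment> \<open>With \<open>z\<close> equal to x^N c + z' and v of odd degree, the pure
    differential of v c is x^N c minus v times that of c. So adding v c to \<open>b\<close> cancels
    x^N c. The error terms lie in the smaller ideal: z' by construction, and \<open>pure_d c\<close>
    because x^N times it is -\<open>pure_d z'\<close>.\<close>
  let ?b = "b + Lambda_mult deg (v x) c"
  have "pure_d (Lambda_mult deg (v x) c) = shift ?P c - Lambda_mult deg (v x) (pure_d c)"
    using pure_d_leibniz[OF v cA] i by (simp add: pure_dv shift_def minus_one_power_iff)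
  hence "a - pure_d ?b = z' + Lambda_mult deg (v x) (pure_d c)"
    by (simp add: lin_add[OF lin_pure_d] z'_def z_def)
  hence "a - pure_d ?b \<in> idl ?S N"
    using z' mult_idl[OF vA pure_dc] pm.subspace_add[OF subspace_supp] by simp
  moreover have "?b \<in> A" using b(1) mult_in_A[OF vA cA] pm.subspace_add[OF subspace_supp] by blast
  ultimately show ?case by blast
qed

text \<open>Beyond \<open>p\<close> every monomial lies in the ideal of all the powers x^(N x).
  Removing every even generator leaves the zero ideal, that is, an exact preimage, of which the
  component of weight \<open>q\<close> is again a preimage.\<close>

lemma pure_d_exact:
  assumes F: "finite F" "cyc {} \<subseteq> pm.span (F \<union> bnd {})"
  obtains p where "\<And>q a. \<lbrakk>p < q; a \<in> supp {M \<in> Mon. wt M = q}; pure_d a = 0\<rbrakk> \<Longrightarrow>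
    \<exists>b \<in> supp {M \<in> Mon. wt M = q}. pure_d b = a"
proof -
  define good where "good x = (\<lambda>(n, i, v). odd i \<and> v \<in> supp {M \<in> Mon. mdeg deg M = i \<and> wt M = Suc i} \<and>
      pure_d v = mon (replicate_mset n x))" for x
  have "\<exists>t. good x t" if x: "x \<in> evens" for x
  proof -
    obtain n i v where "odd i" "v \<in> supp {M \<in> Mon. mdeg deg M = i \<and> wt M = Suc i}"
      "pure_d v = mon (replicate_mset n x)"
      by (rule power_exact[OF F x])
    hence "good x (n, i, v)" by (simp add: good_def)
    thus ?thesis by blast
  qed
  then obtain t where t: "good x (t x)" if "x \<in> evens" for x by metis
  define N i v where "N x = fst (t x)" and "i x = fst (snd (t x))" and "v x = snd (snd (t x))" for x
  have N: "odd (i x) \<and> v x \<in> supp {M \<in> Mon. mdeg deg M = i x \<and> wt M = Suc (i x)} \<and>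
      pure_d (v x) = mon (replicate_mset (N x) x)" if "x \<in> evens" for x
    using t[OF that] by (simp add: good_def N_def i_def v_def split: prod.splits)
  obtain p where p: "\<And>M. M \<in> Mon \<Longrightarrow> p < wt M \<Longrightarrow> M \<in> ideal_mons evens N"
    using bounded_outside_ideal[of N] by blast
  show ?thesis
  proof (rule that)
    fix q a assume a: "p < q" "a \<in> supp {M \<in> Mon. wt M = q}" "pure_d a = 0"
    have "a \<in> idl evens N" using a p by (auto simp: supp_def)
    then obtain b where b: "b \<in> A" "a - pure_d b \<in> idl (evens - evens) N"
      using pure_d_exact_mod[OF N _ a(3), of evens] finite_X by auto
    have "idl {} N = {0}" by (auto simp: ideal_mons_def supp_def)
    hence "a = pure_d b" using b(2) by simp
    hence "pure_d (res (W q) b) = res (W q) a" using res_deg_pure_d[OF b(1), of "W q" "W q"] by simp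
    also have "\<dots> = a" using a(2) by (intro res_id) (auto simp: supp_def)
    finally show "\<exists>b \<in> supp {M \<in> Mon. wt M = q}. pure_d b = a"
      using b(1) by (intro bexI[of _ "res (W q) b"]) (auto simp: supp_def)
  qed
qed

section \<open>Acyclicity in large weight and the Euler characteristic of the truncation\<close>

lemma odd_count_le: "M \<in> Mon \<Longrightarrow> odd_count deg M \<le> card X"
proof -
  assume M: "M \<in> Mon"
  have "odd_count deg M = size (filter_mset (\<lambda>x. odd (deg x)) M)"
    unfolding odd_count_def by (induction M) auto
  also have "\<dots> \<le> size (mset_set X)"
  proof (rule size_mset_mono, rule mset_subset_eqI)
    fix x show "count (filter_mset (\<lambda>x. odd (deg x)) M) x \<le> count (mset_set X) x"
      using M finite_X by (cases "x \<in># M") (auto simp: monomials_def count_mset_set' not_in_iff)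
  qed
  finally show ?thesis by simp
qed

abbreviation "heavy p \<equiv> {M \<in> Mon. p < wt M}"

lemma d_heavy: "a \<in> supp (heavy p) \<Longrightarrow> d a \<in> supp (heavy p)"
proof -
  assume a: "a \<in> supp (heavy p)"
  hence aA: "a \<in> A" by (auto simp: supp_def)
  have "M' \<in> heavy p" if M': "M' \<in> Poly_Mapping.keys (d a)" for M'
  proof -
    obtain M where M: "M \<in> Poly_Mapping.keys a" "step M M'" by (rule keys_d[OF aA M'])
    hence "p < wt M" using a by (auto simp: supp_def)
    thus ?thesis using step_wt[OF M(2)] M(2) by (auto simp: step_def)
  qed
  thus "d a \<in> supp (heavy p)" by (auto simp: supp_def)
qed

text \<open>Correct a cocycle weight by weight; the weight is bounded in terms of the degree, so this stops.\<close>

lemma heavy_acyclic_aux: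
  assumes exact: "\<And>q a. \<lbrakk>p0 < q; a \<in> supp {M \<in> Mon. wt M = q}; pure_d a = 0\<rbrakk> \<Longrightarrow>
    \<exists>b \<in> supp {M \<in> Mon. wt M = q}. pure_d b = a"
    and "p0 \<le> p" "a \<in> supp {M \<in> heavy p. mdeg deg M \<le> k}" "d a = 0"
  shows "\<exists>b \<in> supp (heavy p). d b = a"
  using assms(2-)
\<comment> \<open>A monomial of degree at most \<open>k\<close> has weight at most
  \<open>k + card X\<close>, so once \<open>p\<close> reaches this bound no heavy monomial is
  left.\<close>
proof (induction "k + card X - p" arbitrary: p a)
  case 0
  have "M \<notin> Poly_Mapping.keys a" for M
    using 0 odd_count_le[of M] by (fastforce simp: supp_def wt_def)
  hence "a = 0" by (simp flip: keys_eq_empty) blast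
  thus ?case using pm.subspace_0[OF subspace_supp] lin_0[OF lin_d] by blast
next
  case (Suc n)
  let ?q = "Suc p"
  have "n = k + card X - ?q" using Suc.hyps(2) by simp
  have aA: "a \<in> A" using Suc.prems by (auto simp: supp_def)
  let ?aq = "res (W ?q) a"
  have "pure_d ?aq = res (W ?q) (d ?aq)" by (rule pure_d_homogeneous) (auto simp: supp_def)
  also have "\<dots> = res (W ?q) (d a)"
    using Suc.prems(2) by (intro res_W_d[OF aA]) (auto simp: supp_def)
  finally have "pure_d ?aq = 0" using Suc.prems(3) by (simp add: lin_0[OF lin_res])
  moreover have "?aq \<in> supp {M \<in> Mon. wt M = ?q}" using aA by (auto simp: supp_def)
  ultimately obtain b where b: "b \<in> supp {M \<in> Mon. wt M = ?q}" "pure_d b = ?aq"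
    using exact[of ?q ?aq] Suc.prems(1) by auto
  have bA: "b \<in> A" using b(1) by (auto simp: supp_def)
  \<comment> \<open>Cutting off degrees from \<open>k\<close> on keeps \<open>d ?b\<close> in degree
    at most \<open>k\<close>, so the degree bound survives the correction. Nothing is lost, as
    \<open>?aq\<close> has degree at most \<open>k\<close>.\<close>
  let ?b = "res {M. mdeg deg M < k} b"
  have "pure_d ?b = res {M. mdeg deg M \<le> k} (pure_d b)"
    by (rule res_deg_pure_d[OF bA, symmetric]) (auto simp: step_def)
  also have "\<dots> = ?aq" unfolding b(2) using Suc.prems(2) by (intro res_id) (auto simp: supp_def)
  finally have pure_db: "pure_d ?b = ?aq" .
  have bq: "?b \<in> supp (W ?q)" and bA': "?b \<in> A" and bh: "?b \<in> supp (heavy p)"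
    using b(1) by (auto simp: supp_def)
  have db: "d ?b \<in> supp {M \<in> heavy p. mdeg deg M \<le> k}"
  proof -
    have "mdeg deg M' \<le> k" if M': "M' \<in> Poly_Mapping.keys (d ?b)" for M'
    proof -
      obtain M where "M \<in> Poly_Mapping.keys ?b" "step M M'" by (rule keys_d[OF bA' M'])
      thus ?thesis by (auto simp: step_def)
    qed
    thus ?thesis using d_heavy[OF bh] by (auto simp: supp_def)
  qed
  let ?a = "a - d ?b"
  have aq: "?a \<in> supp {M \<in> heavy p. mdeg deg M \<le> k}"
    using Suc.prems(2) db pm.subspace_diff[OF subspace_supp] by blast
  have "res (W ?q) ?a = ?aq - res (W ?q) (d ?b)" by (simp add: lin_diff[OF lin_res])
  also have "\<dots> = 0" using pure_d_homogeneous[OF bq] pure_db by simp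
  finally have "Poly_Mapping.keys ?a \<inter> W ?q = {}" by (simp only: res_eq_0_iff)
  hence "?a \<in> supp {M \<in> heavy ?q. mdeg deg M \<le> k}"
    using aq by (fastforce simp: supp_def)
  moreover have "d ?a = 0" using Suc.prems(3) by (simp add: lin_diff[OF lin_d] d_d[OF bA'])
  ultimately obtain b' where b': "b' \<in> supp (heavy ?q)" "d b' = ?a"
    using Suc.hyps(1)[of ?q ?a] \<open>n = k + card X - ?q\<close> Suc.prems(1) by auto
  have "b' \<in> supp (heavy p)" using b'(1) by (fastforce simp: supp_def)
  hence "?b + b' \<in> supp (heavy p)" using bh pm.subspace_add[OF subspace_supp] by blast
  moreover have "d (?b + b') = a" using b'(2) by (simp add: lin_add[OF lin_d])
  ultimately show ?case by blast
qed

lemma heavy_acyclic: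
  assumes exact: "\<And>q a. \<lbrakk>p0 < q; a \<in> supp {M \<in> Mon. wt M = q}; pure_d a = 0\<rbrakk> \<Longrightarrow>
    \<exists>b \<in> supp {M \<in> Mon. wt M = q}. pure_d b = a"
    and "p0 \<le> p" "a \<in> supp (heavy p)" "d a = 0"
  shows "\<exists>b \<in> supp (heavy p). d b = a"
proof -
  let ?k = "Max (mdeg deg ` Poly_Mapping.keys a)"
  have a: "a \<in> supp {M \<in> heavy p. mdeg deg M \<le> ?k}"
    using assms(3) by (auto simp: supp_def)
  show ?thesis by (rule heavy_acyclic_aux[OF _ assms(2) a assms(4)]) (rule exact)
qed

definition par :: "bool \<Rightarrow> 'x multiset set" where
  "par b = {M \<in> Mon. even (mdeg deg M) = b}"

lemma res_par_d: "f \<in> A \<Longrightarrow> res (par (\<not> b)) (d f) = d (res (par b) f)"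
proof -
  assume f: "f \<in> A"
  have "res (par (\<not> b)) (d f) = res {M. even (mdeg deg M) \<noteq> b} (d f)"
    using d_in_A[OF f] by (intro poly_mapping_eqI) (auto simp: lookup_res par_def supp_def in_keys_iff subset_iff)
  also have "\<dots> = d (res {M. even (mdeg deg M) = b} f)"
    by (rule res_deg_d[OF f]) (auto simp: step_def)
  also have "res {M. even (mdeg deg M) = b} f = res (par b) f"
    using f by (intro poly_mapping_eqI) (auto simp: lookup_res par_def supp_def in_keys_iff subset_iff)
  finally show ?thesis .
qed

lemma d_par: "f \<in> supp (par b) \<Longrightarrow> d f \<in> supp (par (\<not> b))"
proof -
  assume f: "f \<in> supp (par b)"
  hence "f \<in> A" by (auto simp: supp_def par_def)
  hence "res (par (\<not> b)) (d f) = d f" using res_par_d[of f b] f by (simp add: res_id supp_def)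
  thus ?thesis by (metis (mono_tags, lifting) Int_lower2 keys_res mem_Collect_eq supp_def)
qed

definition cocyc :: "bool \<Rightarrow> 'x lambda set" where
  "cocyc b = {a \<in> supp (par b). d a = 0}"

lemma subspace_kernel: "lin T \<Longrightarrow> pm.subspace V \<Longrightarrow> pm.subspace {v \<in> V. T v = 0}"
  unfolding pm.subspace_def by (auto simp: lin_add lin_scale lin_0)

text \<open>The heavy monomials span a subcomplex, and the light ones carry the quotient complex
  with differential \<open>?D\<close>. The subcomplex is acyclic, so truncation induces an
  isomorphism on cohomology. As \<open>\<kappa>\<close> has the boundaries as kernel, its images of
  the cocycles have the dimensions of even and odd cohomology.\<close>

lemma euler_characteristic_light:
  assumes acyclic: "\<And>a. a \<in> supp (heavy p) \<Longrightarrow> d a = 0 \<Longrightarrow> \<exists>b \<in> supp (heavy p). d b = a"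
    and K: "lin \<kappa>" "\<And>v. \<kappa> v = 0 \<longleftrightarrow> v \<in> d ` A" and T: "finite T" "\<kappa> ` cocyc True \<subseteq> pm.span T" "\<kappa> ` cocyc False \<subseteq> pm.span T"
  shows "card {M \<in> par True. wt M \<le> p} + pm.dim (\<kappa> ` cocyc False) =
         card {M \<in> par False. wt M \<le> p} + pm.dim (\<kappa> ` cocyc True)"
proof -
  let ?L = "{M. wt M \<le> p}"
  let ?C = "\<lambda>b. supp {M \<in> par b. wt M \<le> p}"
  let ?D = "\<lambda>a. res ?L (d a)"
  have lD: "lin ?D" by (rule lin_comp[OF lin_d lin_res])
  have CA: "a \<in> A" if "a \<in> ?C b" for a b using that by (auto simp: supp_def par_def)
  have fin: "finite {M \<in> par b. wt M \<le> p}" for b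
    by (rule finite_subset[OF _ finite_bounded_wt[of p]]) (auto simp: par_def)
  have light: "res ?L (d (res ?L a)) = res ?L (d a)" if a: "a \<in> A" for a
  proof (rule res_lin_cong[OF lin_d, symmetric])
    fix M assume "M \<in> Poly_Mapping.keys a - ?L"
    hence M: "M \<in> Mon" "p < wt M" using a by (auto simp: supp_def)
    show "Poly_Mapping.keys (d (mon M)) \<inter> ?L = {}"
      using step_d[OF M(1)] step_wt[of M] M(2) by fastforce
  qed
  have DC: "?D a \<in> ?C (\<not> b)" if "a \<in> ?C b" for a b
  proof -
    have "a \<in> supp (par b)" using that by (auto simp: supp_def)
    thus ?thesis using d_par[of a b] by (auto simp: supp_def)
  qed
  have heavy: "a - res ?L a \<in> supp (heavy p)" if "a \<in> A" for a
    using that by (auto simp: supp_def keys_diff_res)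
  have key: "pm.dim {c \<in> ?C b. ?D c = 0} = pm.dim (\<kappa> ` cocyc b) + pm.dim (?D ` ?C (\<not> b))" for b
  proof -
    let ?ker = "{c \<in> ?C b. ?D c = 0}"
    let ?im = "?D ` ?C (\<not> b)"
    have sker: "pm.subspace ?ker" by (rule subspace_kernel[OF lD subspace_supp])
    have sim: "pm.subspace ?im"
    proof -
      interpret D: Vector_Spaces.linear qscale qscale ?D by (rule lD)
      show ?thesis by (rule D.subspace_image[OF subspace_supp])
    qed
    have scoc: "pm.subspace (cocyc b)" unfolding cocyc_def by (rule subspace_kernel[OF lin_d subspace_supp])
    have im_ker: "?im \<subseteq> ?ker"
    proof safe
      fix a assume a: "a \<in> ?C (\<not> b)"
      show "?D a \<in> ?C b" using DC[OF a] by simp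
      show "?D (?D a) = 0"
        by (simp add: light[OF d_in_A[OF CA[OF a]]] d_d[OF CA[OF a]] lin_0[OF lin_res])
    qed
    obtain q where q: "lin q" "\<And>v. q v = 0 \<longleftrightarrow> v \<in> ?im"
      using pm.exists_linear_with_kernel[OF sim] by blast
    have coc: "z \<in> A \<and> d z = 0" if "z \<in> cocyc b" for z
      using that by (auto simp: cocyc_def supp_def par_def)
    \<comment> \<open>Surjectivity on cocycles: if the truncated differential kills
      \<open>c\<close>, then \<open>d c\<close> is a heavy cocycle, hence \<open>d l\<close> for a
      heavy \<open>l\<close>, and \<open>c - l\<close> is a cocycle with truncation
      \<open>c\<close>. Restricting \<open>l\<close> to the parity of \<open>c\<close> keeps the
      lift homogeneous.\<close>
    have ker_eq: "?ker = res ?L ` cocyc b"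
    proof
      show "res ?L ` cocyc b \<subseteq> ?ker"
      proof
        fix c assume "c \<in> res ?L ` cocyc b"
        then obtain z where z: "z \<in> cocyc b" "c = res ?L z" by blast
        have "?D c = 0" using light[of z] coc[OF z(1)] by (simp add: z(2) lin_0[OF lin_res])
        moreover have "c \<in> ?C b" using z by (auto simp: cocyc_def supp_def)
        ultimately show "c \<in> ?ker" by simp
      qed
      show "?ker \<subseteq> res ?L ` cocyc b"
      proof
        fix c assume c: "c \<in> ?ker"
        have cA: "c \<in> A" using c CA by blast
        have "d c \<in> supp (heavy p)" using heavy[OF d_in_A[OF cA]] c by simp
        then obtain l where l: "l \<in> supp (heavy p)" "d l = d c"
          using acyclic[of "d c"] d_d[OF cA] by auto
        have lA: "l \<in> A" using l(1) by (auto simp: supp_def)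
        let ?l = "res (par b) l"
        have cp: "c \<in> supp (par b)" using c by (auto simp: supp_def)
        have "d ?l = res (par (\<not> b)) (d l)" by (rule res_par_d[OF lA, symmetric])
        also have "\<dots> = d c" unfolding l(2) using d_par[OF cp] by (intro res_id) (simp add: supp_def)
        finally have "d (c - ?l) = 0" by (simp add: lin_diff[OF lin_d])
        moreover have "?l \<in> supp (par b)" by (simp add: supp_def)
        hence "c - ?l \<in> supp (par b)" using cp pm.subspace_diff[OF subspace_supp] by blast
        ultimately have "c - ?l \<in> cocyc b" by (simp add: cocyc_def)
        moreover have "res ?L (c - ?l) = c"
        proof -
          have "res ?L c = c" using c by (intro res_id) (auto simp: supp_def)
          moreover have "res ?L ?l = 0" using l(1) by (force simp: res_eq_0_iff supp_def)
          ultimately show ?thesis by (simp add: lin_diff[OF lin_res])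
        qed
        ultimately show "c \<in> res ?L ` cocyc b" by (metis imageI)
      qed
    qed
    \<comment> \<open>Injectivity on cohomology: if \<open>z\<close> and \<open>d c\<close> agree in
      low weight, then \<open>z - d c\<close> is a heavy cocycle and therefore a boundary.\<close>
    have same: "\<kappa> z = 0 \<longleftrightarrow> q (res ?L z) = 0" if z: "z \<in> cocyc b" for z
    proof -
      have zA: "z \<in> A" "d z = 0" using coc[OF z] by auto
      show ?thesis unfolding K(2) q(2)
      proof
        assume "z \<in> d ` A"
        then obtain a where a: "a \<in> A" "z = d a" by blast
        let ?a = "res (par (\<not> b)) a"
        have "z \<in> supp (par b)" using z by (simp add: cocyc_def)
        hence "z = res (par b) (d a)" unfolding a(2) by (simp add: res_id supp_def)
        hence "z = d ?a" using res_par_d[OF a(1), of "\<not> b"] by simp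
        moreover have "?a \<in> A" using a(1) by (auto simp: supp_def)
        ultimately have "res ?L z = ?D (res ?L ?a)" by (simp only: light)
        moreover have "res ?L ?a \<in> ?C (\<not> b)" by (auto simp: supp_def)
        ultimately show "res ?L z \<in> ?im" by blast
      next
        assume "res ?L z \<in> ?im"
        then obtain c where c: "c \<in> ?C (\<not> b)" "res ?L z = ?D c" by blast
        have cA: "c \<in> A" using CA[OF c(1)] .
        let ?z = "z - d c"
        have "res ?L ?z = 0" using c(2) by (simp add: lin_diff[OF lin_res])
        moreover have "?z \<in> A" using zA(1) d_in_A[OF cA] pm.subspace_diff[OF subspace_supp] by blast
        ultimately have "?z \<in> supp (heavy p)" using heavy[of ?z] by simp
        then obtain l where l: "l \<in> supp (heavy p)" "d l = ?z"
          using acyclic[of ?z] d_d[OF cA] zA(2) by (auto simp: lin_diff[OF lin_d])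
        have "l + c \<in> A" using l(1) cA pm.subspace_add[OF subspace_supp[of Mon], of l c] by (auto simp: supp_def)
        moreover have "z = d (l + c)" using l(2) by (simp add: lin_add[OF lin_d])
        ultimately show "z \<in> d ` A" by blast
      qed
    qed
    have kT: "\<kappa> ` cocyc b \<subseteq> pm.span T" using T(2,3) by (cases b) auto
    have "pm.dim (\<kappa> ` cocyc b) = pm.dim ((\<lambda>z. q (res ?L z)) ` cocyc b)"
      by (rule pm.dim_image_same_kernel[OF K(1) lin_comp[OF lin_res q(1)] scoc kT T(1) same])
    also have "(\<lambda>z. q (res ?L z)) ` cocyc b = q ` ?ker" unfolding ker_eq by (simp add: image_image)
    finally have 1: "pm.dim (\<kappa> ` cocyc b) = pm.dim (q ` ?ker)" .
    have "?ker \<subseteq> pm.span (mon ` {M \<in> par b. wt M \<le> p})" by (auto simp: supp_eq_span[symmetric])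
    from pm.rank_nullity[OF q(1) sker this] fin
    have "pm.dim ?ker = pm.dim {x \<in> ?ker. q x = 0} + pm.dim (q ` ?ker)" by simp
    moreover have "{x \<in> ?ker. q x = 0} = ?im" using im_ker q(2) by blast
    ultimately show ?thesis using 1 by simp
  qed
  have "card {M \<in> par b. wt M \<le> p} = pm.dim {c \<in> ?C b. ?D c = 0} + pm.dim (?D ` ?C b)" for b
    using pm.rank_nullity[OF lD subspace_supp, of "{M \<in> par b. wt M \<le> p}" "mon ` {M \<in> par b. wt M \<le> p}"] fin
    by (simp add: supp_eq_span[symmetric] dim_supp)
  from this[of True] this[of False] key[of True] key[of False] show ?thesis by simp
qed

end

section \<open>The generating function of monomials by weight\<close>

text \<open>The sign is that of the parity of the degree, so the coefficients up to weight p add up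
  to the Euler characteristic of the light truncation.\<close>

definition weight_series :: "'x::linorder set \<Rightarrow> ('x \<Rightarrow> nat) \<Rightarrow> rat fps" where
  "weight_series X deg = Abs_fps (\<lambda>w. \<Sum>M | M \<in> monomials X deg \<and> mdeg deg M + odd_count deg M = w.
     (- 1) ^ odd_count deg M)"

lemma finite_monomials_weight:
  assumes "finite X" "\<And>x. x \<in> X \<Longrightarrow> 0 < deg x"
  shows "finite {M. M \<in> monomials X deg \<and> mdeg deg M + odd_count deg M = w}"
  by (rule finite_subset[OF _ finite_monomials_bounded_degree[of X deg w, OF assms]]) auto

text \<open>The monomials containing \<open>x\<close> are \<open>x\<close> times monomials in
  \<open>Y\<close>, where \<open>Y\<close> is \<open>insert x X\<close> for even \<open>x\<close>
  and \<open>X\<close> for odd \<open>x\<close>. The numbers \<open>k\<close> and \<open>s\<close>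
  are the weight and the sign of \<open>x\<close>.\<close>

lemma weight_series_insert:
  assumes X: "finite X" "x \<notin> X" "\<And>y. y \<in> insert x X \<Longrightarrow> 0 < deg y"
    and Y: "add_mset x -` monomials (insert x X) deg = monomials Y deg" "Y \<subseteq> insert x X"
  defines "k \<equiv> deg x + (if odd (deg x) then 1 else 0)" and "s \<equiv> if odd (deg x) then - 1 else 1"
  shows "weight_series (insert x X) deg = weight_series X deg + fps_const s * (fps_X ^ k * weight_series Y deg)"
proof (rule fps_ext)
  fix w
  let ?S = "\<lambda>X w. {M. M \<in> monomials X deg \<and> mdeg deg M + odd_count deg M = w}"
  let ?f = "\<lambda>M. (- 1) ^ odd_count deg M :: rat"
  let ?T = "{M \<in> ?S (insert x X) w. x \<in># M}"
  have un: "?S (insert x X) w = ?S X w \<union> ?T" and disj: "?S X w \<inter> ?T = {}"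
    using X(2) by (auto simp: monomials_def)
  have fin': "finite (?S (insert x X) w)" using X by (intro finite_monomials_weight) auto
  have fin: "finite (?S X w)" "finite ?T" by (rule finite_subset[OF _ fin'], use un in blast)+
  have "sum ?f (?S (insert x X) w) = sum ?f (?S X w) + sum ?f ?T"
    by (subst un) (rule sum.union_disjoint[OF fin disj])
  moreover have "sum ?f ?T = (if w < k then 0 else s * sum ?f (?S Y (w - k)))"
  proof -
    have img: "?T = add_mset x ` {M. add_mset x M \<in> monomials (insert x X) deg \<and> k + (mdeg deg M + odd_count deg M) = w}"
      (is "_ = _ ` ?R")
    proof (intro equalityI subsetI)
      fix M assume M: "M \<in> ?T"
      then obtain K where "M = add_mset x K" by (auto dest: multi_member_split)
      thus "M \<in> add_mset x ` ?R" using M by (auto simp: k_def odd_count_def)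
    qed (auto simp: k_def odd_count_def)
    have "?R = (if w < k then {} else ?S Y (w - k))"
      using Y(1) by (auto simp: vimage_def)
    moreover have "sum ?f ?T = (\<Sum>M\<in>?R. s * ?f M)"
      unfolding img by (subst sum.reindex) (auto simp: s_def odd_count_def inj_on_def)
    ultimately show ?thesis by (auto simp: sum_distrib_left)
  qed
  ultimately show "fps_nth (weight_series (insert x X) deg) w =
      fps_nth (weight_series X deg + fps_const s * (fps_X ^ k * weight_series Y deg)) w"
    by (simp add: weight_series_def fps_X_power_mult_nth)
qed

text \<open>For even \<open>x\<close> the recursion has the new series on both sides, so the factor
  1 - t^|x| ends up on the left; for odd \<open>x\<close> it directly multiplies the old series by 1
  - t^(|x| + 1).\<close>

lemma weight_series_product:
  assumes "finite X" "\<And>x. x \<in> X \<Longrightarrow> 0 < deg x"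
  shows "weight_series X deg * (\<Prod>x | x \<in> X \<and> even (deg x). 1 - fps_X ^ deg x) =
    (\<Prod>x | x \<in> X \<and> odd (deg x). 1 - fps_X ^ (deg x + 1))"
  using assms
proof (induction X)
  case empty
  have "{M. M \<in> monomials {} deg \<and> mdeg deg M + odd_count deg M = w} = (if w = 0 then {{#}} else {})" for w
    by (auto simp: monomials_def odd_count_def)
  hence "weight_series {} deg = 1"
    by (intro fps_ext) (simp add: weight_series_def odd_count_def)
  thus ?case by simp
next
  case (insert x X)
  let ?E = "{x \<in> X. even (deg x)}" and ?O = "{x \<in> X. odd (deg x)}"
  have IH: "weight_series X deg * (\<Prod>x\<in>?E. 1 - fps_X ^ deg x) = (\<Prod>x\<in>?O. 1 - fps_X ^ (deg x + 1))"
    using insert by simp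
  show ?case
  proof (cases "even (deg x)")
    case True
    have "add_mset x -` monomials (insert x X) deg = monomials (insert x X) deg"
      using True by (auto simp: monomials_def)
    hence "weight_series (insert x X) deg = weight_series X deg + fps_X ^ deg x * weight_series (insert x X) deg"
      using weight_series_insert[of X x deg "insert x X"] insert True by simp
    hence "weight_series (insert x X) deg * (1 - fps_X ^ deg x) = weight_series X deg"
      by (simp add: algebra_simps)
    moreover have "{y \<in> insert x X. even (deg y)} = insert x ?E" "{y \<in> insert x X. odd (deg y)} = ?O"
      using True by auto
    ultimately show ?thesis using insert.hyps IH by (simp flip: mult.assoc)
  next
    case False
    have "add_mset x -` monomials (insert x X) deg = monomials X deg"
    proof (intro equalityI subsetI)
      fix M assume M: "M \<in> add_mset x -` monomials (insert x X) deg"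
      hence "count (add_mset x M) x \<le> 1" using False unfolding monomials_def by blast
      hence "x \<notin># M" by (simp add: not_in_iff)
      moreover have "count M y \<le> 1" if "odd (deg y)" for y
        using M that \<open>x \<notin># M\<close> unfolding monomials_def
        by (cases "y = x") (auto dest!: spec[of _ y] simp: not_in_iff)
      ultimately show "M \<in> monomials X deg" using M by (auto simp: monomials_def)
    next
      fix M assume M: "M \<in> monomials X deg"
      hence "count M x = 0" using insert.hyps(2) by (auto simp: monomials_def not_in_iff[symmetric])
      thus "M \<in> add_mset x -` monomials (insert x X) deg" using M by (auto simp: monomials_def)
    qed
    hence "weight_series (insert x X) deg = weight_series X deg - fps_X ^ (deg x + 1) * weight_series X deg"
      using weight_series_insert[of X x deg X] insert.hyps insert.prems False
      by (simp add: subset_insertI flip: fps_const_neg)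
    hence "weight_series (insert x X) deg = weight_series X deg * (1 - fps_X ^ (deg x + 1))"
      by (simp add: algebra_simps)
    moreover have "{y \<in> insert x X. even (deg y)} = ?E" "{y \<in> insert x X. odd (deg y)} = insert x ?O"
      using False by auto
    ultimately show ?thesis using insert.hyps IH by (simp add: mult_ac)
  qed
qed

text \<open>The cofactor is 1 + t + ... + t^(c - 1).\<close>

lemma one_minus_power_factor:
  fixes c :: nat
  shows "\<exists>q :: rat poly. 1 - monom 1 c = (1 - monom 1 1) * q \<and> poly q 1 = of_nat c"
proof (induction c)
  case 0 thus ?case by (intro exI[of _ 0]) simp
next
  case (Suc c)
  then obtain q :: "rat poly" where q: "1 - monom 1 c = (1 - monom 1 1) * q" "poly q 1 = of_nat c" by blast
  have "1 - monom 1 (Suc c) = (1 - monom 1 c) + monom 1 c * (1 - monom 1 1 :: rat poly)"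
    by (simp add: algebra_simps mult_monom)
  also have "\<dots> = (1 - monom 1 1) * (q + monom 1 c)" by (simp add: q(1) algebra_simps)
  finally show ?case using q(2) by (intro exI[of _ "q + monom 1 c"]) (simp add: poly_monom)
qed

lemma prod_one_minus_powers_factor:
  fixes c :: "'a \<Rightarrow> nat"
  assumes "finite S"
  shows "\<exists>q :: rat poly. (\<Prod>x\<in>S. 1 - monom 1 (c x)) = (1 - monom 1 1) ^ card S * q \<and>
    poly q 1 = (\<Prod>x\<in>S. of_nat (c x))"
  using assms
proof (induction S)
  case empty thus ?case by (intro exI[of _ 1]) simp
next
  case (insert x S)
  then obtain q :: "rat poly" where q: "(\<Prod>x\<in>S. 1 - monom 1 (c x)) = (1 - monom 1 1) ^ card S * q"
    "poly q 1 = (\<Prod>x\<in>S. of_nat (c x))" by blast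
  obtain r :: "rat poly" where r: "1 - monom 1 (c x) = (1 - monom 1 1) * r" "poly r 1 = of_nat (c x)"
    using one_minus_power_factor by blast
  show ?case using insert.hyps q r by (intro exI[of _ "r * q"]) (simp add: mult_ac)
qed

text \<open>A comparison of zeros at 1: the product over the odd generators contains one factor 1 -
  t for each of them, and the product over the even ones contains exactly one for each, since its
  cofactor has the product of the positive degrees as value. The surplus divides
  \<open>g\<close>.\<close>

lemma weight_polynomial_vanishes:
  assumes "finite X" "\<And>x. x \<in> X \<Longrightarrow> 0 < deg x"
    and "card {x \<in> X. even (deg x)} < card {x \<in> X. odd (deg x)}"
    and g: "weight_series X deg = fps_of_poly g"
  shows "poly g 1 = 0"
proof -
  let ?E = "{x \<in> X. even (deg x)}" and ?O = "{x \<in> X. odd (deg x)}"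
  let ?u = "1 - monom 1 1 :: rat poly"
  have "fps_of_poly (g * (\<Prod>x\<in>?E. 1 - monom 1 (deg x))) = fps_of_poly (\<Prod>x\<in>?O. 1 - monom 1 (deg x + 1))"
    using weight_series_product[of X deg, OF assms(1,2)]
    by (simp add: g fps_of_poly_mult fps_of_poly_prod fps_of_poly_diff fps_of_poly_monom' del: add_Suc_right)
  hence eq: "g * (\<Prod>x\<in>?E. 1 - monom 1 (deg x)) = (\<Prod>x\<in>?O. 1 - monom 1 (deg x + 1))"
    by (simp only: fps_of_poly_eq_iff)
  obtain q where q: "(\<Prod>x\<in>?E. 1 - monom 1 (deg x)) = ?u ^ card ?E * q" "poly q 1 = (\<Prod>x\<in>?E. of_nat (deg x))"
    using prod_one_minus_powers_factor[of ?E deg] assms(1) by auto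
  obtain r where r: "(\<Prod>x\<in>?O. 1 - monom 1 (deg x + 1)) = ?u ^ card ?O * r"
    using prod_one_minus_powers_factor[of ?O "\<lambda>x. deg x + 1"] assms(1) by auto
  have "?u ^ card ?E * (g * q) = ?u ^ card ?E * (?u ^ (card ?O - card ?E) * r)"
    using eq assms(3) unfolding q(1) r by (simp add: mult_ac flip: power_add)
  moreover have "?u \<noteq> 0" by (metis eq_iff_diff_eq_0 monom_eq_1_iff zero_neq_one)
  ultimately have "g * q = ?u ^ (card ?O - card ?E) * r" by simp
  hence "poly g 1 * poly q 1 = poly (?u ^ (card ?O - card ?E) * r) 1" by (metis poly_mult)
  also have "\<dots> = 0" using assms(3) by (simp add: poly_monom)
  finally have "poly g 1 * poly q 1 = 0" .
  moreover have "deg x \<noteq> 0" if "x \<in> X" for x using assms(2)[OF that] by simp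
  hence "poly q 1 \<noteq> 0" using assms(1) by (auto simp: q(2))
  ultimately show ?thesis by simp
qed

section \<open>The dimension estimate\<close>

lemma dimension_arithmetic:
  fixes n m h e o' :: nat
  assumes sum: "e + o' \<le> h" and Q1: "n + 1 \<le> e" and Q2: "n * n + 3 * n + 2 \<le> 2 * e + 2 * m"
    and K: "2 ^ m + 2 ^ n \<le> 2 ^ n * h + 1" and E: "n < m \<Longrightarrow> e = o'"
  shows "n + m \<le> h"
proof -
  obtain q where q: "q = n * n" by simp
  have Q2: "q + 3 * n + 2 \<le> 2 * e + 2 * m" using Q2 q by simp
  show ?thesis
  proof (cases "m \<le> n")
    case True
    \<comment> \<open>This is (n - 1)(n - 2) \<ge> 0. Combined with \<open>Q2\<close>, e \<le> h and
      m \<le> n it gives 2h \<ge> 2n + 2m.\<close>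
    have "4 * n \<le> q + n + 2"
    proof (cases "n \<le> 2")
      case True
      hence "n = 0 \<or> n = 1 \<or> n = 2" by auto
      thus ?thesis by (auto simp: q)
    next
      case False
      hence "3 * n \<le> q" unfolding q by (intro mult_le_mono1) simp
      thus ?thesis using False by linarith
    qed
    moreover have "e \<le> h" using sum by simp
    ultimately show ?thesis using True Q2 by linarith
  next
    case False
    then obtain r where r: "m = n + r" "0 < r" by (metis less_imp_add_positive not_le)
    have h: "2 * e \<le> h" using sum E False by simp
    \<comment> \<open>\<open>K\<close> divided by 2^n. The summand 1 in \<open>K\<close> is absorbed
      once 2^n \<ge> 2, so only n = 0 costs an extra 1.\<close>
    have pow: "2 ^ r < h + (if n = 0 then 1 else 0)"
    proof (rule ccontr)
      assume "\<not> ?thesis"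
      hence "h + (if n = 0 then 1 else 0) \<le> 2 ^ r" by linarith
      hence *: "2 ^ n * (h + (if n = 0 then 1 else 0)) \<le> 2 ^ m"
        unfolding r(1) power_add by (rule mult_le_mono2)
      show False
      proof (cases "n = 0")
        case True thus ?thesis using * K by simp
      next
        case False
        hence "(2::nat) \<le> 2 ^ n" by (cases n) auto
        moreover have "2 ^ n * h \<le> 2 ^ m" using * False by simp
        ultimately show ?thesis using K by linarith
      qed
    qed
    have Q: "q + n + 2 \<le> h + 2 * r" using h Q2 r(1) by linarith
    \<comment> \<open>The target is now 2n + r \<le> h. For r \<le> 2 it follows from h \<ge> 2e
      \<ge> 2n + 2. For r = 3 the bound h \<ge> 9 covers n \<le> 3, and \<open>Q\<close> covers the
      rest.\<close>
    consider "n = 0" | "r \<le> 2" | "n \<noteq> 0" "r = 3" | "n \<noteq> 0" "4 \<le> r" by linarith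
    thus ?thesis
    proof cases
      case 1
      have "r < 2 ^ r" by (rule less_exp)
      moreover have "2 ^ r < h + 1" using pow 1 by simp
      ultimately show ?thesis using 1 r(1) by linarith
    next
      case 2
      thus ?thesis using h Q1 r by linarith
    next
      case 3
      show ?thesis
      proof (cases "n \<le> 3")
        case True thus ?thesis using pow 3 r by simp
      next
        case False
        hence "4 * n \<le> q" unfolding q by (intro mult_le_mono1) simp
        thus ?thesis using Q 3 r(1) False by linarith
      qed
    next
      case 4
      have r2: "4 * r \<le> 2 ^ r" using 4(2)
      proof (induction r rule: dec_induct)
        case (step k) thus ?case by simp
      qed simp
      show ?thesis
      proof (rule ccontr)
        assume "\<not> ?thesis"
        \<comment> \<open>A counterexample has 4r \<le> 2^r < h < 2n + r. This forces n to be large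
          compared with r, where the quadratic bound \<open>Q\<close> is violated.\<close>
        hence lt: "h < 2 * n + r" using r(1) by linarith
        moreover have "2 ^ r < h" using pow 4(1) by simp
        ultimately have n: "3 * r + 2 \<le> 2 * n" using r2 by linarith
        hence "7 \<le> n" using 4(2) by linarith
        hence "7 * n \<le> q" unfolding q by (rule mult_le_mono1)
        thus False using lt Q n by linarith
      qed
    qed
  qed
qed

context hyperelliptic_model
begin

text \<open>From \<open>p0\<close> on, every partial sum of coefficients equals the Euler
  characteristic of cohomology. Differences of consecutive partial sums then vanish, so the series
  is a polynomial, and its value at 1 is that Euler characteristic.\<close>

lemma euler_characteristic_zero:
  assumes F: "finite F" "cyc {} \<subseteq> pm.span (F \<union> bnd {})" and lt: "card evens < card odds"
    and K: "lin \<kappa>" "\<And>v. \<kappa> v = 0 \<longleftrightarrow> v \<in> d ` A" and T: "finite T" "\<kappa> ` cocyc True \<subseteq> pm.span T" "\<kappa> ` cocyc False \<subseteq> pm.span T"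
  shows "pm.dim (\<kappa> ` cocyc True) = pm.dim (\<kappa> ` cocyc False)"
proof -
  obtain p0 where p0: "\<And>q a. \<lbrakk>p0 < q; a \<in> supp {M \<in> Mon. wt M = q}; pure_d a = 0\<rbrakk> \<Longrightarrow>
      \<exists>b \<in> supp {M \<in> Mon. wt M = q}. pure_d b = a"
    using pure_d_exact[OF F] by blast
  define c where "c = fps_nth (weight_series X deg)"
  let ?e = "rat_of_nat (pm.dim (\<kappa> ` cocyc True))" and ?o = "rat_of_nat (pm.dim (\<kappa> ` cocyc False))"
  have c: "c w = (\<Sum>M | M \<in> Mon \<and> wt M = w. (- 1) ^ odd_count deg M)" for w
    by (simp add: c_def weight_series_def wt_def)
  have fin: "finite {M \<in> par b. wt M \<le> p}" for b p
    by (rule finite_subset[OF _ finite_bounded_wt[of p]]) (auto simp: par_def)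
  have partial: "(\<Sum>w\<le>p. c w) = ?e - ?o" if p: "p0 \<le> p" for p
  proof -
    have "(\<Sum>w\<le>p. c w) = (\<Sum>M | M \<in> Mon \<and> wt M \<le> p. (- 1) ^ odd_count deg M)"
    proof -
      have "(\<Sum>M | M \<in> Mon \<and> wt M \<le> p. (- 1) ^ odd_count deg M) =
          (\<Sum>w\<in>{..p}. \<Sum>M | M \<in> {M. M \<in> Mon \<and> wt M \<le> p} \<and> wt M = w. (- 1) ^ odd_count deg M :: rat)"
        using finite_bounded_wt[of p] by (intro sum.group[symmetric]) auto
      also have "\<dots> = (\<Sum>w\<le>p. c w)"
        unfolding c by (intro sum.cong arg_cong2[where f = sum] refl) auto
      finally show ?thesis by simp
    qed
    also have "{M. M \<in> Mon \<and> wt M \<le> p} = {M \<in> par True. wt M \<le> p} \<union> {M \<in> par False. wt M \<le> p}"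
      by (auto simp: par_def)
    also have "(\<Sum>M\<in>\<dots>. (- 1) ^ odd_count deg M :: rat) =
        (\<Sum>M | M \<in> par True \<and> wt M \<le> p. (- 1) ^ odd_count deg M) +
        (\<Sum>M | M \<in> par False \<and> wt M \<le> p. (- 1) ^ odd_count deg M)"
      by (rule sum.union_disjoint[OF fin fin]) (auto simp: par_def)
    also have "(\<Sum>M | M \<in> par True \<and> wt M \<le> p. (- 1) ^ odd_count deg M :: rat) = (\<Sum>M | M \<in> par True \<and> wt M \<le> p. 1)"
      by (intro sum.cong refl) (auto simp: par_def minus_one_power_iff odd_count_parity)
    also have "(\<Sum>M | M \<in> par False \<and> wt M \<le> p. (- 1) ^ odd_count deg M :: rat) = (\<Sum>M | M \<in> par False \<and> wt M \<le> p. - 1)"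
      by (intro sum.cong refl) (auto simp: par_def minus_one_power_iff odd_count_parity)
    finally have 1: "(\<Sum>w\<le>p. c w) = of_nat (card {M \<in> par True. wt M \<le> p}) - of_nat (card {M \<in> par False. wt M \<le> p})"
      by simp
    have "card {M \<in> par True. wt M \<le> p} + pm.dim (\<kappa> ` cocyc False) =
        card {M \<in> par False. wt M \<le> p} + pm.dim (\<kappa> ` cocyc True)"
    proof (rule euler_characteristic_light[OF _ K T])
      show "\<exists>b\<in>supp (heavy p). d b = a" if "a \<in> supp (heavy p)" "d a = 0" for a
        by (rule heavy_acyclic[OF _ p that]) (rule p0)
    qed
    from arg_cong[OF this, of rat_of_nat] 1 show ?thesis by (simp add: algebra_simps)
  qed
  have zero: "c w = 0" if w: "p0 < w" for w
  proof -
    obtain p where p: "w = Suc p" "p0 \<le> p" using w by (cases w) auto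
    show ?thesis using partial[OF p(2)] partial[of "Suc p"] p by simp
  qed
  define g where "g = (\<Sum>w\<le>p0. monom (c w) w)"
  have "weight_series X deg = fps_of_poly g"
  proof (rule fps_ext)
    fix w
    have "coeff g w = (\<Sum>v\<le>p0. if v = w then c v else 0)" by (simp add: g_def coeff_sum)
    also have "\<dots> = c w" using zero[of w] by (auto simp: not_le)
    finally show "fps_nth (weight_series X deg) w = fps_nth (fps_of_poly g) w" by (simp add: c_def)
  qed
  hence "poly g 1 = 0" using weight_polynomial_vanishes[OF finite_X deg_pos lt] by blast
  hence "(\<Sum>w\<le>p0. c w) = 0" by (simp add: g_def poly_sum poly_monom)
  thus ?thesis using partial[of p0] by simp
qed

lemma short_even_words:
  assumes "finite F" "cocyc True \<subseteq> pm.span (F \<union> d ` A)"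
  shows "card evens + 1 \<le> card F"
    and "card evens * card evens + 3 * card evens + 2 \<le> 2 * card F + 2 * card odds"
proof -
  define U where "U k = {P \<in> EvenMon. size P \<le> k}" for k
  have U: "mon ` U k \<subseteq> cocyc True" for k
    by (auto simp: U_def cocyc_def d_EvenMon EvenMon_Mon par_def even_mdeg)
  \<comment> \<open>All words in even generators are cocycles. Projected to the words of length at
    most \<open>k\<close>, they are therefore spanned by the projections of \<open>F\<close> and of
    the boundaries.\<close>
  have bound: "finite (U k) \<and> card (U k) \<le> card F + card G"
    if G: "finite G" "res (U k) ` d ` A \<subseteq> pm.span G" for k G
  proof -
    interpret R: Vector_Spaces.linear qscale qscale "res (U k)" by (rule lin_res)
    have "res (U k) ` (F \<union> d ` A) \<subseteq> pm.span (res (U k) ` F \<union> G)"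
      using G(2) pm.span_mono[of G "res (U k) ` F \<union> G"] by (auto intro: pm.span_base)
    hence "pm.span (res (U k) ` (F \<union> d ` A)) \<subseteq> pm.span (res (U k) ` F \<union> G)"
      by (rule pm.span_minimal) simp
    moreover have "mon ` U k \<subseteq> res (U k) ` cocyc True"
    proof safe
      fix P assume P: "P \<in> U k"
      hence "mon P = res (U k) (mon P)" by (simp add: res_mon)
      thus "mon P \<in> res (U k) ` cocyc True" using U P by blast
    qed
    ultimately have "mon ` U k \<subseteq> pm.span (res (U k) ` F \<union> G)"
      using assms(2) unfolding R.span_image by blast
    from card_le_of_spanned[OF this] assms(1) G(1)
    have "finite (U k)" "card (U k) \<le> card (res (U k) ` F \<union> G)" by auto
    moreover have "card (res (U k) ` F \<union> G) \<le> card F + card G"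
      using card_Un_le[of "res (U k) ` F" G] card_image_le[OF assms(1), of "res (U k)"] by linarith
    ultimately show ?thesis by simp
  qed
  have fE: "finite evens" using finite_X by simp
  have "res (U 1) (d a) = 0" if a: "a \<in> A" for a
  proof -
    have "M \<notin> U 1" if M: "M \<in> Poly_Mapping.keys (d a)" for M
    proof -
      obtain L where "step L M" by (rule keys_d[OF a M])
      thus ?thesis by (simp add: step_def U_def)
    qed
    thus ?thesis unfolding res_eq_0_iff by blast
  qed
  hence "res (U 1) ` d ` A \<subseteq> pm.span {}" by auto
  from bound[OF _ this] have b1: "finite (U 1)" "card (U 1) \<le> card F" by auto
  have c1: "card (insert {#} ((\<lambda>x. {#x#}) ` evens)) = card evens + 1"
    using fE by (subst card_insert_disjoint) (auto simp: card_image inj_on_def)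
  have "insert {#} ((\<lambda>x. {#x#}) ` evens) \<subseteq> U 1" by (auto simp: U_def EvenMon_def)
  from card_mono[OF b1(1) this] show "card evens + 1 \<le> card F" using b1(2) unfolding c1 by linarith
  \<comment> \<open>A step lengthens words, so a word of length 2 arises only from a monomial of
    length at most 1. Apart from single odd generators these are even words, which \<open>d\<close>
    kills.\<close>
  let ?G = "(\<lambda>y. res (U 2) (d (mon {#y#}))) ` odds"
  have "res (U 2) (d a) \<in> pm.span ?G" if a: "a \<in> A" for a
  proof -
    let ?O = "(\<lambda>y. {#y#}) ` odds"
    interpret L: Vector_Spaces.linear qscale qscale "\<lambda>f. res (U 2) (d f)"
      by (rule lin_comp[OF lin_d lin_res])
    have "res (U 2) (d a) = res (U 2) (d (res ?O a))"
    proof (rule res_lin_cong[OF lin_d])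
      fix M assume M: "M \<in> Poly_Mapping.keys a - ?O"
      hence MM: "M \<in> Mon" using a by (auto simp: supp_def)
      have "M' \<notin> U 2" if M': "M' \<in> Poly_Mapping.keys (d (mon M))" for M'
      proof
        assume "M' \<in> U 2"
        moreover have "step M M'" by (rule step_d[OF MM M'])
        ultimately have "size M \<le> 1" by (simp add: U_def step_def)
        hence "size M = 0 \<or> size M = 1" by linarith
        then consider "M = {#}" | x where "M = {#x#}" using size_1_singleton_mset by auto
        hence "M \<in> EvenMon" using M MM by cases (auto simp: EvenMon_def monomials_def)
        thus False using M' d_EvenMon by simp
      qed
      thus "Poly_Mapping.keys (d (mon M)) \<inter> U 2 = {}" by blast
    qed
    moreover have "res ?O a \<in> pm.span (mon ` ?O)" by (simp add: supp_def flip: supp_eq_span)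
    ultimately have "res (U 2) (d a) \<in> (\<lambda>f. res (U 2) (d f)) ` pm.span (mon ` ?O)" by blast
    thus ?thesis by (simp add: L.span_image[symmetric] image_image)
  qed
  hence "res (U 2) ` d ` A \<subseteq> pm.span ?G" by blast
  from bound[OF _ this] finite_X have b2: "finite (U 2)" "card (U 2) \<le> card F + card ?G" by auto
  have cG: "card ?G \<le> card odds" using finite_X by (intro card_image_le) simp
  \<comment> \<open>Words of length 2 are counted as pairs with x \<le> y: the two triangles cover
    the square of \<open>evens\<close> and meet in its diagonal.\<close>
  let ?D = "{(x, y). x \<in> evens \<and> y \<in> evens \<and> x \<le> y}"
  let ?D' = "{(x, y). x \<in> evens \<and> y \<in> evens \<and> y \<le> x}"
  have fD: "finite ?D" "finite ?D'"
    by (rule finite_subset[of _ "evens \<times> evens"]; use fE in auto)+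
  have "card ?D' = card ?D"
    by (rule bij_betw_same_card[of prod.swap]) (auto simp: bij_betw_def inj_on_def image_iff)
  moreover have "?D \<union> ?D' = evens \<times> evens" by auto
  moreover have "?D \<inter> ?D' = (\<lambda>x. (x, x)) ` evens" by auto
  ultimately have cD: "2 * card ?D = card evens * card evens + card evens"
    using card_Un_Int[OF fD] fE by (simp add: card_image inj_on_def card_cartesian_product)
  let ?V = "(\<lambda>(x, y). {#x, y#}) ` ?D"
  have "inj_on (\<lambda>(x, y). {#x, y#}) ?D"
    by (auto simp: inj_on_def add_eq_conv_ex)
  hence cV: "card ?V = card ?D" by (rule card_image)
  have c2: "card (insert {#} ((\<lambda>x. {#x#}) ` evens) \<union> ?V) = card (insert {#} ((\<lambda>x. {#x#}) ` evens)) + card ?V"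
    using fE fD by (intro card_Un_disjoint) auto
  have "insert {#} ((\<lambda>x. {#x#}) ` evens) \<union> ?V \<subseteq> U 2"
    by (auto simp: U_def EvenMon_def)
  from card_mono[OF b2(1) this] have "card evens + 1 + card ?D \<le> card (U 2)" unfolding c2 c1 cV .
  thus "card evens * card evens + 3 * card evens + 2 \<le> 2 * card F + 2 * card odds"
    using cD b2(2) cG by linarith
qed

theorem card_generators_le:
  assumes F: "finite F" "{a \<in> A. d a = 0} \<subseteq> pm.span (F \<union> d ` A)"
  shows "card X \<le> card F"
proof -
  have F': "cyc {} \<subseteq> pm.span (F \<union> bnd {})" using F(2) by (simp add: cyc_empty bnd_empty)
  obtain \<kappa> where K: "lin \<kappa>" "\<And>v. \<kappa> v = 0 \<longleftrightarrow> v \<in> d ` A"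
    using pm.exists_linear_with_kernel[OF subspace_image_d[OF subspace_supp]] by blast
  interpret K: Vector_Spaces.linear qscale qscale \<kappa> by (rule K(1))
  have "\<kappa> ` (F \<union> d ` A) \<subseteq> insert 0 (\<kappa> ` F)" using K(2) by auto
  hence "pm.span (\<kappa> ` (F \<union> d ` A)) \<subseteq> pm.span (insert 0 (\<kappa> ` F))" by (rule pm.span_mono)
  hence sp: "\<kappa> ` {a \<in> A. d a = 0} \<subseteq> pm.span (\<kappa> ` F)"
    using F(2) unfolding K.span_image pm.span_insert_0 by blast
  have coc: "cocyc b \<subseteq> {a \<in> A. d a = 0}" for b by (auto simp: cocyc_def supp_def par_def)
  have scoc: "pm.subspace (cocyc b)" for b unfolding cocyc_def by (rule subspace_kernel[OF lin_d subspace_supp])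
  have spb: "\<kappa> ` cocyc b \<subseteq> pm.span (\<kappa> ` F)" for b using coc sp by blast
  have fK: "finite (\<kappa> ` F)" using F(1) by simp
  \<comment> \<open>The count of short words requires a spanning set for the even cohomology alone,
    of size equal to its dimension; \<open>E\<close> lifts a basis of it.\<close>
  obtain E where E: "E \<subseteq> cocyc True" "finite E" "\<kappa> ` cocyc True \<subseteq> pm.span (\<kappa> ` E)"
    "card E = pm.dim (\<kappa> ` cocyc True)"
    using pm.basis_of_image[OF spb fK] by metis
  have "cocyc True \<subseteq> pm.span (E \<union> d ` A)"
  proof
    fix z assume "z \<in> cocyc True"
    then obtain y where y: "y \<in> pm.span E" "\<kappa> z = \<kappa> y" using E(3) by (auto simp: K.span_image)
    have "z - y \<in> d ` A" using y(2) K(2)[of "z - y"] by (simp add: K.diff)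
    hence "(z - y) + y \<in> pm.span (E \<union> d ` A)"
      using y(1) by (intro pm.span_add) (auto intro: pm.span_mono[THEN subsetD] pm.span_base)
    thus "z \<in> pm.span (E \<union> d ` A)" by simp
  qed
  note words = short_even_words[OF E(2) this]
  \<comment> \<open>If an even and an odd cocycle differ by a boundary \<open>d c\<close>, the even
    component of this identity shows that the even cocycle is itself a boundary.\<close>
  have disj: "\<kappa> ` cocyc True \<inter> \<kappa> ` cocyc False \<subseteq> {0}"
  proof
    fix w assume "w \<in> \<kappa> ` cocyc True \<inter> \<kappa> ` cocyc False"
    then obtain a b where ab: "a \<in> cocyc True" "b \<in> cocyc False" "w = \<kappa> a" "w = \<kappa> b" by blast
    hence "a - b \<in> d ` A" using K(2)[of "a - b"] by (simp add: K.diff)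
    then obtain c where c: "c \<in> A" "a - b = d c" by blast
    have "res (par True) a = a" using ab(1) by (simp add: cocyc_def supp_def res_id)
    moreover have "res (par True) b = 0" using ab(2) by (force simp: cocyc_def supp_def res_eq_0_iff par_def)
    ultimately have "a = res (par True) (d c)" by (simp add: c(2)[symmetric] lin_diff[OF lin_res])
    also have "\<dots> = d (res (par False) c)" using res_par_d[OF c(1), of False] by simp
    finally have "a = d (res (par False) c)" .
    moreover have "res (par False) c \<in> A" using c(1) by (auto simp: supp_def)
    ultimately have "a \<in> d ` A" by blast
    thus "w \<in> {0}" using K(2) ab(3) by simp
  qed
  have "{x + y |x y. x \<in> \<kappa> ` cocyc True \<and> y \<in> \<kappa> ` cocyc False} \<subseteq> pm.span (\<kappa> ` F)"
    using spb by (auto intro!: pm.span_add)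
  from pm.dim_le_card[OF this fK]
    pm.dim_direct_sum[OF K.subspace_image[OF scoc] spb K.subspace_image[OF scoc] spb fK disj]
  have "pm.dim (\<kappa> ` cocyc True) + pm.dim (\<kappa> ` cocyc False) \<le> card (\<kappa> ` F)" by simp
  hence sum: "card E + pm.dim (\<kappa> ` cocyc False) \<le> card F"
    using E(4) card_image_le[OF F(1), of \<kappa>] by simp
  have "card evens + card odds \<le> card F"
  proof (rule dimension_arithmetic[OF sum words])
    show "2 ^ card odds + 2 ^ card evens \<le> 2 ^ card evens * card F + 1"
      by (rule power_bound[OF F(1) F'])
    show "card E = pm.dim (\<kappa> ` cocyc False)" if "card evens < card odds"
      unfolding E(4) by (rule euler_characteristic_zero[OF F(1) F' that K fK spb spb])
  qed
  moreover have "evens \<union> odds = X" by auto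
  hence "card X = card evens + card odds"
    using card_Un_disjoint[of evens odds] finite_X by auto
  ultimately show ?thesis by simp
qed

end

section \<open>Transfer to the module-theoretic definitions\<close>

lemma supp_mono: "S \<subseteq> T \<Longrightarrow> supp S \<subseteq> supp T"
  by (auto simp: supp_def)

text \<open>Both spans are the least subspace containing \<open>S\<close>, one taken inside the
  record structure and one inside the whole type.\<close>

lemma qspan_Lambda:
  assumes "S \<subseteq> supp (monomials X deg)"
  shows "qspan (Lambda X deg d) S = pm.span S"
proof -
  interpret V: vectorspace rat_field "Lambda X deg d" by (rule Lambda_vectorspace)
  have car: "carrier (Lambda X deg d) = supp (monomials X deg)" by (simp add: supp_def)
  have S: "S \<subseteq> carrier (Lambda X deg d)" unfolding car by (rule assms)
  show ?thesis
  proof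
    have "submodule rat_field (pm.span S) (Lambda X deg d)"
    proof (intro submodule.intro V.module_axioms)
      show "pm.span S \<subseteq> carrier (Lambda X deg d)"
        unfolding car by (rule pm.span_minimal[OF assms subspace_supp])
    qed (auto intro: pm.span_add pm.span_scale pm.span_zero)
    thus "qspan (Lambda X deg d) S \<subseteq> pm.span S"
      by (intro V.span_is_subset) (auto intro: pm.span_base)
    interpret N: submodule rat_field "qspan (Lambda X deg d) S" "Lambda X deg d"
      by (rule V.span_is_submodule[OF S])
    show "pm.span S \<subseteq> qspan (Lambda X deg d) S"
    proof (rule pm.span_minimal[OF V.in_own_span[OF S]], rule pm.subspaceI)
      show "0 \<in> qspan (Lambda X deg d) S" using N.zero_closed by simp
      show "f + g \<in> qspan (Lambda X deg d) S"
        if "f \<in> qspan (Lambda X deg d) S" "g \<in> qspan (Lambda X deg d) S" for f g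
        using N.m_closed[OF that] by simp
      show "qscale c f \<in> qspan (Lambda X deg d) S" if "f \<in> qspan (Lambda X deg d) S" for c f
        using N.smult_closed[OF _ that, of c] by simp
    qed
  qed
qed

lemma qspan_Lambda_subset:
  assumes "S \<subseteq> supp T" "T \<subseteq> monomials X deg"
  shows "qspan (Lambda X deg d) S \<subseteq> supp T"
proof -
  have "S \<subseteq> supp (monomials X deg)" using assms by (auto simp: supp_def)
  thus ?thesis using pm.span_minimal[OF assms(1) subspace_supp] by (simp add: qspan_Lambda)
qed

lemma singleton_monomial: "x \<in> X \<Longrightarrow> {#x#} \<in> monomials X deg"
  by (simp add: monomials_def)

lemma mon_in_generators: "x \<in> X \<Longrightarrow> mon {#x#} \<in> generators X deg (deg x)"
  by (simp add: generators_def)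

text \<open>One predicate \<open>P\<close> on degrees treats \<open>even_part\<close>,
  \<open>odd_part\<close> and, with the constant \<open>True\<close>, \<open>total_space\<close>
  uniformly.\<close>

lemma generators_part:
  "(\<Union>n\<in>{n. P n}. generators X deg n) \<subseteq> supp {{#x#} |x. x \<in> X \<and> P (deg x)}"
  by (auto simp: generators_def supp_def)

lemma singletons_monomials: "{{#x#} |x. x \<in> X \<and> P x} \<subseteq> monomials X deg"
  by (auto simp: monomials_def)

lemma generators_part_span:
  "qspan (Lambda X deg d) (\<Union>n\<in>{n. P n}. generators X deg n) \<subseteq> supp {{#x#} |x. x \<in> X \<and> P (deg x)}"
  by (rule qspan_Lambda_subset[OF generators_part singletons_monomials])

lemma mon_in_part:
  assumes "x \<in> X" "P (deg x)"
  shows "mon {#x#} \<in> qspan (Lambda X deg d) (\<Union>n\<in>{n. P n}. generators X deg n)"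
proof -
  have "(\<Union>n\<in>{n. P n}. generators X deg n) \<subseteq> supp (monomials X deg)"
    by (rule order_trans[OF generators_part supp_mono[OF singletons_monomials]])
  moreover have "mon {#x#} \<in> (\<Union>n\<in>{n. P n}. generators X deg n)"
    using mon_in_generators[OF assms(1)] assms(2) by blast
  ultimately show ?thesis by (simp add: qspan_Lambda pm.span_base)
qed

lemma total_space_part: "total_space A V = qspan A (\<Union>n\<in>{n. True}. V n)"
  by (simp add: total_space_def)

abbreviation words_of :: "'x set \<Rightarrow> ('x \<Rightarrow> nat) \<Rightarrow> 'x set \<Rightarrow> (nat \<Rightarrow> bool) \<Rightarrow> 'x multiset set" where
  "words_of X deg E R \<equiv> {M \<in> monomials X deg. set_mset M \<subseteq> E \<and> R (size M)}"

lemma word_supp: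
  assumes "set vs \<subseteq> supp {{#x#} |x. x \<in> X \<and> P x}"
  shows "word (Lambda X deg d) vs \<in> supp (words_of X deg {x. P x} (\<lambda>k. k = length vs))"
  using assms
proof (induction vs)
  case Nil thus ?case by (simp add: word_def supp_def)
next
  case (Cons v vs)
  have v: "v \<in> supp {{#x#} |x. x \<in> X \<and> P x}" using Cons.prems by simp
  have w: "word (Lambda X deg d) vs \<in> supp (words_of X deg {x. P x} (\<lambda>k. k = length vs))"
    using Cons by simp
  have eq: "word (Lambda X deg d) (v # vs) = Lambda_mult deg v (word (Lambda X deg d) vs)"
    by (simp add: word_def)
  have "Poly_Mapping.keys v \<subseteq> monomials X deg"
    using v singletons_monomials[of X P deg] by (auto simp: supp_def)
  hence "Poly_Mapping.keys (Lambda_mult deg v (word (Lambda X deg d) vs)) \<subseteq> monomials X deg"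
    using w by (intro Lambda_mult_closed) (auto simp: supp_def)
  thus ?case
    using keys_Lambda_mult[of deg v "word (Lambda X deg d) vs"] v w unfolding eq supp_def by fastforce
qed

lemma wordlength_ge_supp:
  assumes "W \<subseteq> supp {{#x#} |x. x \<in> X \<and> P x}"
  shows "wordlength_ge (Lambda X deg d) W n \<subseteq> supp (words_of X deg {x. P x} (\<lambda>k. n \<le> k))"
proof -
  have "wordlength_eq (Lambda X deg d) W k \<subseteq> supp (words_of X deg {x. P x} (\<lambda>j. j = k))" for k
    unfolding wordlength_eq_def
  proof (rule qspan_Lambda_subset)
    show "{word (Lambda X deg d) vs |vs. set vs \<subseteq> W \<and> length vs = k} \<subseteq>
        supp (words_of X deg {x. P x} (\<lambda>j. j = k))"
      using word_supp[of _ X P deg d] assms by fastforce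
  qed auto
  hence "(\<Union>k\<in>{n..}. wordlength_eq (Lambda X deg d) W k) \<subseteq> supp (words_of X deg {x. P x} (\<lambda>k. n \<le> k))"
    unfolding supp_def by fastforce
  thus ?thesis unfolding wordlength_ge_def by (rule qspan_Lambda_subset) auto
qed

lemma total_space_supp: "total_space (Lambda X deg d) (generators X deg) \<subseteq> supp {{#x#} |x. x \<in> X \<and> True}"
  unfolding total_space_part by (rule generators_part_span)

text \<open>Outside the carrier \<open>d\<close> is arbitrary; precomposing with \<open>res\<close> makes it linear on the whole type.\<close>

lemma hyperelliptic_model_of_Lambda:
  fixes X :: "'x::linorder set"
  assumes min: "minimal_sullivan_model (Lambda X deg d) (generators X deg)"
    and con: "one_connected (Lambda X deg d) (generators X deg)"
    and hyp: "hyperelliptic (Lambda X deg d) (generators X deg)"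
    and fin: "finite X"
  shows "hyperelliptic_model X deg (\<lambda>f. d (res (monomials X deg) f))"
proof -
  let ?L = "Lambda X deg d" and ?Mon = "monomials X deg"
  interpret C: cdga ?L using min by (simp add: minimal_sullivan_model_def)
  have car: "carrier ?L = supp ?Mon" by (simp add: supp_def)
  have gr: "grade ?L n = supp {M \<in> ?Mon. mdeg deg M = n}" for n by (simp add: supp_def)
  have resA: "res ?Mon f \<in> supp ?Mon" for f by (simp add: supp_def)
  have res: "res ?Mon f = f" if "f \<in> supp ?Mon" for f using that by (simp add: supp_def res_id)
  have lin: "lin (\<lambda>f. d (res ?Mon f))"
  proof (rule linI)
    show "d (res ?Mon (f + g)) = d (res ?Mon f) + d (res ?Mon g)" for f g
      using C.diff_add[of "res ?Mon f" "res ?Mon g"] resA[of f] resA[of g] unfolding car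
      by (simp add: lin_add[OF lin_res])
    show "d (res ?Mon (qscale c f)) = qscale c (d (res ?Mon f))" for c f
      using C.diff_smult[of "res ?Mon f" c] resA[of f] unfolding car by (simp add: lin_scale[OF lin_res])
  qed
  have mong: "d (mon M) \<in> supp {M' \<in> ?Mon. mdeg deg M' = Suc (mdeg deg M)}" if "M \<in> ?Mon" for M
  proof -
    have "mon M \<in> grade ?L (mdeg deg M)" using that by (simp add: gr supp_def)
    from C.diff_grade[OF this] show ?thesis by (simp only: gr Lambda_simps(8))
  qed
  have dA: "d f \<in> supp ?Mon" if f: "f \<in> supp ?Mon" for f
  proof -
    have "Poly_Mapping.keys (d (res ?Mon f)) \<subseteq> (\<Union>M\<in>Poly_Mapping.keys f. Poly_Mapping.keys (d (res ?Mon (mon M))))"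
      by (rule keys_lin[OF lin])
    also have "\<dots> \<subseteq> ?Mon"
    proof (rule UN_least)
      fix M assume "M \<in> Poly_Mapping.keys f"
      hence "M \<in> ?Mon" using f by (auto simp: supp_def)
      thus "Poly_Mapping.keys (d (res ?Mon (mon M))) \<subseteq> ?Mon"
        using mong[of M] res[of "mon M"] by (auto simp: supp_def)
    qed
    finally show ?thesis by (simp add: supp_def res[OF f, unfolded supp_def])
  qed
  show ?thesis
  proof (rule hyperelliptic_model.intro)
    show "finite X" by (rule fin)
    show "0 < deg x" if x: "x \<in> X" for x
    \<comment> \<open>A generator of degree 0 would be a nonzero element of the part of V in degree
      0, contrary to 1-connectedness.\<close>
    proof (rule ccontr)
      assume "\<not> 0 < deg x"
      hence "mon {#x#} \<in> {0}"
        using con mon_in_generators[OF x, of deg] by (simp add: one_connected_def)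
      thus False by (auto dest!: arg_cong[of _ _ Poly_Mapping.keys])
    qed
    show "lin (\<lambda>f. d (res ?Mon f))" by (rule lin)
    show "d (res ?Mon f) \<in> supp ?Mon" if "f \<in> supp ?Mon" for f
      using dA[OF that] res[OF that] by simp
    show "d (res ?Mon (d (res ?Mon f))) = 0" if "f \<in> supp ?Mon" for f
      using C.diff_diff[of f] that dA[OF that] unfolding car by (simp add: res)
    show "d (res ?Mon (Lambda_mult deg f g)) =
        Lambda_mult deg (d (res ?Mon f)) g + qscale ((- 1) ^ i) (Lambda_mult deg f (d (res ?Mon g)))"
      if f: "f \<in> supp {M \<in> ?Mon. mdeg deg M = i}" and g: "g \<in> supp ?Mon" for f g i
    proof -
      have fA: "f \<in> supp ?Mon" using f by (auto simp: supp_def)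
      have "Lambda_mult deg f g \<in> supp ?Mon" using fA g by (simp add: supp_def Lambda_mult_closed)
      thus ?thesis
        using C.leibniz[of f i g] f g res[OF fA] res[OF g] unfolding car gr by (simp add: res)
    qed
    show "d (res ?Mon (mon {#x#})) = 0" if x: "x \<in> X" "even (deg x)" for x
    proof -
      have "mon {#x#} \<in> even_part ?L (generators X deg)"
        unfolding even_part_def by (rule mon_in_part[where P = even and deg = deg, OF x])
      hence "diff ?L (mon {#x#}) \<in> {\<zero>\<^bsub>?L\<^esub>}" using hyp unfolding hyperelliptic_def by blast
      thus ?thesis using res[of "mon {#x#}"] singleton_monomial[OF x(1)] by (simp add: supp_def)
    qed
    show "d (res ?Mon (mon {#x#})) \<in>
        supp {M \<in> ?Mon. mdeg deg M = Suc (deg x) \<and> 2 \<le> size M \<and> (\<exists>y\<in>#M. even (deg y))}"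
      if x: "x \<in> X" "odd (deg x)" for x
    proof -
      have xM: "{#x#} \<in> ?Mon" by (rule singleton_monomial[OF x(1)])
      have 1: "d (mon {#x#}) \<in> supp {M \<in> ?Mon. mdeg deg M = Suc (deg x)}"
        using mong[OF xM] by simp
      have "mon {#x#} \<in> total_space ?L (generators X deg)"
        unfolding total_space_part by (rule mon_in_part[where P = "\<lambda>_. True" and deg = deg, OF x(1)]) simp
      hence "d (mon {#x#}) \<in> wordlength_ge ?L (total_space ?L (generators X deg)) 2"
        using min unfolding minimal_sullivan_model_def by auto
      hence 2: "d (mon {#x#}) \<in> supp (words_of X deg {x. True} (\<lambda>k. 2 \<le> k))"
        using wordlength_ge_supp[OF total_space_supp] by blast
      have "mon {#x#} \<in> odd_part ?L (generators X deg)"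
        unfolding odd_part_def by (rule mon_in_part[where P = odd and deg = deg, OF x])
      hence t: "d (mon {#x#}) \<in> tensor_image ?L (wordlength_ge ?L (even_part ?L (generators X deg)) 1)
          (wordlength_ge ?L (odd_part ?L (generators X deg)) 0)"
        using hyp unfolding hyperelliptic_def by auto
      \<comment> \<open>Wordlength at least 1 here puts an even generator into every monomial of the
        left factor; a product may cancel monomials but never removes a generator from one.\<close>
      have e: "wordlength_ge ?L (even_part ?L (generators X deg)) 1 \<subseteq>
          supp (words_of X deg {x. even (deg x)} (\<lambda>k. 1 \<le> k))"
        by (rule wordlength_ge_supp) (unfold even_part_def, rule generators_part_span)
      have o: "wordlength_ge ?L (odd_part ?L (generators X deg)) 0 \<subseteq>
          supp (words_of X deg {x. odd (deg x)} (\<lambda>k. 0 \<le> k))"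
        by (rule wordlength_ge_supp) (unfold odd_part_def, rule generators_part_span)
      have "tensor_image ?L (wordlength_ge ?L (even_part ?L (generators X deg)) 1)
          (wordlength_ge ?L (odd_part ?L (generators X deg)) 0) \<subseteq> supp {M \<in> ?Mon. \<exists>y\<in>#M. even (deg y)}"
        unfolding tensor_image_def
      proof (rule qspan_Lambda_subset, safe)
        fix s t assume "s \<in> wordlength_ge ?L (even_part ?L (generators X deg)) 1"
          "t \<in> wordlength_ge ?L (odd_part ?L (generators X deg)) 0"
        hence s: "s \<in> supp (words_of X deg {x. even (deg x)} (\<lambda>k. 1 \<le> k))" and
          t: "t \<in> supp (words_of X deg {x. odd (deg x)} (\<lambda>k. 0 \<le> k))" using e o by auto
        have "Poly_Mapping.keys (Lambda_mult deg s t) \<subseteq> ?Mon"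
          using s t by (intro Lambda_mult_closed) (auto simp: supp_def)
        moreover have "\<exists>y\<in>#M. even (deg y)" if "M \<in> Poly_Mapping.keys (Lambda_mult deg s t)" for M
        proof -
          obtain K N where KN: "M = K + N" "K \<in> Poly_Mapping.keys s"
            using keys_Lambda_mult[of deg s t] \<open>M \<in> Poly_Mapping.keys (Lambda_mult deg s t)\<close> by blast
          have "K \<in> words_of X deg {x. even (deg x)} (\<lambda>k. 1 \<le> k)" using s KN(2) unfolding supp_def by blast
          hence K: "set_mset K \<subseteq> {x. even (deg x)}" "K \<noteq> {#}" by auto
          obtain y where y: "y \<in># K" using K(2) by (rule multiset_nonemptyE)
          hence "even (deg y)" using K(1) by blast
          thus ?thesis unfolding KN(1) using y by (intro bexI[of _ y]) simp_all
        qed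
        ultimately have "Poly_Mapping.keys (Lambda_mult deg s t) \<subseteq> {M \<in> ?Mon. \<exists>y\<in>#M. even (deg y)}" by blast
        thus "s \<otimes>\<^bsub>?L\<^esub> t \<in> supp {M \<in> ?Mon. \<exists>y\<in>#M. even (deg y)}"
          unfolding supp_def Lambda_simps(2) by (rule CollectI)
      qed
      hence "d (mon {#x#}) \<in> supp {M \<in> ?Mon. \<exists>y\<in>#M. even (deg y)}" using t by blast
      hence "d (mon {#x#}) \<in> supp {M \<in> ?Mon. mdeg deg M = Suc (deg x) \<and> 2 \<le> size M \<and> (\<exists>y\<in>#M. even (deg y))}"
        using 1 2 unfolding supp_def by blast
      moreover have "res ?Mon (mon {#x#}) = mon {#x#}" using xM by (intro res) (simp add: supp_def)
      ultimately show ?thesis by (simp only:)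
    qed
  qed
qed

section \<open>Dimensions of the generators and of cohomology\<close>

text \<open>\<open>X\<close> is finite because the single generators are independent inside a
  finitely spanned space. \<open>dim\<close> is the least size of a spanning set, so the generators
  themselves witness the upper bound.\<close>

lemma total_space_finite:
  assumes "qfin_dim (Lambda X deg d) (total_space (Lambda X deg d) (generators X deg))"
  shows "finite X"
    and "qdim (Lambda X deg d) (total_space (Lambda X deg d) (generators X deg)) \<le> card X"
proof -
  let ?L = "Lambda X deg d" and ?W = "total_space (Lambda X deg d) (generators X deg)"
  interpret V: vectorspace rat_field ?L by (rule Lambda_vectorspace)
  have gA: "(\<Union>n. generators X deg n) \<subseteq> supp (monomials X deg)"
    using order_trans[OF generators_part[of X deg "\<lambda>_. True"] supp_mono[OF singletons_monomials]] by simp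
  have W: "?W = pm.span (\<Union>n. generators X deg n)"
    unfolding total_space_def by (rule qspan_Lambda[OF gA])
  have car: "carrier ?L = supp (monomials X deg)" by (simp add: supp_def)
  have sub: "submodule rat_field ?W ?L"
    unfolding total_space_def by (rule V.span_is_submodule) (use gA in \<open>simp only: car\<close>)
  have WA: "?W \<subseteq> supp (monomials X deg)" using sub unfolding submodule_def car by blast
  have vs: "vectorspace rat_field (?L\<lparr>carrier := ?W\<rparr>)"
    by (rule V.subspace_is_vs) (intro VectorSpace.subspace.intro V.vectorspace_axioms sub)
  have span: "LinearCombinations.module.span rat_field (?L\<lparr>carrier := ?W\<rparr>) S = pm.span S" if "S \<subseteq> ?W" for S
    using V.span_li_not_depend(1)[OF that sub] qspan_Lambda[of S X deg d] that WA by auto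
  have monW: "mon {#x#} \<in> ?W" if "x \<in> X" for x
    unfolding W using mon_in_generators[OF that, of deg] by (intro pm.span_base) blast
  obtain S where S: "finite S" "S \<subseteq> ?W" "pm.span S = ?W"
    using assms span unfolding vectorspace.fin_dim_def[OF vs] by auto
  have "mon ` (\<lambda>x. {#x#}) ` X \<subseteq> pm.span S" using monW S(3) by auto
  hence "finite ((\<lambda>x. {#x#}) ` X)" using card_le_of_spanned(1)[OF _ S(1)] by blast
  thus fX: "finite X" by (rule finite_imageD) (simp add: inj_on_def)
  let ?G = "mon ` (\<lambda>x. {#x#}) ` X"
  have G: "?G \<subseteq> ?W" using monW by auto
  have "pm.span ?G = ?W"
  proof
    show "pm.span ?G \<subseteq> ?W" unfolding W using G W by (intro pm.span_minimal) auto
    have "(\<Union>n. generators X deg n) \<subseteq> pm.span ?G"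
      unfolding supp_eq_span[symmetric] by (auto simp: generators_def supp_def)
    thus "?W \<subseteq> pm.span ?G" unfolding W by (intro pm.span_minimal) auto
  qed
  moreover have "card ?G = card X"
    by (simp add: card_image inj_mono inj_on_def)
  ultimately show "qdim ?L ?W \<le> card X"
    unfolding vectorspace.dim_def[OF vs] using G fX span[OF G]
    by (intro Least_le exI[of _ ?G]) simp
qed

lemma cosets_of_coboundaries:
  fixes X :: "'x::linorder set" and deg :: "'x \<Rightarrow> nat" and d :: "'x lambda \<Rightarrow> 'x lambda"
  defines "L \<equiv> Lambda X deg d"
  shows "carrier (cohomology L) = (\<lambda>a. (\<lambda>b. b + a) ` coboundaries L) ` cocycles L"
    and "\<zero>\<^bsub>cohomology L\<^esub> = coboundaries L"
    and "K \<oplus>\<^bsub>cohomology L\<^esub> N = {k + n |k n. k \<in> K \<and> n \<in> N}"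
    and "c \<odot>\<^bsub>cohomology L\<^esub> K = (\<Union>k\<in>K. (\<lambda>b. b + qscale c k) ` coboundaries L)"
  by (auto simp: cohomology_def cohomology_ring_def FactRing_def A_RCOSETS_defs a_r_coset_def r_coset_def
    set_add_def set_mult_def L_def)

text \<open>Cohomology consists of cosets, outside the vector space \<open>pm\<close>. A smallest
  spanning set of cosets is therefore lifted to representatives \<open>F\<close>; the cosets of the
  span of \<open>F\<close> form a submodule containing that spanning set, hence everything.\<close>

lemma spanning_cocycles:
  fixes X :: "'x::linorder set" and deg :: "'x \<Rightarrow> nat" and d :: "'x lambda \<Rightarrow> 'x lambda"
  defines "L \<equiv> Lambda X deg d"
  assumes "cdga L" and fin: "qfin_dim (cohomology L) (carrier (cohomology L))"
  obtains F where "finite F" "card F \<le> qdim (cohomology L) (carrier (cohomology L))"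
    "cocycles L \<subseteq> pm.span (F \<union> coboundaries L)"
proof -
  interpret C: cdga L by fact
  define Z where "Z = cocycles L"
  define B where "B = coboundaries L"
  define H where "H = cohomology L"
  define cos where "cos a = (\<lambda>b. b + a) ` B" for a
  have car: "carrier L = supp (monomials X deg)" by (simp add: L_def supp_def)
  note A = subspace_supp[of "monomials X deg"]
  have d_add: "d (f + g) = d f + d g" if "f \<in> carrier L" "g \<in> carrier L" for f g
    using C.diff_add[OF that] by (simp add: L_def)
  have d_scale: "d (qscale c f) = qscale c (d f)" if "f \<in> carrier L" for c f
    using C.diff_smult[OF that] by (simp add: L_def)
  have d0: "d 0 = 0" using d_scale[of 0 0] pm.subspace_0[OF A] by (simp add: car)
  have Z: "Z = {f \<in> carrier L. d f = 0}" by (simp add: Z_def cocycles_def L_def)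
  have B: "B = d ` carrier L" by (simp add: B_def coboundaries_def L_def)
  have sZ: "pm.subspace Z"
  proof (rule pm.subspaceI)
    show "0 \<in> Z" using pm.subspace_0[OF A] d0 by (simp add: Z car)
    show "f + g \<in> Z" if "f \<in> Z" "g \<in> Z" for f g
      using that pm.subspace_add[OF A, of f g] d_add[of f g] by (simp add: Z car)
    show "qscale c f \<in> Z" if "f \<in> Z" for c f
      using that pm.subspace_scale[OF A, of f c] d_scale[of f c] by (simp add: Z car)
  qed
  have sB: "pm.subspace B"
  proof (rule pm.subspaceI)
    show "0 \<in> B" unfolding B using pm.subspace_0[OF A] d0 by (intro image_eqI[of _ _ 0]) (simp_all add: car)
    show "f + g \<in> B" if fg: "f \<in> B" "g \<in> B" for f g
    proof -
      obtain a b where ab: "a \<in> carrier L" "f = d a" "b \<in> carrier L" "g = d b" using fg unfolding B by blast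
      hence "f + g = d (a + b)" "a + b \<in> carrier L"
        using d_add[of a b] pm.subspace_add[OF A, of a b] by (simp_all add: car)
      thus ?thesis unfolding B by blast
    qed
    show "qscale c f \<in> B" if f: "f \<in> B" for c f
    proof -
      obtain a where "a \<in> carrier L" "f = d a" using f unfolding B by blast
      hence "qscale c f = d (qscale c a)" "qscale c a \<in> carrier L"
        using d_scale[of a c] pm.subspace_scale[OF A, of a c] by (simp_all add: car)
      thus ?thesis unfolding B by blast
    qed
  qed
  have cos_eq: "cos a = cos b \<longleftrightarrow> a - b \<in> B" for a b
  proof
    assume "cos a = cos b"
    moreover have "a \<in> cos a" unfolding cos_def using pm.subspace_0[OF sB] by force
    ultimately obtain c where "c \<in> B" "a = c + b" by (auto simp: cos_def)
    thus "a - b \<in> B" by simp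
  next
    assume ab: "a - b \<in> B"
    have "cos u \<subseteq> cos v" if "u - v \<in> B" for u v
    proof
      fix w assume "w \<in> cos u"
      then obtain c where "c \<in> B" "w = c + u" by (auto simp: cos_def)
      hence "w = (c + (u - v)) + v" "c + (u - v) \<in> B" using that pm.subspace_add[OF sB] by auto
      thus "w \<in> cos v" unfolding cos_def by (rule image_eqI)
    qed
    moreover have "b - a \<in> B" using pm.subspace_neg[OF sB ab] by simp
    ultimately show "cos a = cos b" using ab by blast
  qed
  have Hcar: "carrier H = cos ` Z"
    by (simp add: H_def cosets_of_coboundaries L_def Z_def B_def cos_def[abs_def])
  have Hzero: "\<zero>\<^bsub>H\<^esub> = cos 0"
    by (simp add: H_def cosets_of_coboundaries L_def B_def cos_def)
  have Hadd: "cos a \<oplus>\<^bsub>H\<^esub> cos b = cos (a + b)" for a b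
  proof -
    have "cos a \<oplus>\<^bsub>H\<^esub> cos b = {k + n |k n. k \<in> cos a \<and> n \<in> cos b}"
      by (simp add: H_def cosets_of_coboundaries L_def)
    also have "\<dots> = cos (a + b)"
    proof safe
      fix k n assume "k \<in> cos a" "n \<in> cos b"
      then obtain u v where "u \<in> B" "k = u + a" "v \<in> B" "n = v + b" by (auto simp: cos_def)
      hence "k + n = (u + v) + (a + b)" "u + v \<in> B" using pm.subspace_add[OF sB] by auto
      thus "k + n \<in> cos (a + b)" by (auto simp: cos_def)
    next
      fix w assume "w \<in> cos (a + b)"
      then obtain u where u: "u \<in> B" "w = u + (a + b)" by (auto simp: cos_def)
      have "b \<in> cos b" unfolding cos_def using pm.subspace_0[OF sB] by force
      moreover have "u + a \<in> cos a" using u(1) by (auto simp: cos_def)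
      ultimately show "\<exists>k n. w = k + n \<and> k \<in> cos a \<and> n \<in> cos b"
        using u(2) by (metis add.assoc)
    qed
    finally show ?thesis .
  qed
  have Hsmult: "c \<odot>\<^bsub>H\<^esub> cos a = cos (qscale c a)" for c a
  proof -
    have "c \<odot>\<^bsub>H\<^esub> cos a = (\<Union>k\<in>cos a. cos (qscale c k))"
      by (simp add: H_def cosets_of_coboundaries L_def B_def cos_def)
    \<comment> \<open>Scalar multiplication is a union over all representatives of the coset; they
      differ by coboundaries, so all members of the union coincide.\<close>
    also have "\<dots> = (\<Union>k\<in>cos a. cos (qscale c a))"
    proof (intro SUP_cong refl)
      fix k assume "k \<in> cos a"
      then obtain u where "u \<in> B" "k = u + a" by (auto simp: cos_def)
      thus "cos (qscale c k) = cos (qscale c a)"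
        using pm.subspace_scale[OF sB, of u c] by (simp add: cos_eq scale_add)
    qed
    also have "\<dots> = cos (qscale c a)" using pm.subspace_0[OF sB] by (auto simp: cos_def)
    finally show ?thesis .
  qed
  have "cring rat_field" using rat_field_field by (simp add: field_def domain_def)
  hence mod: "Module.module rat_field H"
  proof (rule module_criteria)
    show "\<zero>\<^bsub>H\<^esub> \<in> carrier H" using pm.subspace_0[OF sZ] by (auto simp: Hzero Hcar)
    show "\<forall>v w. v \<in> carrier H \<and> w \<in> carrier H \<longrightarrow> v \<oplus>\<^bsub>H\<^esub> w \<in> carrier H"
      using pm.subspace_add[OF sZ] by (auto simp: Hcar Hadd)
    show "\<forall>v\<in>carrier H. \<exists>n\<in>carrier H. v \<oplus>\<^bsub>H\<^esub> n = \<zero>\<^bsub>H\<^esub>"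
    proof
      fix v assume "v \<in> carrier H"
      then obtain a where a: "a \<in> Z" "v = cos a" by (auto simp: Hcar)
      have "v \<oplus>\<^bsub>H\<^esub> cos (- a) = \<zero>\<^bsub>H\<^esub>" by (simp add: a(2) Hadd Hzero)
      thus "\<exists>n\<in>carrier H. v \<oplus>\<^bsub>H\<^esub> n = \<zero>\<^bsub>H\<^esub>" using pm.subspace_neg[OF sZ a(1)] by (auto simp: Hcar)
    qed
    show "\<forall>c v. c \<in> carrier rat_field \<and> v \<in> carrier H \<longrightarrow> c \<odot>\<^bsub>H\<^esub> v \<in> carrier H"
      using pm.subspace_scale[OF sZ] by (auto simp: Hcar Hsmult)
  qed (auto simp: Hcar Hadd Hzero Hsmult add_ac scale_add pm.scale_left_distrib)
  interpret H: Module.module rat_field H by (rule mod)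
  have vs: "vectorspace rat_field H" by (intro vectorspace.intro mod rat_field_field)
  have self: "H\<lparr>carrier := carrier H\<rparr> = H" by simp
  have fin': "vectorspace.fin_dim rat_field H" using fin unfolding H_def[symmetric] self .
  \<comment> \<open>\<open>dim\<close> is by definition the least size of a finite spanning set, and
    \<open>LeastI_ex\<close> provides one that attains it.\<close>
  let ?P = "\<lambda>n S. finite S \<and> card S = n \<and> S \<subseteq> carrier H \<and> LinearCombinations.module.span rat_field H S = carrier H"
  have "\<exists>n S. ?P n S" using fin' unfolding vectorspace.fin_dim_def[OF vs] by blast
  hence "\<exists>S. ?P (LEAST n. \<exists>S. ?P n S) S" by (rule LeastI_ex)
  then obtain G where G: "finite G" "card G = vectorspace.dim rat_field H" "G \<subseteq> carrier H"
    "LinearCombinations.module.span rat_field H G = carrier H"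
    unfolding vectorspace.dim_def[OF vs] by blast
  obtain F where F: "F \<subseteq> Z" "G = cos ` F" "inj_on cos F" using G(3) unfolding Hcar by (meson subset_image_inj)
  have fF: "finite F" "card F = card G" using F G(1) by (auto simp: finite_image_iff card_image)
  have spZ: "pm.span F \<subseteq> Z" by (rule pm.span_minimal[OF F(1) sZ])
  have "submodule rat_field (cos ` pm.span F) H"
  proof (intro submodule.intro mod)
    show "cos ` pm.span F \<subseteq> carrier H" using spZ by (auto simp: Hcar)
    show "\<zero>\<^bsub>H\<^esub> \<in> cos ` pm.span F" using pm.span_zero by (auto simp: Hzero)
    show "v \<oplus>\<^bsub>H\<^esub> w \<in> cos ` pm.span F" if "v \<in> cos ` pm.span F" "w \<in> cos ` pm.span F" for v w
      using that by (auto simp: Hadd intro!: imageI pm.span_add)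
    show "c \<odot>\<^bsub>H\<^esub> v \<in> cos ` pm.span F" if "v \<in> cos ` pm.span F" for c v
      using that by (auto simp: Hsmult intro!: imageI pm.span_scale)
  qed
  moreover have "G \<subseteq> cos ` pm.span F" unfolding F(2) by (intro image_mono pm.span_superset)
  ultimately have "carrier H \<subseteq> cos ` pm.span F" unfolding G(4)[symmetric] by (intro H.span_is_subset)
  hence span: "cos ` Z \<subseteq> cos ` pm.span F" unfolding Hcar .
  have "Z \<subseteq> pm.span (F \<union> B)"
  proof
    fix z assume "z \<in> Z"
    then obtain y where y: "y \<in> pm.span F" "cos z = cos y" using span by blast
    hence "z - y \<in> B" by (simp add: cos_eq)
    hence "z - y \<in> pm.span (F \<union> B)" by (auto intro: pm.span_base)
    moreover have "y \<in> pm.span (F \<union> B)" using y(1) pm.span_mono[of F "F \<union> B"] by blast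
    ultimately have "(z - y) + y \<in> pm.span (F \<union> B)" by (rule pm.span_add)
    thus "z \<in> pm.span (F \<union> B)" by simp
  qed
  thus ?thesis
    using that[of F] fF G(2) unfolding H_def[symmetric] self Z_def[symmetric] B_def[symmetric] by simp
qed

theorem proposition6:
  fixes X :: "'x::linorder set"
    and deg :: "'x \<Rightarrow> nat"
    and d :: "'x lambda \<Rightarrow> 'x lambda"
  assumes "minimal_sullivan_model (Lambda X deg d) (generators X deg)"
    and "one_connected (Lambda X deg d) (generators X deg)"
    and "elliptic (Lambda X deg d) (generators X deg)"
    and "formal TYPE('c) (Lambda X deg d)"
    and "hyperelliptic (Lambda X deg d) (generators X deg)"
  shows "qdim (cohomology (Lambda X deg d)) (carrier (cohomology (Lambda X deg d)))
           \<ge> qdim (Lambda X deg d) (total_space (Lambda X deg d) (generators X deg))"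
proof -
  let ?L = "Lambda X deg d" and ?d = "\<lambda>f. d (res (monomials X deg) f)"
  have ell: "qfin_dim ?L (total_space ?L (generators X deg))"
    "qfin_dim (cohomology ?L) (carrier (cohomology ?L))"
    using assms(3) by (simp_all only: elliptic_def)
  note fin = total_space_finite[OF ell(1)]
  interpret M: hyperelliptic_model X deg ?d
    by (rule hyperelliptic_model_of_Lambda[OF assms(1,2,5) fin(1)])
  have cdga: "cdga ?L" using assms(1) by (simp add: minimal_sullivan_model_def)
  obtain F where F: "finite F" "card F \<le> qdim (cohomology ?L) (carrier (cohomology ?L))"
    "cocycles ?L \<subseteq> pm.span (F \<union> coboundaries ?L)"
    using spanning_cocycles[OF cdga ell(2)] by blast
  have res: "res (monomials X deg) f = f" if "f \<in> supp (monomials X deg)" for f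
    using that by (simp add: supp_def res_id)
  have "cocycles ?L = {a \<in> supp (monomials X deg). ?d a = 0}"
    using res by (auto simp: cocycles_def supp_def)
  moreover have "coboundaries ?L = ?d ` supp (monomials X deg)"
    using res by (auto simp: coboundaries_def supp_def image_iff)
  ultimately have "card X \<le> card F" using M.card_generators_le[OF F(1)] F(3) by simp
  thus ?thesis using F(2) fin(2) by linarith
qed

end
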